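(* Let $0<r<1/2$ and $s=\frac{r}{2-4r}$. The balls $U=\mathbb B^s_{2\infty}(P_0)$, $P_0>0$, in the Besov space $\mathbb B^s_{2\infty}$ are perfect maxisets for the kernel-based test statistics; that is, for every sequence $f_n\in\mathbb L_2^{per}(\mathbb R^1)$ with $cn^{-r}\le\|f_n\|\le Cn^{-r}$ (constants $0<c\le C$): (i) $f_n$ is consistent if and only if there are $\gamma>0$, constants $0<c_2\le C_2$ and a sequence $f_{1n}\in\gamma U$ with $c_2n^{-r}\le\|f_{1n}\|\le C_2n^{-r}$ such that $\|f_n\|^2=\|f_{1n}\|^2+\|f_n-f_{1n}\|^2$; (ii) $f_n$ is inconsistent if and only if for every $\gamma>0$ and every sequence $f_{1n}\in\gamma U$ with $c_2n^{-r}\le\|f_{1n}\|\le C_2n^{-r}$ (for some constants $0<c_2\le C_2$), the sequence of alternatives $f_n+f_{1n}$ is consistent and $\|f_n+f_{1n}\|^2=\|f_n\|^2+\|f_{1n}\|^2+o(n^{-2r})$ as $n\to\infty$.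
   Context: Model: one observes $dY_n(t)=f(t)dt+\frac{\sigma}{\sqrt n}dw(t)$, $t\in[0,1]$, $\sigma>0$, $dw$ Gaussian white noise, where the unknown signal $f$ belongs to $\mathbb L_2^{per}(\mathbb R^1)$, the set of (real) 1-periodic functions whose restriction to $[0,1)$ is in $\mathbb L_2(0,1)$; $\|\cdot\|$ is the $\mathbb L_2(0,1)$ norm. Signal and noise are extended 1-periodically to the real line. The hypothesis is $H_0:f=0$. $\alpha(K_n)$, $\beta(K_n,f)$ are the type I error probability and the type II error probability at $f$ of a test $K_n$. A test is generated by $T_n$ if it rejects $H_0$ when $T_n$ exceeds a threshold. $a_n\asymp b_n$ means $ca_n\le b_n\le Ca_n$ for all $n$ with constants $0<c\le C$. Kernel-based statistics: $\hat f_{h_n}(t)=\frac1{h_n}\int_{-\infty}^\infty K\bigl(\frac{t-u}{h_n}\bigr)dY_n(u)$, $t\in(0,1)$ (with the periodic extension of $Y_n$), where $h_n>0$, $h_n\to0$, and $K$ is a bounded function supported in $[-1,1]$ with $K(t)=K(-t)$ and $\int K=1$. Then $T_n(Y_n)=nh_n^{1/2}\sigma^{-2}\kappa^{-1}\bigl(\|\hat f_{h_n}\|^2-\sigma^2(nh_n)^{-1}\|K\|^2\bigr)$, with $\kappa^2=2\int\bigl(\int K(t-s)K(s)ds\bigr)^2dt$ and $\|K\|^2=\int K^2$. Consistency: a sequence $f_n$ is consistent if for some choice of bandwidths $h_n\asymp n^{4r-2}$ there is a sequence of tests $K_n$ generated by $T_n$ with $\limsup_{n\to\infty}(\alpha(K_n)+\beta(K_n,f_n))<1$.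 It is inconsistent if for every choice of bandwidths $h_n\asymp n^{4r-2}$ every sequence of tests $K_n$ generated by $T_n$ satisfies $\liminf_{n\to\infty}(\alpha(K_n)+\beta(K_n,f_n))\ge1$. Balls: with $\phi_j(t)=\exp\{2\pi ijt\}$, $\mathbb B^s_{2\infty}(P_0)=\{f=\sum_{j\in\mathbb Z}\theta_j\phi_j:\ \sup_{\lambda>0}\lambda^{2s}\sum_{|j|>\lambda}|\theta_j|^2\le P_0\}$ (real-valued $f$), and $\gamma U=\{\gamma g:g\in U\}$. *)

theory Defs
  imports "HOL-Probability.Probability" "HOL-Library.Landau_Symbols"
begin

subsection \<open>Periodic square-integrable functions\<close>

text \<open>Elements are Borel representatives, not classes; every class has one, and nothing
  below distinguishes functions that agree almost everywhere.\<close>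

definition L2_per :: "(real \<Rightarrow> real) set" where
  "L2_per = {f \<in> borel_measurable borel.
     (\<forall>t. f (t + 1) = f t) \<and> set_integrable lborel {0..<1} (\<lambda>t. (f t)\<^sup>2)}"

definition L2_inner :: "(real \<Rightarrow> real) \<Rightarrow> (real \<Rightarrow> real) \<Rightarrow> real" where
  "L2_inner f g = (LINT t:{0..<1}|lborel. f t * g t)"

definition L2_norm :: "(real \<Rightarrow> real) \<Rightarrow> real" where
  "L2_norm f = sqrt (LINT t:{0..<1}|lborel. (f t)\<^sup>2)"

definition fourier_basis :: "int \<Rightarrow> real \<Rightarrow> complex" where
  "fourier_basis j t = exp (2 * of_real pi * \<i> * of_int j * of_real t)"

definition fourier_coeff :: "(real \<Rightarrow> real) \<Rightarrow> int \<Rightarrow> complex" where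
  "fourier_coeff f j = (LINT t:{0..<1}|lborel. of_real (f t) * cnj (fourier_basis j t))"

text \<open>The coefficients are square-summable by Bessel's inequality, so the infinite sum is
  a genuine one.\<close>

definition besov_ball :: "real \<Rightarrow> real \<Rightarrow> (real \<Rightarrow> real) set" where
  "besov_ball s P\<^sub>0 = {f \<in> L2_per. \<forall>l>0.
     l powr (2 * s) * (\<Sum>\<^sub>\<infinity>j\<in>{j::int. \<bar>real_of_int j\<bar> > l}. (cmod (fourier_coeff f j))\<^sup>2) \<le> P\<^sub>0}"

definition scale_set :: "real \<Rightarrow> (real \<Rightarrow> real) set \<Rightarrow> (real \<Rightarrow> real) set" where
  "scale_set \<gamma> U = (\<lambda>g t. \<gamma> * g t) ` U"

text \<open>Sequences are indexed by \<open>n \<ge> 1\<close>; the value at \<open>0\<close> is never used.\<close>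

definition same_order :: "(nat \<Rightarrow> real) \<Rightarrow> (nat \<Rightarrow> real) \<Rightarrow> bool" where
  "same_order a b \<longleftrightarrow> (\<exists>c C. 0 < c \<and> c \<le> C \<and> (\<forall>n\<ge>1. c * b n \<le> a n \<and> a n \<le> C * b n))"

subsection \<open>White noise and the observation\<close>

text \<open>A realization \<open>y\<close> of the observation is identified with the functional
  \<open>g \<mapsto> \<integral>\<^sub>0\<^sup>1 g dy\<close>, and \<open>W \<omega> g\<close> is the Wiener integral of \<open>g\<close> against the white noise.
  The last axiom asks that \<open>W\<close> be a measurable process, so that path integrals such as the
  squared norm of a kernel estimator are random variables. It does not restrict the noise:
  with \<open>e\<^sub>k\<close> an orthonormal basis and \<open>\<xi>\<^sub>k\<close> the Gaussian coordinates, the pointwise limit of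
  \<open>\<Sum>k<N. \<langle>g, e\<^sub>k\<rangle> \<xi>\<^sub>k\<close> (and \<open>0\<close> where there is no limit) is such a version.\<close>

type_synonym observation = "(real \<Rightarrow> real) \<Rightarrow> real"

locale gaussian_white_noise = prob_space M for M :: "'w measure" +
  fixes W :: "'w \<Rightarrow> observation"
  assumes gaussian: "\<And>g. g \<in> L2_per \<Longrightarrow> L2_norm g > 0 \<Longrightarrow>
      distributed M lborel (\<lambda>\<omega>. W \<omega> g) (\<lambda>x. ennreal (normal_density 0 (L2_norm g) x))"
    and degenerate: "\<And>g. g \<in> L2_per \<Longrightarrow> L2_norm g = 0 \<Longrightarrow> AE \<omega> in M. W \<omega> g = 0"
    and linear: "\<And>f g a b. f \<in> L2_per \<Longrightarrow> g \<in> L2_per \<Longrightarrow>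
      AE \<omega> in M. W \<omega> (\<lambda>t. a * f t + b * g t) = a * W \<omega> f + b * W \<omega> g"
    and measurable_process: "\<And>g :: real \<Rightarrow> real \<Rightarrow> real.
      case_prod g \<in> borel_measurable (borel \<Otimes>\<^sub>M borel) \<Longrightarrow> (\<And>t. g t \<in> L2_per) \<Longrightarrow>
      (\<lambda>(t, \<omega>). W \<omega> (g t)) \<in> borel_measurable (borel \<Otimes>\<^sub>M M)"

text \<open>The observation \<open>dY\<^sub>n(t) = f(t) dt + (\<sigma> / \<surd>n) dw(t)\<close>.\<close>

definition observe ::
    "('w \<Rightarrow> observation) \<Rightarrow> real \<Rightarrow> nat \<Rightarrow> (real \<Rightarrow> real) \<Rightarrow> 'w \<Rightarrow> observation" where
  "observe W \<sigma> n f \<omega> = (\<lambda>g. L2_inner f g + \<sigma> / sqrt (real n) * W \<omega> g)"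

text \<open>The integral over the line of a compactly supported \<open>g\<close> against the 1-periodic
  extension of \<open>y\<close> is the integral over \<open>[0,1)\<close> of the periodization of \<open>g\<close>, in which only
  finitely many terms are non-zero.\<close>

definition line_integral :: "observation \<Rightarrow> (real \<Rightarrow> real) \<Rightarrow> real" where
  "line_integral y g = y (\<lambda>u. \<Sum>\<^sub>\<infinity>k::int. g (u + of_int k))"

subsection \<open>Kernel-based tests\<close>

definition admissible_kernel :: "(real \<Rightarrow> real) \<Rightarrow> bool" where
  "admissible_kernel K \<longleftrightarrow>
     K \<in> borel_measurable borel \<and> (\<exists>B. \<forall>t. \<bar>K t\<bar> \<le> B) \<and> (\<forall>t. t \<notin> {-1..1} \<longrightarrow> K t = 0) \<and>
     (\<forall>t. K (- t) = K t) \<and> (LINT t|lborel. K t) = 1"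

definition kernel_estimator ::
    "(real \<Rightarrow> real) \<Rightarrow> real \<Rightarrow> observation \<Rightarrow> real \<Rightarrow> real" where
  "kernel_estimator K h y t = 1 / h * line_integral y (\<lambda>u. K ((t - u) / h))"

definition kernel_kappa :: "(real \<Rightarrow> real) \<Rightarrow> real" where
  "kernel_kappa K =
     sqrt (2 * (LINT t|lborel. (LINT s|lborel. K (t - s) * K s)\<^sup>2))"

definition kernel_statistic ::
    "(real \<Rightarrow> real) \<Rightarrow> real \<Rightarrow> nat \<Rightarrow> real \<Rightarrow> observation \<Rightarrow> real" where
  "kernel_statistic K \<sigma> n h y =
     real n * sqrt h / (\<sigma>\<^sup>2 * kernel_kappa K) *
       ((LINT t:{0<..<1}|lborel. (kernel_estimator K h y t)\<^sup>2)
        - \<sigma>\<^sup>2 / (real n * h) * (LINT t|lborel. (K t)\<^sup>2))"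

text \<open>A test maps an observation to the decision to reject the hypothesis \<open>f = 0\<close>.\<close>

definition type_I_error ::
    "'w measure \<Rightarrow> ('w \<Rightarrow> observation) \<Rightarrow> real \<Rightarrow> nat \<Rightarrow> (observation \<Rightarrow> bool) \<Rightarrow> real" where
  "type_I_error M W \<sigma> n test =
     measure M {\<omega> \<in> space M. test (observe W \<sigma> n (\<lambda>_. 0) \<omega>)}"

definition type_II_error ::
    "'w measure \<Rightarrow> ('w \<Rightarrow> observation) \<Rightarrow> real \<Rightarrow> nat \<Rightarrow> (observation \<Rightarrow> bool) \<Rightarrow>
     (real \<Rightarrow> real) \<Rightarrow> real" where
  "type_II_error M W \<sigma> n test f =
     measure M {\<omega> \<in> space M. \<not> test (observe W \<sigma> n f \<omega>)}"

definition generated_tests ::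
    "(nat \<Rightarrow> observation \<Rightarrow> real) \<Rightarrow> (nat \<Rightarrow> observation \<Rightarrow> bool) \<Rightarrow> bool" where
  "generated_tests T tests \<longleftrightarrow>
     (\<exists>c :: nat \<Rightarrow> real. \<forall>n\<ge>1. \<forall>y. tests n y \<longleftrightarrow> T n y > c n)"

text \<open>For \<open>r < 1/2\<close> the two-sided bound forces \<open>h n \<longlonglongrightarrow> 0\<close>.\<close>

definition bandwidths :: "real \<Rightarrow> (nat \<Rightarrow> real) \<Rightarrow> bool" where
  "bandwidths r h \<longleftrightarrow>
     (\<forall>n\<ge>1. h n > 0) \<and> same_order h (\<lambda>n. real n powr (4 * r - 2))"

definition consistent ::
    "'w measure \<Rightarrow> ('w \<Rightarrow> observation) \<Rightarrow> real \<Rightarrow> (real \<Rightarrow> real) \<Rightarrow> real \<Rightarrow>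
     (nat \<Rightarrow> real \<Rightarrow> real) \<Rightarrow> bool" where
  "consistent M W \<sigma> K r f \<longleftrightarrow>
     (\<exists>h. bandwidths r h \<and>
       (\<exists>tests. generated_tests (\<lambda>n. kernel_statistic K \<sigma> n (h n)) tests \<and>
         limsup (\<lambda>n. ereal (type_I_error M W \<sigma> n (tests n)
                          + type_II_error M W \<sigma> n (tests n) (f n))) < 1))"

definition inconsistent ::
    "'w measure \<Rightarrow> ('w \<Rightarrow> observation) \<Rightarrow> real \<Rightarrow> (real \<Rightarrow> real) \<Rightarrow> real \<Rightarrow>
     (nat \<Rightarrow> real \<Rightarrow> real) \<Rightarrow> bool" where
  "inconsistent M W \<sigma> K r f \<longleftrightarrow>
     (\<forall>h. bandwidths r h \<longrightarrow>
       (\<forall>tests. generated_tests (\<lambda>n. kernel_statistic K \<sigma> n (h n)) tests \<longrightarrow>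
         liminf (\<lambda>n. ereal (type_I_error M W \<sigma> n (tests n)
                          + type_II_error M W \<sigma> n (tests n) (f n))) \<ge> 1))"

end

theory Submission
  imports Defs
begin

text \<open>
  In Fourier coordinates the statistic is \<open>n h\<^sup>1\<^sup>/\<^sup>2 \<Sum>\<^sub>j \<lambda>\<^sub>j\<^sup>2 (\<theta>\<^sub>j + \<sigma> n\<^sup>-\<^sup>1\<^sup>/\<^sup>2 \<xi>\<^sub>j)\<^sup>2\<close> up to constants, where
  \<open>\<lambda>\<^sub>j\<close> is the Fourier transform of the kernel at \<open>j h\<close> and the \<open>\<xi>\<^sub>j\<close> are independent standard
  normal variables. Passing from \<open>0\<close> to \<open>f\<close> shifts it by
  \<open>D = n h\<^sup>1\<^sup>/\<^sup>2 \<sigma>\<^sup>-\<^sup>2 \<kappa>\<^sup>-\<^sup>1 \<Sum>\<^sub>j \<lambda>\<^sub>j\<^sup>2 \<theta>\<^sub>j\<^sup>2\<close> plus a cross term of variance \<open>O(h\<^sup>1\<^sup>/\<^sup>2 D)\<close>. The null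
  distribution is tight and has a bounded concentration function, uniformly in \<open>n\<close>, so the error sum
  of the best threshold stays below \<open>1\<close> exactly as long as \<open>D\<close> stays away from \<open>0\<close>.

  Since \<open>\<lambda>\<close> is close to \<open>1\<close> near \<open>0\<close> and vanishes at infinity, and \<open>n h\<^sup>1\<^sup>/\<^sup>2\<close> is of order \<open>n\<^sup>2\<^sup>r\<close>,
  this says that \<open>f\<^sub>n\<close> is consistent iff, for some \<open>c\<close>, its energy in the frequencies
  \<open>\<bar>j\<bar> \<le> c n\<^sup>2\<^sup>-\<^sup>4\<^sup>r\<close> is at least of order \<open>n\<^sup>-\<^sup>2\<^sup>r\<close>, and inconsistent iff for every \<open>c\<close> this energy is
  \<open>o(n\<^sup>-\<^sup>2\<^sup>r)\<close>. The exponent \<open>s\<close> is the one for which truncation at \<open>c n\<^sup>2\<^sup>-\<^sup>4\<^sup>r\<close> maps functions of norm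
  \<open>n\<^sup>-\<^sup>r\<close> into a fixed multiple of the Besov ball, and for which the elements of the ball have all but
  an arbitrarily small part of that energy below \<open>c n\<^sup>2\<^sup>-\<^sup>4\<^sup>r\<close>.
\<close>

subsection \<open>Square-integrable functions and the Hartley basis\<close>

text \<open>The axioms on \<open>W\<close> supply only one-dimensional normal laws and a linearity
  that holds almost surely for each pair of functions, whereas the statistic integrates
  \<open>W \<omega> (per h t)\<close> over a continuum of \<open>t\<close>. Two devices bridge this.
  Independence of the Gaussian coordinates is derived from characteristic functions of finite linear
  forms. The passage to Fourier coordinates is never made pathwise: for each fixed \<open>t\<close>
  the error of truncating at frequency N is small in mean square, joint measurability allows
  integration over \<open>t\<close>, and for fixed n the squared path norm is an \<open>L1\<close>
  limit of finite quadratic forms. Probability estimates are proved for the truncated forms with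
  constants free of N and carried over with a little slack in the event. A generated test is a
  threshold on the statistic and both error probabilities refer to the same noise, so the null and
  the shifted statistic can be compared at one sample point. The threshold and the bandwidth
  constant may depend on the alternatives, which is why existence of a good cell or a good frequency
  level is enough.\<close>

definition sqint :: "'a measure \<Rightarrow> ('a \<Rightarrow> real) set" where
  "sqint M = {f \<in> borel_measurable M. integrable M (\<lambda>x. (f x)\<^sup>2)}"

lemma sqint_measurable: "f \<in> sqint M \<Longrightarrow> f \<in> borel_measurable M"
  by (simp add: sqint_def)

lemma sqint_integrable_power2: "f \<in> sqint M \<Longrightarrow> integrable M (\<lambda>x. (f x)\<^sup>2)"
  by (simp add: sqint_def)

lemma sqint_integrable_mult:
  assumes f: "f \<in> sqint M" and g: "g \<in> sqint M"
  shows "integrable M (\<lambda>x. f x * g x)"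
proof (rule Bochner_Integration.integrable_bound)
  show "integrable M (\<lambda>x. (f x)\<^sup>2 + (g x)\<^sup>2)"
    using f g by (simp add: sqint_def)
  show "(\<lambda>x. f x * g x) \<in> borel_measurable M"
    using f g by (auto simp: sqint_def)
  have "\<bar>a * b\<bar> \<le> a\<^sup>2 + b\<^sup>2" for a b :: real
  proof -
    have "2 * (\<bar>a\<bar> * \<bar>b\<bar>) \<le> a\<^sup>2 + b\<^sup>2"
      using sum_squares_bound[of "\<bar>a\<bar>" "\<bar>b\<bar>"] by (simp add: mult.assoc)
    moreover have "0 \<le> \<bar>a\<bar> * \<bar>b\<bar>" by simp
    ultimately show ?thesis unfolding abs_mult by linarith
  qed
  then show "AE x in M. norm (f x * g x) \<le> norm ((f x)\<^sup>2 + (g x)\<^sup>2)"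
    by (simp add: abs_of_nonneg)
qed

lemma sqint_cmult: "f \<in> sqint M \<Longrightarrow> (\<lambda>x. c * f x) \<in> sqint M"
  by (auto simp add: sqint_def power_mult_distrib)

lemma sqint_zero: "(\<lambda>x. 0) \<in> sqint M"
  by (simp add: sqint_def)

lemma sqint_add:
  assumes f: "f \<in> sqint M" and g: "g \<in> sqint M"
  shows "(\<lambda>x. f x + g x) \<in> sqint M"
  using f g sqint_integrable_mult[OF f g]
  by (auto simp add: sqint_def power2_sum mult.assoc)

lemma sqint_diff:
  assumes "f \<in> sqint M" and "g \<in> sqint M"
  shows "(\<lambda>x. f x - g x) \<in> sqint M"
  using sqint_add[OF assms(1) sqint_cmult[OF assms(2), of "-1"]] by simp

lemma sqint_sum: "(\<And>i. i \<in> J \<Longrightarrow> f i \<in> sqint M) \<Longrightarrow> (\<lambda>x. \<Sum>i\<in>J. f i x) \<in> sqint M"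
  by (induction J rule: infinite_finite_induct) (auto intro: sqint_zero sqint_add)

lemma sqint_lin: "(\<And>i. i \<in> J \<Longrightarrow> e i \<in> sqint M) \<Longrightarrow> (\<lambda>x. \<Sum>i\<in>J. a i * e i x) \<in> sqint M"
  by (intro sqint_sum sqint_cmult)

lemma sqint_dominated:
  assumes "g \<in> sqint M" "f \<in> borel_measurable M" "\<And>x. x \<in> space M \<Longrightarrow> \<bar>f x\<bar> \<le> \<bar>g x\<bar>"
  shows "f \<in> sqint M"
proof -
  have "integrable M (\<lambda>x. (f x)\<^sup>2)"
    by (rule Bochner_Integration.integrable_bound[OF sqint_integrable_power2[OF assms(1)]])
       (use assms in \<open>auto intro!: AE_I2 simp: abs_le_square_iff\<close>)
  with assms show ?thesis by (simp add: sqint_def)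
qed

lemma (in finite_measure) sqint_bounded:
  assumes "f \<in> borel_measurable M" "\<And>x. x \<in> space M \<Longrightarrow> \<bar>f x\<bar> \<le> B"
  shows "f \<in> sqint M"
  by (rule sqint_dominated[of "\<lambda>_. B"]) (use assms in \<open>force simp: sqint_def\<close>)+

lemma (in finite_measure) sqint_integrable:
  assumes "f \<in> sqint M" shows "integrable M f"
  using sqint_integrable_mult[OF assms sqint_bounded[of "\<lambda>_. 1" 1]] by simp

text \<open>The form a u^2 + 2 b u v + c v^2 is the integral of (u f + v g)^2, hence non-negative;
  suitable u and v give the discriminant inequality.\<close>

lemma sqint_Cauchy_Schwarz:
  assumes f: "f \<in> sqint M" and g: "g \<in> sqint M"
  shows "(\<integral>x. f x * g x \<partial>M)\<^sup>2 \<le> (\<integral>x. (f x)\<^sup>2 \<partial>M) * (\<integral>x. (g x)\<^sup>2 \<partial>M)"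
proof -
  define a b c where "a = (\<integral>x. (f x)\<^sup>2 \<partial>M)" and "b = (\<integral>x. f x * g x \<partial>M)"
    and "c = (\<integral>x. (g x)\<^sup>2 \<partial>M)"
  note [simp] = sqint_integrable_power2[OF f] sqint_integrable_power2[OF g] sqint_integrable_mult[OF f g]
  have q: "0 \<le> a * u\<^sup>2 + 2 * b * u * v + c * v\<^sup>2" for u v
  proof -
    have "0 \<le> (\<integral>x. (u * f x + v * g x)\<^sup>2 \<partial>M)" by simp
    also have "(\<lambda>x. (u * f x + v * g x)\<^sup>2) = (\<lambda>x. u\<^sup>2 * (f x)\<^sup>2 + (2 * u * v) * (f x * g x) + v\<^sup>2 * (g x)\<^sup>2)"
      by (auto simp: power2_eq_square algebra_simps)
    also have "(\<integral>x. \<dots> x \<partial>M) = a * u\<^sup>2 + 2 * b * u * v + c * v\<^sup>2"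
      by (simp add: a_def b_def c_def)
    finally show ?thesis .
  qed
  have "a \<ge> 0" "c \<ge> 0" by (auto simp: a_def c_def)
  show ?thesis
  proof (cases "c = 0")
    case True
    have "b = 0"
    proof (rule ccontr)
      assume "b \<noteq> 0"
      \<comment> \<open>With c = 0 the form is linear in v, and this pair drives it to -b^2.\<close>
      have "0 \<le> a * b\<^sup>2 + 2 * b * b * (-(a + 1) / 2)" using q[of b "-(a + 1) / 2"] True by simp
      also have "\<dots> = - b\<^sup>2" by (simp add: power2_eq_square field_simps)
      finally show False using \<open>b \<noteq> 0\<close> by simp
    qed
    then show ?thesis using True by (simp add: a_def b_def c_def)
  next
    case False
    have "0 \<le> a * c\<^sup>2 + 2 * b * c * (-b) + c * (-b)\<^sup>2" by (rule q)
    also have "\<dots> = c * (a * c - b\<^sup>2)" by (simp add: power2_eq_square algebra_simps)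
    finally have "0 \<le> a * c - b\<^sup>2" using False \<open>c \<ge> 0\<close> by (simp add: zero_le_mult_iff)
    then show ?thesis by (simp add: a_def b_def c_def)
  qed
qed

lemma sqint_Cauchy_Schwarz_abs:
  assumes f: "f \<in> sqint M" and g: "g \<in> sqint M"
  shows "\<bar>\<integral>x. f x * g x \<partial>M\<bar> \<le> sqrt (\<integral>x. (f x)\<^sup>2 \<partial>M) * sqrt (\<integral>x. (g x)\<^sup>2 \<partial>M)"
  using sqint_Cauchy_Schwarz[OF assms] by (metis real_le_rsqrt real_sqrt_abs real_sqrt_le_iff real_sqrt_mult)

lemma sqint_add_bound:
  assumes f: "f \<in> sqint M" and g: "g \<in> sqint M"
  shows "(\<integral>x. (f x + g x)\<^sup>2 \<partial>M) \<le> 2 * (\<integral>x. (f x)\<^sup>2 \<partial>M) + 2 * (\<integral>x. (g x)\<^sup>2 \<partial>M)"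
proof -
  have "(\<integral>x. (f x + g x)\<^sup>2 \<partial>M) \<le> (\<integral>x. 2 * (f x)\<^sup>2 + 2 * (g x)\<^sup>2 \<partial>M)"
    using sqint_integrable_power2[OF f] sqint_integrable_power2[OF g]
      sqint_integrable_power2[OF sqint_add[OF f g]]
  proof (intro integral_mono)
    show "(f x + g x)\<^sup>2 \<le> 2 * (f x)\<^sup>2 + 2 * (g x)\<^sup>2" for x
      using sum_squares_bound[of "f x" "g x"] unfolding power2_sum by linarith
  qed auto
  then show ?thesis
    using sqint_integrable_power2[OF f] sqint_integrable_power2[OF g] by simp
qed

lemma orthonormal_inner:
  fixes e :: "'i \<Rightarrow> 'a \<Rightarrow> real"
  assumes "finite J" and e: "\<And>i. i \<in> J \<Longrightarrow> e i \<in> sqint M"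
    and g: "g \<in> sqint M"
  shows "(\<integral>x. g x * (\<Sum>i\<in>J. a i * e i x) \<partial>M) = (\<Sum>i\<in>J. a i * (\<integral>x. g x * e i x \<partial>M))"
proof -
  have "(\<lambda>x. g x * (\<Sum>i\<in>J. a i * e i x)) = (\<lambda>x. \<Sum>i\<in>J. a i * (g x * e i x))"
    by (simp add: sum_distrib_left mult_ac)
  then show ?thesis
    using sqint_integrable_mult[OF g e] by (simp add: Bochner_Integration.integral_sum)
qed

lemma orthonormal_norm:
  fixes e :: "'i \<Rightarrow> 'a \<Rightarrow> real"
  assumes J: "finite J" and e: "\<And>i. i \<in> J \<Longrightarrow> e i \<in> sqint M"
    and orth: "\<And>i j. i \<in> J \<Longrightarrow> j \<in> J \<Longrightarrow> (\<integral>x. e i x * e j x \<partial>M) = (if i = j then 1 else 0)"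
  shows "(\<integral>x. (\<Sum>i\<in>J. a i * e i x)\<^sup>2 \<partial>M) = (\<Sum>i\<in>J. (a i)\<^sup>2)"
proof -
  have *: "(\<integral>x. (\<Sum>i\<in>J. a i * e i x) * e j x \<partial>M) = a j" if "j \<in> J" for j
  proof -
    have "(\<integral>x. (\<Sum>i\<in>J. a i * e i x) * e j x \<partial>M) = (\<Sum>i\<in>J. a i * (\<integral>x. e j x * e i x \<partial>M))"
      using orthonormal_inner[OF J e e[OF that], where a=a] by (simp add: mult.commute)
    also have "\<dots> = (\<Sum>i\<in>J. if j = i then a i else 0)"
      using orth[OF that] by (intro sum.cong) auto
    finally show ?thesis using that J by simp
  qed
  have "(\<integral>x. (\<Sum>i\<in>J. a i * e i x)\<^sup>2 \<partial>M) = (\<Sum>i\<in>J. a i * (\<integral>x. (\<Sum>i\<in>J. a i * e i x) * e i x \<partial>M))"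
    using orthonormal_inner[OF J e sqint_lin[of J e M a], where a=a] e by (simp add: power2_eq_square)
  then show ?thesis using * by (simp add: power2_eq_square)
qed

text \<open>Stated for arbitrary coefficients, since later a function is approximated with the
  coefficients of a different function.\<close>

lemma orthonormal_expansion:
  fixes e :: "'i \<Rightarrow> 'a \<Rightarrow> real"
  assumes J: "finite J" and e: "\<And>i. i \<in> J \<Longrightarrow> e i \<in> sqint M"
    and orth: "\<And>i j. i \<in> J \<Longrightarrow> j \<in> J \<Longrightarrow> (\<integral>x. e i x * e j x \<partial>M) = (if i = j then 1 else 0)"
    and f: "f \<in> sqint M"
  shows "(\<integral>x. (f x - (\<Sum>i\<in>J. a i * e i x))\<^sup>2 \<partial>M) =
    (\<integral>x. (f x)\<^sup>2 \<partial>M) - 2 * (\<Sum>i\<in>J. a i * (\<integral>x. f x * e i x \<partial>M)) + (\<Sum>i\<in>J. (a i)\<^sup>2)"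
proof -
  define p where "p = (\<lambda>x. \<Sum>i\<in>J. a i * e i x)"
  have p: "p \<in> sqint M" unfolding p_def by (rule sqint_lin[OF e])
  have "(\<lambda>x. (f x - p x)\<^sup>2) = (\<lambda>x. (f x)\<^sup>2 - 2 * (f x * p x) + (p x)\<^sup>2)"
    by (auto simp: power2_eq_square algebra_simps)
  then have "(\<integral>x. (f x - p x)\<^sup>2 \<partial>M) = (\<integral>x. (f x)\<^sup>2 \<partial>M) - 2 * (\<integral>x. f x * p x \<partial>M) + (\<integral>x. (p x)\<^sup>2 \<partial>M)"
    using sqint_integrable_power2[OF f] sqint_integrable_power2[OF p] sqint_integrable_mult[OF f p] by simp
  then show ?thesis
    using orthonormal_inner[OF J e f, where a=a] orthonormal_norm[OF J e orth, where a=a] by (simp add: p_def)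
qed

section \<open>The unit interval as a probability space\<close>

abbreviation unit_measure :: "real measure" where
  "unit_measure \<equiv> restrict_space lborel {0..<1}"

lemma space_unit: "space unit_measure = {0..<1}"
  by (simp add: space_restrict_space)

interpretation unit: prob_space unit_measure
  by (rule prob_space_restrict_space) auto

lemma unit_integral: "(\<integral>t. g t \<partial>unit_measure) = (LINT t:{0..<1}|lborel. g t)"
  for g :: "real \<Rightarrow> 'b::{banach, second_countable_topology}"
  by (subst integral_restrict_space) (auto simp: set_lebesgue_integral_def)

lemma unit_integrable: "integrable unit_measure g \<longleftrightarrow> set_integrable lborel {0..<1} g"
  for g :: "real \<Rightarrow> 'b::{banach, second_countable_topology}"
  by (subst integrable_restrict_space) (auto simp: set_integrable_def)

lemma unit_measurable: "g \<in> borel_measurable borel \<Longrightarrow> g \<in> borel_measurable unit_measure"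
  by (simp add: measurable_restrict_space1)

lemma L2_per_sqint: "f \<in> L2_per \<Longrightarrow> f \<in> sqint unit_measure"
  by (simp add: L2_per_def sqint_def unit_integrable unit_measurable)

lemma L2_per_iff:
  "f \<in> L2_per \<longleftrightarrow> f \<in> borel_measurable borel \<and> (\<forall>t. f (t + 1) = f t) \<and> f \<in> sqint unit_measure"
  by (auto simp add: L2_per_def sqint_def unit_integrable unit_measurable)

lemma L2_per_lin:
  "f \<in> L2_per \<Longrightarrow> g \<in> L2_per \<Longrightarrow> (\<lambda>t. a * f t + b * g t) \<in> L2_per"
  unfolding L2_per_iff by (auto intro!: sqint_add sqint_cmult)

lemma L2_inner_unit: "L2_inner f g = (\<integral>t. f t * g t \<partial>unit_measure)"
  by (simp add: L2_inner_def unit_integral)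

lemma L2_norm_unit: "L2_norm f = sqrt (\<integral>t. (f t)\<^sup>2 \<partial>unit_measure)"
  by (simp add: L2_norm_def unit_integral)

lemma L2_norm_power2: "(L2_norm f)\<^sup>2 = (\<integral>t. (f t)\<^sup>2 \<partial>unit_measure)"
  by (simp add: L2_norm_unit)

lemma unit_integral_FTC:
  fixes F f :: "real \<Rightarrow> real"
  assumes "\<And>x. (F has_real_derivative f x) (at x)" "continuous_on UNIV f"
  shows "(\<integral>t. f t \<partial>unit_measure) = F 1 - F 0"
proof -
  have "(\<integral>t. f t \<partial>unit_measure) = (\<integral>x. f x * indicator {0..1} x \<partial>lborel)"
    unfolding unit_integral set_lebesgue_integral_def
  proof (rule integral_cong_AE)
    have m: "f \<in> borel_measurable borel" using assms(2) by (rule borel_measurable_continuous_onI)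
    then show "(\<lambda>x. indicator {0..<1} x *\<^sub>R f x) \<in> borel_measurable lborel"
      "(\<lambda>x. f x * indicator {0..1} x) \<in> borel_measurable lborel" by auto
    show "AE x in lborel. indicator {0..<1} x *\<^sub>R f x = f x * indicator {0..1} x"
      using AE_lborel_singleton[of 1] by eventually_elim (auto simp: indicator_def)
  qed
  also have "\<dots> = F 1 - F 0"
    by (rule integral_FTC_Icc_real) (use assms in \<open>auto simp: continuous_on_eq_continuous_at\<close>)
  finally show ?thesis .
qed

text \<open>The phase is kept so that sines (phase -pi / 2) and the shifted cosines of the
  Riemann-Lebesgue estimate follow from the same formula.\<close>

lemma unit_integral_cos:
  assumes "a \<noteq> 0"
  shows "(\<integral>t. cos (a * t + b) \<partial>unit_measure) = (sin (a + b) - sin b) / a"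
proof -
  have "(\<integral>t. cos (a * t + b) \<partial>unit_measure) = sin (a * 1 + b) / a - sin (a * 0 + b) / a"
    by (rule unit_integral_FTC) (use assms in \<open>auto intro!: derivative_eq_intros continuous_intros\<close>)
  then show ?thesis by (simp add: diff_divide_distrib)
qed

text \<open>The real functions \<open>cos + sin\<close> replace the complex exponentials: indexed by all integers they are
  orthonormal, and convolution with an even kernel is diagonal in them.\<close>

definition cas :: "int \<Rightarrow> real \<Rightarrow> real" where
  "cas j t = cos (2 * pi * of_int j * t) + sin (2 * pi * of_int j * t)"

lemma continuous_cas [continuous_intros]: "continuous_on S (cas j)"
  unfolding cas_def by (intro continuous_intros)

lemma measurable_cas [measurable]: "cas j \<in> borel_measurable borel"
  by (intro borel_measurable_continuous_onI continuous_intros)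

lemma abs_cas_le: "\<bar>cas j t\<bar> \<le> 2"
  unfolding cas_def using abs_cos_le_one[of "2 * pi * of_int j * t"] abs_sin_le_one[of "2 * pi * of_int j * t"]
  by linarith

lemma cas_periodic: "cas j (t + of_int k) = cas j t"
proof -
  have *: "2 * pi * of_int j * (t + of_int k) = 2 * pi * of_int j * t + 2 * pi * of_int (j * k)"
    by (simp add: algebra_simps)
  show ?thesis
    unfolding cas_def * sin_add cos_add sin_int_2pin cos_int_2pin by simp
qed

lemma cas_0 [simp]: "cas 0 t = 1" "cas j 0 = 1"
  by (simp_all add: cas_def)

lemma cas_sqint: "cas j \<in> sqint unit_measure"
  by (rule unit.sqint_bounded[where B=2]) (auto simp: abs_cas_le intro: unit_measurable)

lemma cas_L2_per: "cas j \<in> L2_per"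
  using cas_periodic[of j _ 1] by (simp add: L2_per_iff cas_sqint)

lemma unit_integral_cos_int: "(\<integral>t. cos (2 * pi * of_int k * t) \<partial>unit_measure) = (if k = 0 then 1 else 0)"
  using unit_integral_cos[of "2 * pi * of_int k" 0] sin_int_2pin[of k] unit.prob_space
  by (auto simp: space_unit)

lemma unit_integral_sin_int: "(\<integral>t. sin (2 * pi * of_int k * t) \<partial>unit_measure) = 0"
proof (cases "k = 0")
  case False
  have "(\<integral>t. sin (2 * pi * of_int k * t) \<partial>unit_measure) = (\<integral>t. cos (2 * pi * of_int k * t + (- pi / 2)) \<partial>unit_measure)"
    by (intro Bochner_Integration.integral_cong refl) (simp add: cos_diff)
  also have "\<dots> = 0"
    using unit_integral_cos[of "2 * pi * of_int k" "- pi / 2"] False cos_int_2pin[of k]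
    by (simp add: sin_diff mult.assoc)
  finally show ?thesis .
qed auto

lemma cas_mult: "cas j t * cas k t = cos (2 * pi * of_int (j - k) * t) + sin (2 * pi * of_int (j + k) * t)"
  by (simp add: cas_def cos_diff sin_add algebra_simps)

lemma cas_orthonormal: "(\<integral>t. cas j t * cas k t \<partial>unit_measure) = (if j = k then 1 else 0)"
proof -
  have [simp]: "integrable unit_measure (\<lambda>t. cos (a * t))" "integrable unit_measure (\<lambda>t. sin (a * t))" for a
    by (rule unit.integrable_const_bound[where B=1]; auto intro: unit_measurable)+
  show ?thesis
    unfolding cas_mult
    by (simp add: unit_integral_cos_int unit_integral_sin_int del: of_int_diff of_int_add)
qed

text \<open>Products of exponentials are exponentials, but products of \<open>cas\<close> functions
  spread over four frequencies; a finite combination is all that closure under multiplication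
  requires.\<close>

lemma cas_product: "cas j t * cas k t = (cas (j - k) t + cas (k - j) t + cas (j + k) t - cas (- (j + k)) t) / 2"
proof -
  have "cos (2 * pi * of_int i * t) = (cas i t + cas (- i) t) / 2"
    "sin (2 * pi * of_int i * t) = (cas i t - cas (- i) t) / 2" for i
    by (simp_all add: cas_def)
  from this(1)[of "j - k"] this(2)[of "j + k"] show ?thesis
    unfolding cas_mult by (simp add: field_simps)
qed

section \<open>Hartley coefficients and truncation in frequency\<close>

definition hartley :: "(real \<Rightarrow> real) \<Rightarrow> int \<Rightarrow> real" where
  "hartley f j = (\<integral>t. f t * cas j t \<partial>unit_measure)"

abbreviation low :: "real \<Rightarrow> int set" where
  "low c \<equiv> {j. \<bar>real_of_int j\<bar> \<le> c}"

lemma finite_low [simp]: "finite (low c)"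
proof (rule finite_subset)
  show "low c \<subseteq> {-\<lceil>c\<rceil>..\<lceil>c\<rceil>}" by (auto; linarith)
qed auto

lemma low_mono: "c \<le> d \<Longrightarrow> low c \<subseteq> low d"
  by auto

definition proj :: "real \<Rightarrow> (real \<Rightarrow> real) \<Rightarrow> real \<Rightarrow> real" where
  "proj c f t = (\<Sum>j\<in>low c. hartley f j * cas j t)"

definition low_energy :: "(real \<Rightarrow> real) \<Rightarrow> real \<Rightarrow> real" where
  "low_energy f c = (\<Sum>j\<in>low c. (hartley f j)\<^sup>2)"

lemma proj_L2_per: "proj c f \<in> L2_per"
  unfolding L2_per_iff proj_def
  using cas_periodic[of _ _ 1] by (auto intro!: sqint_lin cas_sqint)

lemma hartley_trig: "hartley (\<lambda>t. \<Sum>j\<in>low c. a j * cas j t) k = (if \<bar>real_of_int k\<bar> \<le> c then a k else 0)"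
proof -
  have "hartley (\<lambda>t. \<Sum>j\<in>low c. a j * cas j t) k = (\<Sum>j\<in>low c. a j * (\<integral>t. cas k t * cas j t \<partial>unit_measure))"
    using orthonormal_inner[OF finite_low cas_sqint cas_sqint, where a=a] by (simp add: hartley_def mult.commute)
  then show ?thesis by (simp add: cas_orthonormal if_distrib cong: if_cong)
qed

lemma hartley_proj: "hartley (proj c f) k = (if \<bar>real_of_int k\<bar> \<le> c then hartley f k else 0)"
  unfolding proj_def hartley_trig ..

text \<open>Completing the square separates the Bessel defect, which does not depend on
  \<open>a\<close>, from the squared distance of \<open>a\<close> to the Hartley
  coefficients.\<close>

lemma norm_diff_trig:
  assumes "f \<in> sqint unit_measure"
  shows "(\<integral>t. (f t - (\<Sum>j\<in>low c. a j * cas j t))\<^sup>2 \<partial>unit_measure) =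
    (\<integral>t. (f t)\<^sup>2 \<partial>unit_measure) - low_energy f c + (\<Sum>j\<in>low c. (a j - hartley f j)\<^sup>2)"
proof -
  have "(\<integral>t. (f t - (\<Sum>j\<in>low c. a j * cas j t))\<^sup>2 \<partial>unit_measure) =
    (\<integral>t. (f t)\<^sup>2 \<partial>unit_measure) - 2 * (\<Sum>j\<in>low c. a j * hartley f j) + (\<Sum>j\<in>low c. (a j)\<^sup>2)"
    unfolding hartley_def by (rule orthonormal_expansion[OF finite_low cas_sqint cas_orthonormal assms])
  then show ?thesis
    by (simp add: low_energy_def power2_diff sum.distrib sum_subtractf sum_distrib_left mult.assoc)
qed

lemma norm_diff_proj:
  assumes "f \<in> sqint unit_measure"
  shows "(\<integral>t. (f t - proj c f t)\<^sup>2 \<partial>unit_measure) = (\<integral>t. (f t)\<^sup>2 \<partial>unit_measure) - low_energy f c"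
  unfolding proj_def norm_diff_trig[OF assms] by simp

lemma norm_proj: "(\<integral>t. (proj c f t)\<^sup>2 \<partial>unit_measure) = low_energy f c"
  unfolding proj_def low_energy_def by (rule orthonormal_norm[OF finite_low cas_sqint cas_orthonormal])

lemma Bessel: "f \<in> sqint unit_measure \<Longrightarrow> low_energy f c \<le> (\<integral>t. (f t)\<^sup>2 \<partial>unit_measure)"
  using norm_diff_proj[of f c] by (smt (verit) integral_nonneg_AE AE_I2 zero_le_power2)

lemma low_energy_mono: "c \<le> d \<Longrightarrow> low_energy f c \<le> low_energy f d"
  unfolding low_energy_def by (intro sum_mono2 low_mono) auto

lemma low_energy_nonneg: "0 \<le> low_energy f c"
  by (simp add: low_energy_def sum_nonneg)

subsection \<open>Completeness of the trigonometric system\<close>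

text \<open>The \<open>L2\<close> closure of the trigonometric polynomials, expressed through the
  Bessel defect: by best approximation this defect is the squared distance to the polynomials with
  frequencies in \<open>low c\<close>.\<close>

definition trig_closure :: "(real \<Rightarrow> real) set" where
  "trig_closure = {f \<in> sqint unit_measure. \<forall>\<epsilon>>0. \<exists>c. (\<integral>t. (f t)\<^sup>2 \<partial>unit_measure) - low_energy f c < \<epsilon>}"

lemma trig_best_approximation:
  assumes "f \<in> sqint unit_measure"
  shows "(\<integral>t. (f t)\<^sup>2 \<partial>unit_measure) - low_energy f c \<le>
    (\<integral>t. (f t - (\<Sum>j\<in>low c. a j * cas j t))\<^sup>2 \<partial>unit_measure)"
  unfolding norm_diff_trig[OF assms] by (simp add: sum_nonneg)

lemma trig_closure_sqint: "f \<in> trig_closure \<Longrightarrow> f \<in> sqint unit_measure"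
  by (simp add: trig_closure_def)

lemma trig_closureD:
  "f \<in> trig_closure \<Longrightarrow> \<epsilon> > 0 \<Longrightarrow> \<exists>c. (\<integral>t. (f t)\<^sup>2 \<partial>unit_measure) - low_energy f c < \<epsilon>"
  by (simp add: trig_closure_def)

lemma trig_closure_proj:
  assumes "f \<in> trig_closure" "\<epsilon> > 0"
  obtains c where "(\<integral>t. (f t - proj c f t)\<^sup>2 \<partial>unit_measure) < \<epsilon>"
  using assms norm_diff_proj[of f] by (auto simp: trig_closure_def)

lemma proj_sqint: "proj c f \<in> sqint unit_measure"
  using proj_L2_per L2_per_sqint by blast

text \<open>A truncation of the approximant \<open>g\<close> competes with the truncation of
  \<open>f\<close>, whose defect is therefore bounded by two small distances.\<close>

lemma trig_closure_approx:
  assumes f: "f \<in> sqint unit_measure"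
    and ex: "\<And>\<epsilon>. \<epsilon> > 0 \<Longrightarrow> \<exists>g\<in>trig_closure. (\<integral>t. (f t - g t)\<^sup>2 \<partial>unit_measure) < \<epsilon>"
  shows "f \<in> trig_closure"
  unfolding trig_closure_def
proof (safe intro!: f)
  fix \<epsilon> :: real assume "\<epsilon> > 0"
  then obtain g where g: "g \<in> trig_closure" "(\<integral>t. (f t - g t)\<^sup>2 \<partial>unit_measure) < \<epsilon> / 4"
    using ex[of "\<epsilon> / 4"] by auto
  obtain c where c: "(\<integral>t. (g t - proj c g t)\<^sup>2 \<partial>unit_measure) < \<epsilon> / 4"
    using trig_closure_proj[OF g(1), of "\<epsilon> / 4"] \<open>\<epsilon> > 0\<close> by auto
  have "(\<integral>t. (f t)\<^sup>2 \<partial>unit_measure) - low_energy f c \<le> (\<integral>t. (f t - proj c g t)\<^sup>2 \<partial>unit_measure)"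
    unfolding proj_def by (rule trig_best_approximation[OF f])
  also have "\<dots> = (\<integral>t. ((f t - g t) + (g t - proj c g t))\<^sup>2 \<partial>unit_measure)"
    by simp
  also have "\<dots> \<le> 2 * (\<integral>t. (f t - g t)\<^sup>2 \<partial>unit_measure) + 2 * (\<integral>t. (g t - proj c g t)\<^sup>2 \<partial>unit_measure)"
    by (intro sqint_add_bound sqint_diff f trig_closure_sqint g proj_sqint)
  also have "\<dots> < \<epsilon>" using g c by simp
  finally show "\<exists>c. (\<integral>t. (f t)\<^sup>2 \<partial>unit_measure) - low_energy f c < \<epsilon>" ..
qed

lemma trig_closure_cmult:
  assumes "f \<in> trig_closure" shows "(\<lambda>t. k * f t) \<in> trig_closure"
proof (cases "k = 0")
  case True
  then show ?thesis by (auto simp: trig_closure_def sqint_zero low_energy_def hartley_def)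
next
  case False
  have H: "low_energy (\<lambda>t. k * f t) c = k\<^sup>2 * low_energy f c" for c
    by (simp add: low_energy_def hartley_def mult.assoc power_mult_distrib sum_distrib_left)
  show ?thesis
    unfolding trig_closure_def
  proof (safe intro!: sqint_cmult trig_closure_sqint[OF assms])
    fix \<epsilon> :: real assume "\<epsilon> > 0"
    with False have "\<epsilon> / k\<^sup>2 > 0" by simp
    from trig_closureD[OF assms this] obtain c
      where "(\<integral>t. (f t)\<^sup>2 \<partial>unit_measure) - low_energy f c < \<epsilon> / k\<^sup>2" ..
    with False show "\<exists>c. (\<integral>t. (k * f t)\<^sup>2 \<partial>unit_measure) - low_energy (\<lambda>t. k * f t) c < \<epsilon>"
      by (intro exI[of _ c]) (simp add: H power_mult_distrib field_simps)
  qed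
qed

lemma trig_closure_add:
  assumes f: "f \<in> trig_closure" and g: "g \<in> trig_closure"
  shows "(\<lambda>t. f t + g t) \<in> trig_closure"
  unfolding trig_closure_def mem_Collect_eq
proof (intro conjI allI impI)
  show "(\<lambda>t. f t + g t) \<in> sqint unit_measure" by (intro sqint_add trig_closure_sqint[OF f] trig_closure_sqint[OF g])
  fix \<epsilon> :: real assume "\<epsilon> > 0"
  obtain c1 where c1: "(\<integral>t. (f t)\<^sup>2 \<partial>unit_measure) - low_energy f c1 < \<epsilon> / 4"
    using trig_closureD[OF f, of "\<epsilon> / 4"] \<open>\<epsilon> > 0\<close> by auto
  obtain c2 where c2: "(\<integral>t. (g t)\<^sup>2 \<partial>unit_measure) - low_energy g c2 < \<epsilon> / 4"
    using trig_closureD[OF g, of "\<epsilon> / 4"] \<open>\<epsilon> > 0\<close> by auto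
  define c where "c = max c1 c2"
  note f' = trig_closure_sqint[OF f] and g' = trig_closure_sqint[OF g]
  have "(\<integral>t. (f t + g t)\<^sup>2 \<partial>unit_measure) - low_energy (\<lambda>t. f t + g t) c
    \<le> (\<integral>t. (f t + g t - (\<Sum>j\<in>low c. (hartley f j + hartley g j) * cas j t))\<^sup>2 \<partial>unit_measure)"
    by (rule trig_best_approximation[OF sqint_add[OF f' g']])
  also have "\<dots> = (\<integral>t. ((f t - proj c f t) + (g t - proj c g t))\<^sup>2 \<partial>unit_measure)"
    by (simp add: proj_def algebra_simps sum.distrib)
  also have "\<dots> \<le> 2 * (\<integral>t. (f t - proj c f t)\<^sup>2 \<partial>unit_measure) + 2 * (\<integral>t. (g t - proj c g t)\<^sup>2 \<partial>unit_measure)"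
    by (intro sqint_add_bound sqint_diff f' g' proj_sqint)
  also have "\<dots> < \<epsilon>"
    using c1 c2 low_energy_mono[of c1 c f] low_energy_mono[of c2 c g]
    by (simp add: norm_diff_proj f' g' c_def)
  finally show "\<exists>c. (\<integral>t. (f t + g t)\<^sup>2 \<partial>unit_measure) - low_energy (\<lambda>t. f t + g t) c < \<epsilon>" ..
qed

lemma trig_closure_sum:
  "(\<And>i. i \<in> J \<Longrightarrow> f i \<in> trig_closure) \<Longrightarrow> (\<lambda>t. \<Sum>i\<in>J. f i t) \<in> trig_closure"
proof (induction J rule: infinite_finite_induct)
  case empty
  then show ?case by (auto simp: trig_closure_def sqint_zero low_energy_def hartley_def)
next
  case (infinite A)
  then show ?case by (auto simp: trig_closure_def sqint_zero low_energy_def hartley_def)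
next
  case (insert x F)
  then show ?case using trig_closure_add[of "f x" "\<lambda>t. \<Sum>i\<in>F. f i t"] by simp
qed

lemma trig_closure_cas: "cas j \<in> trig_closure"
  unfolding trig_closure_def
proof (safe intro!: cas_sqint exI[of _ "\<bar>of_int j\<bar>"])
  fix \<epsilon> :: real assume "\<epsilon> > 0"
  have "(\<Sum>i\<in>low \<bar>of_int j\<bar>. (if i = j then 1 else 0) * cas i t) = cas j t" for t
    by (simp add: if_distrib[of "\<lambda>c. c * _"] cong: if_cong)
  then have "(\<integral>t. (cas j t)\<^sup>2 \<partial>unit_measure) - low_energy (cas j) \<bar>of_int j\<bar> \<le> 0"
    using trig_best_approximation[OF cas_sqint, of j "\<bar>of_int j\<bar>" "\<lambda>i. if i = j then 1 else 0"] by simp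
  with \<open>\<epsilon> > 0\<close> show "(\<integral>t. (cas j t)\<^sup>2 \<partial>unit_measure) - low_energy (cas j) \<bar>of_int j\<bar> < \<epsilon>" by simp
qed

lemma sqint_mult_bounded:
  assumes "f \<in> borel_measurable M" "\<And>t. t \<in> space M \<Longrightarrow> \<bar>f t\<bar> \<le> B" and g: "g \<in> sqint M"
  shows "(\<lambda>t. f t * g t) \<in> sqint M"
    and "(\<integral>t. (f t * g t)\<^sup>2 \<partial>M) \<le> B\<^sup>2 * (\<integral>t. (g t)\<^sup>2 \<partial>M)"
proof -
  have le: "\<bar>f t * g t\<bar> \<le> \<bar>B * g t\<bar>" if "t \<in> space M" for t
    using assms(2)[OF that] by (simp add: abs_mult mult_right_mono)
  show s: "(\<lambda>t. f t * g t) \<in> sqint M"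
    by (rule sqint_dominated[OF sqint_cmult[OF g, of B]])
       (use assms(1) sqint_measurable[OF g] le in auto)
  have "(\<integral>t. (f t * g t)\<^sup>2 \<partial>M) \<le> (\<integral>t. (B * g t)\<^sup>2 \<partial>M)"
    using sqint_integrable_power2[OF s] sqint_integrable_power2[OF sqint_cmult[OF g, of B]] le
    by (intro integral_mono) (auto simp: abs_le_square_iff)
  then show "(\<integral>t. (f t * g t)\<^sup>2 \<partial>M) \<le> B\<^sup>2 * (\<integral>t. (g t)\<^sup>2 \<partial>M)"
    by (simp add: power_mult_distrib)
qed

text \<open>Multiplication by a bounded \<open>g\<close> is a bounded operator on \<open>L2\<close>,
  so it preserves the closure as soon as it sends each \<open>cas j\<close> into it.\<close>

lemma trig_closure_mult_trig:
  assumes f: "f \<in> trig_closure"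
    and step: "\<And>j. (\<lambda>t. g t * cas j t) \<in> trig_closure"
    and g: "g \<in> borel_measurable unit_measure" "\<And>t. t \<in> {0..<1} \<Longrightarrow> \<bar>g t\<bar> \<le> B"
  shows "(\<lambda>t. g t * f t) \<in> trig_closure"
proof (rule trig_closure_approx)
  show "(\<lambda>t. g t * f t) \<in> sqint unit_measure"
    using g by (intro sqint_mult_bounded(1)[where B=B] trig_closure_sqint f) (auto simp: space_unit)
  fix \<epsilon> :: real assume "\<epsilon> > 0"
  then have "\<epsilon> / (B\<^sup>2 + 1) > 0" by (simp add: add_nonneg_pos)
  from trig_closure_proj[OF f this] obtain c
    where c: "(\<integral>t. (f t - proj c f t)\<^sup>2 \<partial>unit_measure) < \<epsilon> / (B\<^sup>2 + 1)" .
  have "(\<lambda>t. \<Sum>j\<in>low c. hartley f j * (g t * cas j t)) \<in> trig_closure"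
    by (intro trig_closure_sum trig_closure_cmult step)
  then have cl: "(\<lambda>t. g t * proj c f t) \<in> trig_closure"
    by (simp add: proj_def sum_distrib_left mult_ac)
  have "(\<integral>t. (g t * f t - g t * proj c f t)\<^sup>2 \<partial>unit_measure) = (\<integral>t. (g t * (f t - proj c f t))\<^sup>2 \<partial>unit_measure)"
    by (simp add: right_diff_distrib)
  also have "\<dots> \<le> B\<^sup>2 * (\<integral>t. (f t - proj c f t)\<^sup>2 \<partial>unit_measure)"
    using g by (intro sqint_mult_bounded(2) sqint_diff trig_closure_sqint f proj_sqint) (auto simp: space_unit)
  also have "\<dots> \<le> (B\<^sup>2 + 1) * (\<integral>t. (f t - proj c f t)\<^sup>2 \<partial>unit_measure)"
    by (intro mult_right_mono) auto
  also have "\<dots> < \<epsilon>"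
    using c by (simp add: pos_less_divide_eq add_nonneg_pos mult.commute)
  finally show "\<exists>h\<in>trig_closure. (\<integral>t. (g t * f t - h t)\<^sup>2 \<partial>unit_measure) < \<epsilon>"
    by (rule bexI[OF _ cl])
qed

text \<open>The bounded functions in the closure form an algebra. It contains the identity by the value of
  \<open>\<Sum> 1 / n\<^sup>2\<close>, hence all polynomials, hence the continuous functions.\<close>

definition trig_bounded :: "(real \<Rightarrow> real) set" where
  "trig_bounded = {f \<in> trig_closure. \<exists>B. \<forall>t\<in>{0..<1}. \<bar>f t\<bar> \<le> B}"

lemma trig_bounded_mult:
  assumes f: "f \<in> trig_bounded" and g: "g \<in> trig_bounded"
  shows "(\<lambda>t. f t * g t) \<in> trig_bounded"
proof -
  have f': "f \<in> trig_closure" and g': "g \<in> trig_closure" using assms by (auto simp: trig_bounded_def)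
  obtain B where B: "\<And>t. t \<in> {0..<1} \<Longrightarrow> \<bar>f t\<bar> \<le> B" using f unfolding trig_bounded_def by blast
  obtain C where C: "\<And>t. t \<in> {0..<1} \<Longrightarrow> \<bar>g t\<bar> \<le> C" using g unfolding trig_bounded_def by blast
  have cc: "(\<lambda>t. cas k t * cas j t) \<in> trig_closure" for j k
  proof -
    have "(\<lambda>t. (1/2) * (cas (k - j) t + cas (j - k) t + cas (k + j) t + (-1) * cas (- (k + j)) t)) \<in> trig_closure"
      by (intro trig_closure_cmult trig_closure_add trig_closure_cas)
    then show ?thesis unfolding cas_product by simp
  qed
  \<comment> \<open>The multiplication lemma is used twice: with multiplier \<open>cas j\<close>
    acting on \<open>f\<close>, then with multiplier \<open>f\<close> acting on
    \<open>g\<close>.\<close>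
  have "(\<lambda>t. cas j t * f t) \<in> trig_closure" for j
    by (rule trig_closure_mult_trig[OF f' cc, of j 2]) (auto simp: abs_cas_le intro: unit_measurable)
  then have "(\<lambda>t. f t * g t) \<in> trig_closure"
    by (intro trig_closure_mult_trig[OF g' _ _ B])
       (auto simp: mult.commute intro: sqint_measurable trig_closure_sqint f')
  moreover have "\<bar>f t * g t\<bar> \<le> B * C" if "t \<in> {0..<1}" for t
    unfolding abs_mult using B[OF that] C[OF that] by (intro mult_mono) auto
  ultimately show ?thesis unfolding trig_bounded_def by blast
qed

lemma trig_bounded_add:
  assumes f: "f \<in> trig_bounded" and g: "g \<in> trig_bounded"
  shows "(\<lambda>t. f t + g t) \<in> trig_bounded"
proof -
  obtain B where B: "\<And>t. t \<in> {0..<1} \<Longrightarrow> \<bar>f t\<bar> \<le> B" using f unfolding trig_bounded_def by blast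
  obtain C where C: "\<And>t. t \<in> {0..<1} \<Longrightarrow> \<bar>g t\<bar> \<le> C" using g unfolding trig_bounded_def by blast
  have "\<bar>f t + g t\<bar> \<le> B + C" if "t \<in> {0..<1}" for t
    using B[OF that] C[OF that] by linarith
  moreover have "(\<lambda>t. f t + g t) \<in> trig_closure"
    using assms by (intro trig_closure_add) (auto simp: trig_bounded_def)
  ultimately show ?thesis unfolding trig_bounded_def by blast
qed

lemma trig_bounded_const: "(\<lambda>t. k) \<in> trig_bounded"
  using trig_closure_cmult[OF trig_closure_cas[of 0], of k] by (auto simp: trig_bounded_def)

lemma trig_bounded_power: "f \<in> trig_bounded \<Longrightarrow> (\<lambda>t. f t ^ n) \<in> trig_bounded"
  by (induction n) (auto intro: trig_bounded_const trig_bounded_mult)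

lemma trig_bounded_sum:
  "(\<And>i. i \<in> J \<Longrightarrow> f i \<in> trig_bounded) \<Longrightarrow> (\<lambda>t. \<Sum>i\<in>J. f i t) \<in> trig_bounded"
  by (induction J rule: infinite_finite_induct) (auto intro: trig_bounded_const trig_bounded_add)

lemma hartley_ident: "hartley (\<lambda>t. t) j = (if j = 0 then 1 / 2 else - 1 / (2 * pi * of_int j))"
proof (cases "j = 0")
  case True
  have "(\<integral>t. t \<partial>unit_measure) = 1\<^sup>2 / 2 - 0\<^sup>2 / (2::real)"
    by (rule unit_integral_FTC) (auto intro!: derivative_eq_intros continuous_intros)
  with True show ?thesis by (simp add: hartley_def)
next
  case False
  define a where "a = 2 * pi * of_int j"
  have "a \<noteq> 0" using False by (simp add: a_def)
  have sc: "sin a = 0" "cos a = 1" unfolding a_def by (simp_all only: sin_int_2pin cos_int_2pin)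
  \<comment> \<open>Antiderivative of \<open>t * cas j t\<close>, found by integration by
    parts.\<close>
  define F where "F = (\<lambda>t. t * (sin (a * t) - cos (a * t)) / a + (cos (a * t) + sin (a * t)) / a\<^sup>2)"
  have "(\<integral>t. t * cas j t \<partial>unit_measure) = F 1 - F 0"
  proof (rule unit_integral_FTC)
    show "(F has_real_derivative x * cas j x) (at x)" for x
      unfolding F_def cas_def a_def[symmetric] using \<open>a \<noteq> 0\<close>
      by (auto intro!: derivative_eq_intros simp: field_simps power2_eq_square)
  qed (intro continuous_intros)
  then show ?thesis using False by (simp add: hartley_def F_def sc a_def)
qed

lemma trig_bounded_ident: "(\<lambda>t. t) \<in> trig_bounded"
proof -
  have s: "(\<lambda>t. t) \<in> sqint unit_measure"
    by (rule unit.sqint_bounded[where B=1]) (auto simp: space_unit intro: unit_measurable)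
  have n: "(\<integral>t. t\<^sup>2 \<partial>unit_measure) = 1 ^ 3 / 3 - 0 ^ 3 / (3::real)"
    by (rule unit_integral_FTC) (auto intro!: derivative_eq_intros continuous_intros)
  have le: "low_energy (\<lambda>t. t) (real N) = 1 / 4 + (\<Sum>k<N. 1 / (real k + 1)\<^sup>2) / (2 * pi\<^sup>2)" for N
  proof (induction N)
    case 0
    have "low 0 = {0}" by auto
    then show ?case by (simp add: low_energy_def hartley_ident power2_eq_square)
  next
    case (Suc N)
    have "low (real (Suc N)) = insert (int N + 1) (insert (- (int N + 1)) (low (real N)))"
    proof -
      have "\<bar>real_of_int j\<bar> \<le> real (Suc N) \<longleftrightarrow> j = int N + 1 \<or> j = - (int N + 1) \<or> \<bar>real_of_int j\<bar> \<le> real N" for j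
      proof -
        have "\<bar>real_of_int j\<bar> \<le> real m \<longleftrightarrow> \<bar>j\<bar> \<le> int m" for m by linarith
        from this[of "Suc N"] this[of N] show ?thesis by simp arith
      qed
      then show ?thesis by blast
    qed
    \<comment> \<open>The frequencies N + 1 and -(N + 1) enter together and contribute
      equally.\<close>
    then have "low_energy (\<lambda>t. t) (real (Suc N)) = 2 * (1 / (2 * pi * (real N + 1)))\<^sup>2 + low_energy (\<lambda>t. t) (real N)"
      by (simp add: low_energy_def hartley_ident power2_eq_square field_simps)
    also have "\<dots> = 1 / 4 + (\<Sum>k<Suc N. 1 / (real k + 1)\<^sup>2) / (2 * pi\<^sup>2)"
      unfolding Suc by (simp add: power_mult_distrib power_divide add_divide_distrib)
    finally show ?case .
  qed
  \<comment> \<open>The limit is 1/4 + 1/12 = 1/3, the squared norm of the identity, so its Bessel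
    defect tends to 0 by explicit computation.\<close>
  have "(\<lambda>N. low_energy (\<lambda>t. t) (real N)) \<longlonglongrightarrow> 1 / 4 + (pi\<^sup>2 / 6) / (2 * pi\<^sup>2)"
    unfolding le using inverse_squares_sums unfolding sums_def
    by (intro tendsto_intros) (auto simp: add.commute)
  then have lim: "(\<lambda>N. low_energy (\<lambda>t. t) (real N)) \<longlonglongrightarrow> 1 / 3"
    by simp
  have "\<exists>c. (\<integral>t. t\<^sup>2 \<partial>unit_measure) - low_energy (\<lambda>t. t) c < \<epsilon>" if "\<epsilon> > 0" for \<epsilon>
  proof -
    have "eventually (\<lambda>N. low_energy (\<lambda>t. t) (real N) > 1 / 3 - \<epsilon>) sequentially"
      by (rule order_tendstoD[OF lim]) (use that in auto)
    then obtain N where "low_energy (\<lambda>t. t) (real N) > 1 / 3 - \<epsilon>"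
      by (auto simp: eventually_sequentially)
    then show ?thesis using n by (intro exI[of _ "real N"]) simp
  qed
  with s have "(\<lambda>t. t) \<in> trig_closure" by (auto simp: trig_closure_def)
  then show ?thesis by (auto simp: trig_bounded_def intro!: exI[of _ 1])
qed

text \<open>Bernstein polynomials approximate uniformly on [0, 1], hence in the norm of the unit
  interval. The values at 0 and 1 may differ, which uniform approximation by trigonometric
  polynomials would forbid.\<close>

lemma trig_closure_continuous:
  assumes f: "continuous_on UNIV (f :: real \<Rightarrow> real)"
  shows "f \<in> trig_closure"
proof (rule trig_closure_approx)
  have bm: "f \<in> borel_measurable borel" by (rule borel_measurable_continuous_onI[OF f])
  have f01: "continuous_on {0..1} f" using f continuous_on_subset by blast
  have "compact (f ` {0..1})" by (rule compact_continuous_image[OF f01]) simp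
  then obtain B where B: "\<And>t. t \<in> {0..1} \<Longrightarrow> norm (f t) \<le> B"
    using compact_imp_bounded bounded_iff by (metis imageI)
  show sf: "f \<in> sqint unit_measure"
    by (rule unit.sqint_bounded[where B=B]) (use B in \<open>auto simp: space_unit intro: unit_measurable bm\<close>)
  fix \<epsilon> :: real assume e: "\<epsilon> > 0"
  define \<delta> where "\<delta> = sqrt (\<epsilon> / 2)"
  have "\<delta> > 0" using e by (simp add: \<delta>_def)
  from Bernstein_Weierstrass[OF f01 this] obtain n
    where n: "\<And>x. x \<in> {0..1} \<Longrightarrow> \<bar>f x - (\<Sum>k\<le>n. f (k / n) * Bernstein n k x)\<bar> \<le> \<delta>"
    using less_imp_le by blast
  define g where "g = (\<lambda>x. \<Sum>k\<le>n. f (k / n) * Bernstein n k x)"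
  have "g \<in> trig_bounded"
    unfolding g_def Bernstein_def
    by (intro trig_bounded_sum trig_bounded_mult trig_bounded_power trig_bounded_const trig_bounded_ident
        trig_bounded_add[OF trig_bounded_const trig_bounded_mult[OF trig_bounded_const[of "-1"] trig_bounded_ident], of 1, simplified])
  then have g: "g \<in> trig_closure" by (simp add: trig_bounded_def)
  have "(\<integral>t. (f t - g t)\<^sup>2 \<partial>unit_measure) \<le> (\<integral>t. \<delta>\<^sup>2 \<partial>unit_measure)"
  proof (rule integral_mono)
    show "integrable unit_measure (\<lambda>t. (f t - g t)\<^sup>2)"
      by (intro sqint_integrable_power2 sqint_diff sf trig_closure_sqint g)
    show "(f t - g t)\<^sup>2 \<le> \<delta>\<^sup>2" if "t \<in> space unit_measure" for t
      using n[of t] that \<open>\<delta> > 0\<close> by (auto simp: space_unit g_def abs_le_square_iff[symmetric])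
  qed auto
  also have "\<dots> < \<epsilon>" using e unit.prob_space by (simp add: \<delta>_def space_unit)
  finally show "\<exists>g\<in>trig_closure. (\<integral>t. (f t - g t)\<^sup>2 \<partial>unit_measure) < \<epsilon>" using g by blast
qed

lemma trig_closure_limit:
  assumes F: "\<And>n. F n \<in> trig_closure" and w: "w \<in> sqint unit_measure"
    and dom: "\<And>n t. t \<in> {0..<1} \<Longrightarrow> \<bar>F n t\<bar> \<le> w t"
    and lim: "\<And>t. t \<in> {0..<1} \<Longrightarrow> (\<lambda>n. F n t) \<longlonglongrightarrow> f t"
  shows "f \<in> trig_closure"
proof (rule trig_closure_approx)
  have mF: "F n \<in> borel_measurable unit_measure" for n
    by (intro sqint_measurable trig_closure_sqint F)
  have mf: "f \<in> borel_measurable unit_measure"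
    by (rule borel_measurable_LIMSEQ_real[OF _ mF]) (auto simp: space_unit intro: lim)
  have fw: "\<bar>f t\<bar> \<le> w t" if "t \<in> {0..<1}" for t
    using tendsto_rabs[OF lim[OF that]] dom[OF that] by (intro LIMSEQ_le_const2) auto
  show sf: "f \<in> sqint unit_measure"
    by (rule sqint_dominated[OF w mf]) (use fw in \<open>force simp: space_unit\<close>)
  fix \<epsilon> :: real assume e: "\<epsilon> > 0"
  have "(\<lambda>n. \<integral>t. (f t - F n t)\<^sup>2 \<partial>unit_measure) \<longlonglongrightarrow> (\<integral>t. 0 \<partial>unit_measure)"
  proof (rule integral_dominated_convergence[where w="\<lambda>t. (2 * w t)\<^sup>2"])
    show "integrable unit_measure (\<lambda>t. (2 * w t)\<^sup>2)"
      by (intro sqint_integrable_power2 sqint_cmult w)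
    show "AE t in unit_measure. (\<lambda>n. (f t - F n t)\<^sup>2) \<longlonglongrightarrow> 0"
    proof (rule AE_I2)
      fix t assume "t \<in> space unit_measure"
      then have "(\<lambda>n. (f t - F n t)\<^sup>2) \<longlonglongrightarrow> (f t - f t)\<^sup>2"
        by (intro tendsto_intros lim) (auto simp: space_unit)
      then show "(\<lambda>n. (f t - F n t)\<^sup>2) \<longlonglongrightarrow> 0" by simp
    qed
    show "AE t in unit_measure. norm ((f t - F n t)\<^sup>2) \<le> (2 * w t)\<^sup>2" for n
    proof (rule AE_I2)
      fix t assume "t \<in> space unit_measure"
      then have "\<bar>f t - F n t\<bar> \<le> \<bar>2 * w t\<bar>" using fw[of t] dom[of t n] by (auto simp: space_unit)
      then show "norm ((f t - F n t)\<^sup>2) \<le> (2 * w t)\<^sup>2" unfolding abs_le_square_iff by simp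
    qed
  qed (use mf mF in auto)
  then have "eventually (\<lambda>n. (\<integral>t. (f t - F n t)\<^sup>2 \<partial>unit_measure) < \<epsilon>) sequentially"
    using e by (intro order_tendstoD) auto
  then show "\<exists>g\<in>trig_closure. (\<integral>t. (f t - g t)\<^sup>2 \<partial>unit_measure) < \<epsilon>"
    using F by (auto simp: eventually_sequentially)
qed

lemma trig_closure_indicator:
  assumes "A \<in> sets borel"
  shows "(indicator A :: real \<Rightarrow> real) \<in> trig_closure"
proof -
  have one: "(\<lambda>_. 1) \<in> sqint unit_measure" by (rule unit.sqint_bounded[where B=1]) auto
  have half: "(indicator {..a} :: real \<Rightarrow> real) \<in> trig_closure" for a
  proof (rule trig_closure_limit[OF _ one])
    \<comment> \<open>Continuous ramps that equal 1 up to \<open>a\<close> and, for n > 0, have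
      fallen to 0 at a + 1 / n.\<close>
    define F where "F n t = max 0 (min 1 (1 - real n * (t - a)))" for n t
    show "F n \<in> trig_closure" for n
      unfolding F_def by (intro trig_closure_continuous continuous_intros)
    show "\<bar>F n t\<bar> \<le> 1" for n t by (auto simp: F_def)
    fix t :: real
    show "(\<lambda>n. F n t) \<longlonglongrightarrow> indicator {..a} t"
    proof (cases "t \<le> a")
      case True
      then have "F n t = 1" for n by (auto simp: F_def mult_nonneg_nonpos)
      then show ?thesis using True by simp
    next
      case False
      obtain N where N: "1 / (t - a) < real N" using reals_Archimedean2 by blast
      have "F n t = 0" if "n \<ge> N" for n
      proof -
        have "1 < real N * (t - a)" using N False by (simp add: field_simps)
        also have "\<dots> \<le> real n * (t - a)" using that False by (intro mult_right_mono) auto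
        finally show ?thesis by (simp add: F_def)
      qed
      then have "eventually (\<lambda>n. F n t = 0) sequentially" by (auto simp: eventually_sequentially)
      then show ?thesis using False by (simp add: tendsto_eventually)
    qed
  qed
  \<comment> \<open>Half-lines form an intersection-stable generator of the Borel sets, so
    complements and disjoint countable unions remain.\<close>
  have "Int_stable (range (\<lambda>a::real. {..a}))"
    by (auto simp: Int_stable_def)
  moreover have "range (\<lambda>a::real. {..a}) \<subseteq> Pow UNIV" by simp
  moreover have "A \<in> sigma_sets UNIV (range (\<lambda>a::real. {..a}))"
    using assms by (simp add: borel_eq_atMost)
  ultimately show ?thesis
  proof (induct rule: sigma_sets_induct_disjoint)
    case (basic A)
    then show ?case using half by auto
  next
    case empty
    then show ?case using trig_closure_cmult[OF half[of 0], of 0] by (simp add: indicator_def)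
  next
    case (compl A)
    have "(\<lambda>t. cas 0 t + (-1) * indicator A t) \<in> trig_closure"
      by (intro trig_closure_add trig_closure_cmult trig_closure_cas compl)
    also have "(\<lambda>t. cas 0 t + (-1) * indicator A t) = (indicator (UNIV - A) :: real \<Rightarrow> real)"
      by (auto simp: indicator_def)
    finally show ?case .
  next
    case (union A)
    show ?case
    proof (rule trig_closure_limit[OF _ one])
      show "(\<lambda>t. \<Sum>i<n. indicator (A i) t) \<in> trig_closure" for n
        by (intro trig_closure_sum union)
      have eq: "(\<Sum>i<n. indicator (A i) t) = (indicator (\<Union>i<n. A i) t :: real)" for n t
        by (rule indicator_UN_disjoint[symmetric])
           (use union(1) in \<open>auto simp: disjoint_family_on_def\<close>)
      show "\<bar>\<Sum>i<n. indicator (A i) t\<bar> \<le> (1::real)" for n and t :: real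
        unfolding eq by (simp add: indicator_def)
      show "(\<lambda>n. \<Sum>i<n. indicator (A i) t) \<longlonglongrightarrow> (indicator (\<Union>i. A i) t :: real)" for t
        unfolding eq by (rule LIMSEQ_indicator_UN)
    qed
  qed
qed

text \<open>Simple functions of modulus at most 2 |f| converge pointwise to \<open>f\<close>, so
  dominated convergence reduces the claim to indicators of Borel sets.\<close>

theorem trig_complete:
  assumes f: "f \<in> borel_measurable borel" and s: "f \<in> sqint unit_measure"
  shows "f \<in> trig_closure"
proof -
  obtain F where F: "\<And>i. simple_function borel (F i)" "\<And>x. (\<lambda>i. F i x) \<longlonglongrightarrow> f x"
    "\<And>i x. dist (F i x) 0 \<le> 2 * dist (f x) 0"
    using borel_measurable_implies_sequence_metric[OF f, of 0] by (auto simp: space_borel)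
  show ?thesis
  proof (rule trig_closure_limit[OF _ _ _ F(2)])
    show "F i \<in> trig_closure" for i
    proof -
      have fin: "finite (range (F i))" using simple_functionD(1)[OF F(1)] by simp
      have "(\<lambda>t. \<Sum>y\<in>range (F i). y * indicator (F i -` {y}) t) \<in> trig_closure"
        using simple_functionD(2)[OF F(1)]
        by (intro trig_closure_sum trig_closure_cmult trig_closure_indicator) auto
      also have "(\<lambda>t. \<Sum>y\<in>range (F i). y * indicator (F i -` {y}) t) = F i"
      proof
        fix t
        have "(\<Sum>y\<in>range (F i). y * indicator (F i -` {y}) t) = (\<Sum>y\<in>range (F i). if y = F i t then y else 0)"
          by (intro sum.cong) (auto simp: indicator_def)
        also have "\<dots> = F i t" using fin by (simp add: sum.delta)
        finally show "(\<Sum>y\<in>range (F i). y * indicator (F i -` {y}) t) = F i t" .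
      qed
      finally show ?thesis .
    qed
    show "(\<lambda>t. \<bar>2 * f t\<bar>) \<in> sqint unit_measure"
      using sqint_cmult[OF s, of 2] by (auto simp: sqint_def)
    show "\<bar>F i t\<bar> \<le> \<bar>2 * f t\<bar>" for i t
      using F(3)[of i t] by (simp add: dist_real_def abs_mult)
  qed
qed

corollary Parseval_L2_per:
  assumes f: "f \<in> L2_per" and "\<epsilon> > 0"
  shows "\<exists>c. \<forall>d\<ge>c. (L2_norm f)\<^sup>2 - low_energy f d < \<epsilon>"
proof -
  have "f \<in> trig_closure" using f by (auto simp: L2_per_iff intro: trig_complete)
  with \<open>\<epsilon> > 0\<close> obtain c where "(\<integral>t. (f t)\<^sup>2 \<partial>unit_measure) - low_energy f c < \<epsilon>"
    by (auto simp: trig_closure_def)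
  then have "(L2_norm f)\<^sup>2 - low_energy f d < \<epsilon>" if "d \<ge> c" for d
    using low_energy_mono[OF that, of f] by (simp add: L2_norm_power2)
  then show ?thesis by blast
qed

corollary Parseval_limit:
  assumes f: "f \<in> L2_per"
  shows "(\<lambda>N::nat. low_energy f (real N)) \<longlonglongrightarrow> (L2_norm f)\<^sup>2"
proof (rule LIMSEQ_I)
  fix \<epsilon> :: real assume "\<epsilon> > 0"
  from Parseval_L2_per[OF f this] obtain c
    where c: "\<And>d. d \<ge> c \<Longrightarrow> (L2_norm f)\<^sup>2 - low_energy f d < \<epsilon>" by blast
  have "norm (low_energy f (real N) - (L2_norm f)\<^sup>2) < \<epsilon>" if "N \<ge> nat \<lceil>c\<rceil>" for N
  proof -
    have "real N \<ge> c" using that by linarith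
    then show ?thesis
      using c[of "real N"] Bessel[OF L2_per_sqint[OF f], of "real N"] unfolding L2_norm_power2 by auto
  qed
  then show "\<exists>N0. \<forall>N\<ge>N0. norm (low_energy f (real N) - (L2_norm f)\<^sup>2) < \<epsilon>" by blast
qed

subsection \<open>Besov balls in terms of low-frequency energy\<close>

text \<open>With cosine coefficient A and sine coefficient B, the complex coefficient is A - i B,
  while the Hartley coefficients at j and -j are A + B and A - B.\<close>

lemma fourier_coeff_hartley:
  assumes f: "f \<in> sqint unit_measure"
  shows "(cmod (fourier_coeff f j))\<^sup>2 = ((hartley f j)\<^sup>2 + (hartley f (- j))\<^sup>2) / 2"
proof -
  define A where "A = (\<integral>t. f t * cos (2 * pi * of_int j * t) \<partial>unit_measure)"
  define B where "B = (\<integral>t. f t * sin (2 * pi * of_int j * t) \<partial>unit_measure)"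
  have cs: "(\<lambda>t. cos (2 * pi * of_int j * t)) \<in> sqint unit_measure" "(\<lambda>t. sin (2 * pi * of_int j * t)) \<in> sqint unit_measure"
    by (rule unit.sqint_bounded[where B=1]; auto intro: unit_measurable)+
  have ic: "integrable unit_measure (\<lambda>t. f t * cos (2 * pi * of_int j * t))"
    and isn: "integrable unit_measure (\<lambda>t. f t * sin (2 * pi * of_int j * t))"
    by (intro sqint_integrable_mult f cs)+
  have "fourier_coeff f j = (\<integral>t. complex_of_real (f t * cos (2 * pi * of_int j * t)) - \<i> * complex_of_real (f t * sin (2 * pi * of_int j * t)) \<partial>unit_measure)"
    unfolding fourier_coeff_def unit_integral[symmetric]
  proof (intro Bochner_Integration.integral_cong refl)
    fix t
    have "2 * of_real pi * \<i> * of_int j * of_real t = \<i> * of_real (2 * pi * of_int j * t)"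
      by simp
    then have "fourier_basis j t = cis (2 * pi * of_int j * t)"
      unfolding fourier_basis_def cis_conv_exp by (simp only:)
    then show "complex_of_real (f t) * cnj (fourier_basis j t) =
      complex_of_real (f t * cos (2 * pi * of_int j * t)) - \<i> * complex_of_real (f t * sin (2 * pi * of_int j * t))"
      by (simp add: complex_eq_iff)
  qed
  also have "\<dots> = complex_of_real A - \<i> * complex_of_real B"
    unfolding A_def B_def using ic isn
    by (simp del: of_real_mult)
  finally have "(cmod (fourier_coeff f j))\<^sup>2 = A\<^sup>2 + B\<^sup>2"
    by (simp add: cmod_power2)
  moreover have "hartley f j = A + B" "hartley f (- j) = A - B"
    unfolding hartley_def cas_def A_def B_def using ic isn by (simp_all add: distrib_left right_diff_distrib)
  ultimately show ?thesis by (simp add: power2_sum power2_diff)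
qed

text \<open>For non-negative terms the unordered sum can be evaluated along an exhausting sequence
  of finite sets, and every finite set of integers lies in some \<open>low N\<close>.\<close>

lemma has_sum_nonneg_low:
  fixes g :: "int \<Rightarrow> real"
  assumes nn: "\<And>j. g j \<ge> 0" and lim: "(\<lambda>N::nat. sum g (low (real N))) \<longlonglongrightarrow> L"
  shows "(g has_sum L) UNIV"
proof -
  have ex: "\<exists>N::nat. \<forall>n\<ge>N. F \<subseteq> low (real n)" if "finite F" for F
  proof (intro exI allI impI subsetI)
    fix n j assume n: "n \<ge> nat (\<Sum>i\<in>F. \<bar>i\<bar>)" and j: "j \<in> F"
    have "\<bar>j\<bar> \<le> (\<Sum>i\<in>F. \<bar>i\<bar>)" using that j by (intro member_le_sum) auto
    with n show "j \<in> low (real n)" by (simp; linarith)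
  qed
  have inc: "incseq (\<lambda>N. sum g (low (real N)))"
    by (intro monoI sum_mono2 low_mono) (auto simp: nn)
  have le: "sum g F \<le> L" if F: "finite F" for F
  proof -
    obtain N :: nat where "F \<subseteq> low (real N)" using ex[OF F] by blast
    then have "sum g F \<le> sum g (low (real N))" by (intro sum_mono2) (auto simp: nn)
    also have "\<dots> \<le> L" by (rule incseq_le[OF inc lim])
    finally show ?thesis .
  qed
  have "g summable_on UNIV"
    by (rule nonneg_bdd_above_summable_on) (auto simp: nn intro!: bdd_aboveI[of _ L] le)
  then have "(g has_sum infsum g UNIV) UNIV" by simp
  moreover have "filterlim (\<lambda>N. low (real N)) (finite_subsets_at_top UNIV) sequentially"
    unfolding filterlim_finite_subsets_at_top using ex by (auto simp: eventually_sequentially)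
  ultimately have "(\<lambda>N::nat. sum g (low (real N))) \<longlonglongrightarrow> infsum g UNIV"
    unfolding has_sum_def by (rule filterlim_compose)
  with lim have "infsum g UNIV = L" using LIMSEQ_unique by blast
  with \<open>(g has_sum infsum g UNIV) UNIV\<close> show ?thesis by simp
qed

text \<open>Complex and Hartley energies agree only after adding the frequencies j and -j, hence on
  the symmetric sets \<open>low l\<close>, whose complements are the index sets of the Besov
  condition.\<close>

lemma fourier_tail:
  assumes f: "f \<in> L2_per"
  shows "(\<Sum>\<^sub>\<infinity>j\<in>{j::int. \<bar>real_of_int j\<bar> > l}. (cmod (fourier_coeff f j))\<^sup>2) = (L2_norm f)\<^sup>2 - low_energy f l"
proof -
  let ?g = "\<lambda>j. (cmod (fourier_coeff f j))\<^sup>2"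
  have s: "sum ?g (low c) = low_energy f c" for c
  proof -
    have "(\<Sum>j\<in>low c. (hartley f (- j))\<^sup>2) = (\<Sum>j\<in>low c. (hartley f j)\<^sup>2)"
      by (rule sum.reindex_bij_witness[of _ uminus uminus]) auto
    then show ?thesis
      by (simp add: fourier_coeff_hartley[OF L2_per_sqint[OF f]] low_energy_def sum_divide_distrib[symmetric] sum.distrib)
  qed
  have "(?g has_sum (L2_norm f)\<^sup>2) UNIV"
    by (rule has_sum_nonneg_low) (simp_all add: s Parseval_limit[OF f])
  then have "(?g has_sum ((L2_norm f)\<^sup>2 - sum ?g (low l))) (UNIV - low l)"
    by (rule has_sum_Diff) (auto intro: has_sum_finite)
  moreover have "UNIV - low l = {j::int. \<bar>real_of_int j\<bar> > l}" by auto
  ultimately show ?thesis unfolding s by (metis infsumI)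
qed

lemma besov_ball_iff:
  "f \<in> besov_ball s P \<longleftrightarrow>
    f \<in> L2_per \<and> (\<forall>l>0. l powr (2 * s) * ((L2_norm f)\<^sup>2 - low_energy f l) \<le> P)"
  by (auto simp: besov_ball_def fourier_tail)

lemma L2_per_cmult: "f \<in> L2_per \<Longrightarrow> (\<lambda>t. k * f t) \<in> L2_per"
  using L2_per_lin[of f f k 0] by simp

lemma L2_per_add: "f \<in> L2_per \<Longrightarrow> g \<in> L2_per \<Longrightarrow> (\<lambda>t. f t + g t) \<in> L2_per"
  using L2_per_lin[of f g 1 1] by simp

lemma L2_per_diff: "f \<in> L2_per \<Longrightarrow> g \<in> L2_per \<Longrightarrow> (\<lambda>t. f t - g t) \<in> L2_per"
  using L2_per_lin[of f g 1 "-1"] by simp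

lemma L2_norm_cmult_power2: "(L2_norm (\<lambda>t. k * f t))\<^sup>2 = k\<^sup>2 * (L2_norm f)\<^sup>2"
  by (simp add: L2_norm_power2 power_mult_distrib)

lemma low_energy_cmult: "low_energy (\<lambda>t. k * f t) c = k\<^sup>2 * low_energy f c"
  by (simp add: low_energy_def hartley_def mult.assoc power_mult_distrib sum_distrib_left)

lemma L2_norm_nonneg: "L2_norm f \<ge> 0"
  by (simp add: L2_norm_unit)

lemma low_energy_le_norm: "f \<in> L2_per \<Longrightarrow> low_energy f c \<le> (L2_norm f)\<^sup>2"
  using Bessel[OF L2_per_sqint] by (simp add: L2_norm_power2)

lemma scaled_ball_tail:
  assumes "f \<in> scale_set \<gamma> (besov_ball s P)" and "l > 0"
  shows "f \<in> L2_per" and "(L2_norm f)\<^sup>2 - low_energy f l \<le> \<gamma>\<^sup>2 * P * l powr (- 2 * s)"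
proof -
  from assms obtain g where g: "g \<in> besov_ball s P" and f: "f = (\<lambda>t. \<gamma> * g t)"
    by (auto simp: scale_set_def)
  from g show "f \<in> L2_per" by (simp add: f besov_ball_iff L2_per_cmult)
  have "l powr (2 * s) * ((L2_norm g)\<^sup>2 - low_energy g l) \<le> P"
    using g \<open>l > 0\<close> by (simp add: besov_ball_iff)
  then have "(L2_norm g)\<^sup>2 - low_energy g l \<le> P * l powr (- 2 * s)"
    using \<open>l > 0\<close> by (simp add: powr_minus field_simps)
  then have "\<gamma>\<^sup>2 * ((L2_norm g)\<^sup>2 - low_energy g l) \<le> \<gamma>\<^sup>2 * (P * l powr (- 2 * s))"
    by (intro mult_left_mono) auto
  then show "(L2_norm f)\<^sup>2 - low_energy f l \<le> \<gamma>\<^sup>2 * P * l powr (- 2 * s)"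
    by (simp add: f L2_norm_cmult_power2 low_energy_cmult right_diff_distrib mult.assoc)
qed

lemma L2_norm_proj: "(L2_norm (proj c f))\<^sup>2 = low_energy f c"
  by (simp add: L2_norm_power2 norm_proj)

lemma low_energy_proj: "low_energy (proj c f) l = low_energy f (min c l)"
proof -
  have "low_energy (proj c f) l = (\<Sum>j\<in>low l. if \<bar>real_of_int j\<bar> \<le> c then (hartley f j)\<^sup>2 else 0)"
    unfolding low_energy_def by (intro sum.cong) (auto simp: hartley_proj)
  also have "\<dots> = (\<Sum>j\<in>low (min c l). (hartley f j)\<^sup>2)"
    by (subst sum.inter_filter[symmetric]) (auto intro!: sum.cong)
  finally show ?thesis by (simp add: low_energy_def)
qed

text \<open>Beyond \<open>c\<close> the projection has no tail; for l < c the weight is at most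
  \<open>c powr (2 * s)\<close> and the tail at most the full squared norm. The bound is demanded
  only for 0 < c, so the projection on constants falls under the same lemma.\<close>

lemma proj_in_scaled_ball:
  assumes f: "f \<in> L2_per" and "\<gamma> > 0" "s > 0" "P > 0"
    and b: "0 < c \<Longrightarrow> c powr (2 * s) * (L2_norm f)\<^sup>2 \<le> \<gamma>\<^sup>2 * P"
  shows "proj c f \<in> scale_set \<gamma> (besov_ball s P)"
proof -
  define k where "k = 1 / \<gamma>"
  have k: "k > 0" "k\<^sup>2 * \<gamma>\<^sup>2 = 1" using \<open>\<gamma> > 0\<close> by (auto simp: k_def power_divide)
  define g where "g = (\<lambda>t. k * proj c f t)"
  have "l powr (2 * s) * ((L2_norm g)\<^sup>2 - low_energy g l) \<le> P" if "l > 0" for l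
  proof (cases "c \<le> l")
    case True
    then show ?thesis
      using \<open>P > 0\<close> by (simp add: g_def L2_norm_cmult_power2 low_energy_cmult L2_norm_proj low_energy_proj min_absorb1)
  next
    case False
    then have "0 < c" "l < c" using that by auto
    have "l powr (2 * s) * (low_energy f c - low_energy f (min c l)) \<le> c powr (2 * s) * (L2_norm f)\<^sup>2"
      using \<open>l < c\<close> that \<open>s > 0\<close> low_energy_nonneg[of f "min c l"] low_energy_le_norm[OF f, of c]
        low_energy_mono[of "min c l" c f]
      by (intro mult_mono powr_mono2) auto
    also have "\<dots> \<le> \<gamma>\<^sup>2 * P" by (rule b[OF \<open>0 < c\<close>])
    finally have "k\<^sup>2 * (l powr (2 * s) * (low_energy f c - low_energy f (min c l))) \<le> k\<^sup>2 * (\<gamma>\<^sup>2 * P)"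
      by (intro mult_left_mono) auto
    also have "\<dots> = P" using k(2) by (simp flip: mult.assoc)
    finally show ?thesis
      by (simp add: g_def L2_norm_cmult_power2 low_energy_cmult L2_norm_proj low_energy_proj algebra_simps)
  qed
  then have "g \<in> besov_ball s P"
    by (simp add: besov_ball_iff g_def L2_per_cmult[OF proj_L2_per])
  moreover have "proj c f = (\<lambda>t. \<gamma> * g t)" using \<open>\<gamma> > 0\<close> by (simp add: g_def k_def)
  ultimately show ?thesis by (auto simp: scale_set_def)
qed

section \<open>Inner products and truncation\<close>

lemma inner_proj: "f \<in> L2_per \<Longrightarrow> L2_inner f (proj c g) = (\<Sum>j\<in>low c. hartley f j * hartley g j)"
  using orthonormal_inner[OF finite_low[of c] cas_sqint L2_per_sqint[of f], where a="hartley g" and j1="\<lambda>i. i"]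
  unfolding proj_def L2_inner_unit hartley_def[of f] by (simp add: mult.commute)

lemma inner_proj_proj: "f \<in> L2_per \<Longrightarrow> L2_inner f (proj c g) = L2_inner (proj c f) (proj c g)"
  by (simp add: inner_proj proj_L2_per hartley_proj)

lemma inner_proj_self: "f \<in> L2_per \<Longrightarrow> L2_inner f (proj c f) = low_energy f c"
  by (simp add: inner_proj low_energy_def power2_eq_square)

lemma L2_Cauchy_Schwarz: "f \<in> L2_per \<Longrightarrow> g \<in> L2_per \<Longrightarrow> \<bar>L2_inner f g\<bar> \<le> L2_norm f * L2_norm g"
  unfolding L2_inner_unit L2_norm_unit by (intro sqint_Cauchy_Schwarz_abs L2_per_sqint)

lemma L2_inner_integrable:
  "f \<in> L2_per \<Longrightarrow> g \<in> L2_per \<Longrightarrow> integrable unit_measure (\<lambda>t. f t * g t)"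
  by (intro sqint_integrable_mult L2_per_sqint)

lemma L2_inner_diff_right:
  "f \<in> L2_per \<Longrightarrow> g \<in> L2_per \<Longrightarrow> h \<in> L2_per \<Longrightarrow>
    L2_inner f (\<lambda>t. g t - h t) = L2_inner f g - L2_inner f h"
  using L2_inner_integrable[of f g] L2_inner_integrable[of f h]
  by (simp add: L2_inner_unit right_diff_distrib)

lemma L2_norm_diff_proj:
  assumes "f \<in> L2_per"
  shows "(L2_norm (\<lambda>t. f t - proj c f t))\<^sup>2 = (L2_norm f)\<^sup>2 - low_energy f c"
  using norm_diff_proj[OF L2_per_sqint[OF assms], of c] by (simp add: L2_norm_power2)

text \<open>Truncation is self-adjoint and idempotent, so the low part of \<open>g\<close> sees only
  the low part of \<open>f\<close>; the remainder of \<open>g\<close> is paired with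
  \<open>f\<close> by Cauchy-Schwarz. The inner product is thus small once \<open>f\<close> has
  little low-frequency energy and \<open>g\<close> a small tail.\<close>

lemma L2_inner_low_bound:
  assumes f: "f \<in> L2_per" and g: "g \<in> L2_per"
  shows "\<bar>L2_inner f g\<bar> \<le> sqrt (low_energy f c) * sqrt (low_energy g c)
    + L2_norm f * sqrt ((L2_norm g)\<^sup>2 - low_energy g c)"
proof -
  have n: "L2_norm (proj c h) = sqrt (low_energy h c)" for h
    by (metis L2_norm_proj L2_norm_nonneg real_sqrt_unique)
  have "L2_inner f g = L2_inner (proj c f) (proj c g) + L2_inner f (\<lambda>t. g t - proj c g t)"
    using L2_inner_diff_right[OF f g proj_L2_per, of c g] inner_proj_proj[OF f, of c g] by simp
  moreover have "\<bar>L2_inner (proj c f) (proj c g)\<bar> \<le> sqrt (low_energy f c) * sqrt (low_energy g c)"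
    using L2_Cauchy_Schwarz[OF proj_L2_per proj_L2_per, of c f c g] by (simp add: n)
  moreover have "\<bar>L2_inner f (\<lambda>t. g t - proj c g t)\<bar> \<le> L2_norm f * L2_norm (\<lambda>t. g t - proj c g t)"
    by (intro L2_Cauchy_Schwarz f L2_per_diff g proj_L2_per)
  moreover have "L2_norm (\<lambda>t. g t - proj c g t) = sqrt ((L2_norm g)\<^sup>2 - low_energy g c)"
    using L2_norm_diff_proj[OF g, of c] L2_norm_nonneg by (metis real_sqrt_unique)
  ultimately show ?thesis by (simp only:)
qed

lemma L2_norm_add_power2:
  assumes "f \<in> L2_per" "g \<in> L2_per"
  shows "(L2_norm (\<lambda>t. f t + g t))\<^sup>2 = (L2_norm f)\<^sup>2 + (L2_norm g)\<^sup>2 + 2 * L2_inner f g"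
  using sqint_integrable_power2[OF L2_per_sqint[OF assms(1)]] sqint_integrable_power2[OF L2_per_sqint[OF assms(2)]]
    L2_inner_integrable[OF assms]
  by (simp add: L2_norm_power2 L2_inner_unit power2_sum mult.assoc)

lemma L2_norm_diff_power2:
  assumes "f \<in> L2_per" "g \<in> L2_per"
  shows "(L2_norm (\<lambda>t. f t - g t))\<^sup>2 = (L2_norm f)\<^sup>2 + (L2_norm g)\<^sup>2 - 2 * L2_inner f g"
  using sqint_integrable_power2[OF L2_per_sqint[OF assms(1)]] sqint_integrable_power2[OF L2_per_sqint[OF assms(2)]]
    L2_inner_integrable[OF assms]
  by (simp add: L2_norm_power2 L2_inner_unit power2_diff mult.assoc)

lemma hartley_add:
  assumes "f \<in> L2_per" "g \<in> L2_per"
  shows "hartley (\<lambda>t. f t + g t) j = hartley f j + hartley g j"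
  using L2_inner_integrable[OF assms(1) cas_L2_per] L2_inner_integrable[OF assms(2) cas_L2_per]
  by (simp add: hartley_def distrib_right)

subsection \<open>Kernels and their Fourier transforms\<close>

locale kernel =
  fixes K :: "real \<Rightarrow> real"
  assumes admissible: "admissible_kernel K"
begin

lemma measurable_K [measurable]: "K \<in> borel_measurable borel"
  using admissible by (simp add: admissible_kernel_def)

definition bnd :: real where
  "bnd = (SOME B. (\<forall>t. \<bar>K t\<bar> \<le> B) \<and> B > 0)"

lemma bnd: "\<bar>K t\<bar> \<le> bnd" "bnd > 0"
proof -
  obtain B where B: "\<And>t. \<bar>K t\<bar> \<le> B" using admissible by (auto simp: admissible_kernel_def)
  then have "(\<forall>t. \<bar>K t\<bar> \<le> max B 1) \<and> max B 1 > 0" by (auto simp: le_max_iff_disj)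
  then have "(\<forall>t. \<bar>K t\<bar> \<le> bnd) \<and> bnd > 0" unfolding bnd_def by (rule someI)
  then show "\<bar>K t\<bar> \<le> bnd" "bnd > 0" by auto
qed

lemma K_support: "\<bar>t\<bar> > 1 \<Longrightarrow> K t = 0"
proof -
  assume "\<bar>t\<bar> > 1"
  then have "t \<notin> {-1..1}" by auto
  with admissible show ?thesis unfolding admissible_kernel_def by blast
qed

lemma K_even: "K (- t) = K t"
  using admissible by (simp add: admissible_kernel_def)

lemma K_integral: "(\<integral>t. K t \<partial>lborel) = 1"
  using admissible by (simp add: admissible_kernel_def)

lemma integrable_bounded_support:
  fixes g :: "real \<Rightarrow> real"
  assumes "g \<in> borel_measurable borel" "\<And>x. \<bar>g x\<bar> \<le> B" "\<And>x. x \<notin> {a..b} \<Longrightarrow> g x = 0"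
  shows "integrable lborel g"
proof (rule Bochner_Integration.integrable_bound)
  show "integrable lborel (\<lambda>x. B * indicator {a..b} x)"
    by (intro integrable_mult_right integrable_real_indicator) (auto simp: emeasure_lborel_Icc_eq)
  show "AE x in lborel. norm (g x) \<le> norm (B * indicator {a..b} x)"
  proof (rule AE_I2)
    fix x show "norm (g x) \<le> norm (B * indicator {a..b} x :: real)"
      using assms(2)[of x] assms(3)[of x] by (cases "x \<in> {a..b}") auto
  qed
qed (use assms in auto)

lemma K_mult_integrable:
  assumes [measurable]: "e \<in> borel_measurable borel" and "\<And>x. \<bar>e x\<bar> \<le> E"
  shows "integrable lborel (\<lambda>v. K v * e v)"
proof (rule integrable_bounded_support[where a="-1" and b=1 and B="bnd * E"])
  show "\<bar>K x * e x\<bar> \<le> bnd * E" for x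
    unfolding abs_mult using bnd(1)[of x] bnd(2) assms(2)[of x] by (intro mult_mono) auto
  show "K x * e x = 0" if "x \<notin> {-1..1}" for x
    using K_support[of x] that by auto
qed measurable

lemma K_integrable: "integrable lborel K"
  using K_mult_integrable[of "\<lambda>_. 1" 1] by simp

text \<open>\<open>K\<close> may change sign, so its \<open>L1\<close> norm, and not 1, bounds the
  transform.\<close>

definition mass :: real where "mass = (\<integral>v. \<bar>K v\<bar> \<partial>lborel)"

lemma mass_ge_1: "mass \<ge> 1"
  using integral_abs_bound[of lborel K] K_integral by (simp add: mass_def)

text \<open>The cosine transform is the whole Fourier transform because \<open>K\<close> is even;
  with the factor 2 pi its values at j h are the multipliers of the kernel smoother.\<close>

definition Khat :: "real \<Rightarrow> real" where
  "Khat x = (\<integral>v. K v * cos (2 * pi * x * v) \<partial>lborel)"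

lemma K_cos_integrable: "integrable lborel (\<lambda>v. K v * cos (x * v))"
  and K_sin_integrable: "integrable lborel (\<lambda>v. K v * sin (x * v))"
  by (rule K_mult_integrable[where E=1]; simp)+

lemma K_sin_integral: "(\<integral>v. K v * sin (x * v) \<partial>lborel) = 0"
  using lborel_integral_real_affine[of "-1" "\<lambda>v. K v * sin (x * v)" 0] by (simp add: K_even)

lemma Khat_le_mass: "\<bar>Khat x\<bar> \<le> mass"
proof -
  have "\<bar>Khat x\<bar> \<le> (\<integral>v. \<bar>K v * cos (2 * pi * x * v)\<bar> \<partial>lborel)"
    unfolding Khat_def by (rule integral_abs_bound)
  also have "\<dots> \<le> mass"
    unfolding mass_def
    by (intro integral_mono integrable_abs K_cos_integrable K_integrable)
       (auto simp: abs_mult intro!: mult_left_le)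
  finally show ?thesis .
qed

text \<open>Rests on 1 - cos y = 2 sin^2 (y / 2) \<le> y^2 / 2 and on |v| \<le> 1 over the support;
  the 1 is the integral of \<open>K\<close>.\<close>

lemma Khat_near_0: "\<bar>Khat x - 1\<bar> \<le> 2 * pi\<^sup>2 * x\<^sup>2 * mass"
proof -
  have "Khat x - 1 = (\<integral>v. K v * (cos (2 * pi * x * v) - 1) \<partial>lborel)"
    using K_cos_integrable[of "2 * pi * x"] K_integrable K_integral
    by (simp add: Khat_def right_diff_distrib)
  also have "\<bar>\<dots>\<bar> \<le> (\<integral>v. \<bar>K v * (cos (2 * pi * x * v) - 1)\<bar> \<partial>lborel)"
    by (rule integral_abs_bound)
  also have "\<dots> \<le> (\<integral>v. 2 * pi\<^sup>2 * x\<^sup>2 * \<bar>K v\<bar> \<partial>lborel)"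
  proof (intro integral_mono integrable_abs)
    show "integrable lborel (\<lambda>v. K v * (cos (2 * pi * x * v) - 1))"
      using K_cos_integrable[of "2 * pi * x"] K_integrable by (simp add: right_diff_distrib)
    show "integrable lborel (\<lambda>v. 2 * pi\<^sup>2 * x\<^sup>2 * \<bar>K v\<bar>)"
      using K_integrable by auto
    fix v
    show "\<bar>K v * (cos (2 * pi * x * v) - 1)\<bar> \<le> 2 * pi\<^sup>2 * x\<^sup>2 * \<bar>K v\<bar>"
    proof (cases "\<bar>v\<bar> > 1")
      case False
      define y where "y = 2 * pi * x * v"
      have "\<bar>cos y - 1\<bar> = 2 * (sin (y / 2))\<^sup>2"
        using cos_double_sin[of "y / 2"] by simp
      also have "\<dots> \<le> 2 * (y / 2)\<^sup>2"
        using abs_sin_x_le_abs_x[of "y / 2"] unfolding abs_le_square_iff by simp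
      also have "\<dots> = 2 * pi\<^sup>2 * x\<^sup>2 * v\<^sup>2" by (simp add: y_def power_mult_distrib)
      also have "\<dots> \<le> 2 * pi\<^sup>2 * x\<^sup>2 * 1"
        using False by (intro mult_left_mono) (auto simp: abs_square_le_1)
      finally have "\<bar>K v\<bar> * \<bar>cos y - 1\<bar> \<le> \<bar>K v\<bar> * (2 * pi\<^sup>2 * x\<^sup>2)"
        by (intro mult_left_mono) auto
      then show ?thesis by (simp add: abs_mult y_def mult.commute)
    qed (simp add: K_support)
  qed
  also have "\<dots> = 2 * pi\<^sup>2 * x\<^sup>2 * mass"
    by (simp add: mass_def)
  finally show ?thesis .
qed

text \<open>The point where the bound 2 pi^2 x^2 mass of \<open>Khat_near_0\<close> reaches
  1/2.\<close>

definition cutoff :: real where "cutoff = 1 / (2 * pi * sqrt mass)"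

lemma cutoff_pos: "cutoff > 0"
  using mass_ge_1 by (simp add: cutoff_def)

lemma Khat_ge_half: "\<bar>x\<bar> \<le> cutoff \<Longrightarrow> Khat x \<ge> 1 / 2"
proof -
  assume "\<bar>x\<bar> \<le> cutoff"
  then have "\<bar>x\<bar> \<le> \<bar>cutoff\<bar>" by simp
  then have "x\<^sup>2 \<le> cutoff\<^sup>2" by (simp only: abs_le_square_iff)
  then have "2 * pi\<^sup>2 * x\<^sup>2 * mass \<le> 2 * pi\<^sup>2 * cutoff\<^sup>2 * mass"
    using mass_ge_1 by (intro mult_right_mono mult_left_mono) auto
  also have "\<dots> = 1 / 2"
    using mass_ge_1 by (simp add: cutoff_def power_divide power_mult_distrib)
  finally show ?thesis using Khat_near_0[of x] by linarith
qed

lemma unit_integral_cos_bound: "\<bar>\<integral>t. cos (a * t + b) \<partial>unit_measure\<bar> \<le> 2 / \<bar>a\<bar>" if "a \<noteq> 0"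
proof -
  have "\<bar>sin (a + b) - sin b\<bar> \<le> 2"
    using abs_sin_le_one[of "a + b"] abs_sin_le_one[of b] by linarith
  then show ?thesis
    using that by (simp add: unit_integral_cos abs_divide divide_right_mono)
qed

text \<open>The product expands into four cosines with frequencies 2 pi (j + 2 x) and 2 pi (j - 2
  x), both at least 2 |x| in modulus because |j| \<le> |x|. The argument 2 u - 1 comes from mapping
  the unit interval onto [-1, 1].\<close>

lemma unit_integral_cas_cos_bound:
  assumes "\<bar>of_int j\<bar> \<le> \<bar>x\<bar>" "x \<noteq> 0"
  shows "\<bar>\<integral>u. cas j u * cos (2 * pi * x * (2 * u - 1)) \<partial>unit_measure\<bar> \<le> 4 / \<bar>x\<bar>"
proof -
  define p where "p = 2 * pi * of_int j + 4 * pi * x"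
  define q where "q = 2 * pi * of_int j - 4 * pi * x"
  have eq: "cas j u * cos (2 * pi * x * (2 * u - 1)) =
    (cos (p * u + (- 2 * pi * x)) + cos (q * u + 2 * pi * x)
      + cos (p * u + (- 2 * pi * x - pi / 2)) + cos (q * u + (2 * pi * x - pi / 2))) / 2" for u
  proof -
    define \<theta> where "\<theta> = 2 * pi * of_int j * u"
    define \<psi> where "\<psi> = 2 * pi * x * (2 * u - 1)"
    have 1: "p * u + (- 2 * pi * x) = \<theta> + \<psi>" "q * u + 2 * pi * x = \<theta> - \<psi>"
      by (simp_all add: p_def q_def \<theta>_def \<psi>_def algebra_simps)
    have 2: "p * u + (- 2 * pi * x - pi / 2) = (\<theta> + \<psi>) - pi / 2" "q * u + (2 * pi * x - pi / 2) = (\<theta> - \<psi>) - pi / 2"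
      unfolding 1[symmetric] by simp_all
    have 3: "cos (y - pi / 2) = sin y" for y by (simp add: cos_diff)
    show ?thesis unfolding 1 2 3 cas_def \<theta>_def[symmetric] \<psi>_def[symmetric]
      by (simp add: cos_add cos_diff sin_add sin_diff algebra_simps)
  qed
  have pq: "\<bar>p\<bar> \<ge> 2 * \<bar>x\<bar>" "\<bar>q\<bar> \<ge> 2 * \<bar>x\<bar>"
  proof -
    have "4 * pi * \<bar>x\<bar> - 2 * pi * \<bar>of_int j\<bar> \<ge> 2 * pi * \<bar>x\<bar>"
      using assms(1) by (simp add: algebra_simps)
    moreover have "2 * pi * \<bar>x\<bar> \<ge> 2 * \<bar>x\<bar>"
      using pi_gt3 by (simp add: mult_le_cancel_right)
    moreover have "\<bar>p\<bar> \<ge> \<bar>4 * pi * x\<bar> - \<bar>2 * pi * of_int j\<bar>" "\<bar>q\<bar> \<ge> \<bar>4 * pi * x\<bar> - \<bar>2 * pi * of_int j\<bar>"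
      by (simp_all add: p_def q_def)
    moreover have "\<bar>4 * pi * x\<bar> = 4 * pi * \<bar>x\<bar>" "\<bar>2 * pi * of_int j\<bar> = 2 * pi * \<bar>of_int j :: real\<bar>"
      by (simp_all add: abs_mult)
    ultimately show "\<bar>p\<bar> \<ge> 2 * \<bar>x\<bar>" "\<bar>q\<bar> \<ge> 2 * \<bar>x\<bar>" by linarith+
  qed
  have bd: "\<bar>\<integral>t. cos (a * t + b) \<partial>unit_measure\<bar> \<le> 1 / \<bar>x\<bar>" if "\<bar>a\<bar> \<ge> 2 * \<bar>x\<bar>" for a b
  proof -
    have "a \<noteq> 0" using that assms(2) by auto
    have "2 / \<bar>a\<bar> \<le> 2 / (2 * \<bar>x\<bar>)" using that assms(2) by (intro divide_left_mono) auto
    with unit_integral_cos_bound[OF \<open>a \<noteq> 0\<close>, of b] show ?thesis by simp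
  qed
  have int: "integrable unit_measure (\<lambda>t. cos (a * t + b))" for a b
    by (rule unit.integrable_const_bound[where B=1]) (auto intro: unit_measurable)
  have "(\<integral>u. cas j u * cos (2 * pi * x * (2 * u - 1)) \<partial>unit_measure) =
    ((\<integral>u. cos (p * u + (- 2 * pi * x)) \<partial>unit_measure) + (\<integral>u. cos (q * u + 2 * pi * x) \<partial>unit_measure)
      + (\<integral>u. cos (p * u + (- 2 * pi * x - pi / 2)) \<partial>unit_measure) + (\<integral>u. cos (q * u + (2 * pi * x - pi / 2)) \<partial>unit_measure)) / 2"
    unfolding eq by (simp only: integral_divide_zero Bochner_Integration.integral_add Bochner_Integration.integrable_add int)
  moreover have "\<bar>(a + b + c + d) / 2\<bar> \<le> 4 * y"
    if "\<bar>a\<bar> \<le> (y::real)" "\<bar>b\<bar> \<le> y" "\<bar>c\<bar> \<le> y" "\<bar>d\<bar> \<le> y" for a b c d y :: real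
  proof -
    have "0 \<le> y" using that(1) by linarith
    moreover have "a + b + c + d \<le> 4 * y" using that by (simp add: abs_le_iff)
    moreover have "- (a + b + c + d) \<le> 4 * y" using that by (simp add: abs_le_iff)
    ultimately have "\<bar>a + b + c + d\<bar> \<le> 4 * y" by (intro abs_leI)
    moreover have "\<bar>(a + b + c + d) / 2\<bar> \<le> \<bar>a + b + c + d\<bar>" by simp
    ultimately show ?thesis by (rule order_trans[rotated])
  qed
  note this[OF bd[OF pq(1), of "- 2 * pi * x"] bd[OF pq(2), of "2 * pi * x"]
      bd[OF pq(1), of "- 2 * pi * x - pi / 2"] bd[OF pq(2), of "2 * pi * x - pi / 2"]]
  ultimately show ?thesis by simp
qed

text \<open>Riemann--Lebesgue: on \<open>[-1, 1]\<close> the kernel is \<open>L\<^sub>2\<close>-close to a trigonometric polynomial.\<close>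

lemma Khat_decay:
  assumes "\<epsilon> > 0"
  shows "\<exists>w>0. \<forall>x. \<bar>x\<bar> \<ge> w \<longrightarrow> \<bar>Khat x\<bar> \<le> \<epsilon>"
proof -
  define k where "k = (\<lambda>u. K (2 * u - 1))"
  have km: "k \<in> borel_measurable borel" by (simp add: k_def)
  have ks: "k \<in> sqint unit_measure"
    by (rule unit.sqint_bounded[where B=bnd]) (use bnd km in \<open>auto simp: k_def intro: unit_measurable\<close>)
  have eq: "Khat x = 2 * (\<integral>u. k u * cos (2 * pi * x * (2 * u - 1)) \<partial>unit_measure)" for x
  proof -
    have "Khat x = 2 * (\<integral>u. K (-1 + 2 * u) * cos (2 * pi * x * (-1 + 2 * u)) \<partial>lborel)"
      unfolding Khat_def
      by (subst lborel_integral_real_affine[where c=2 and t="-1"]) simp_all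
    also have "(\<integral>u. K (-1 + 2 * u) * cos (2 * pi * x * (-1 + 2 * u)) \<partial>lborel)
      = (\<integral>u. k u * cos (2 * pi * x * (2 * u - 1)) \<partial>unit_measure)"
      unfolding unit_integral set_lebesgue_integral_def
    proof (rule integral_cong_AE)
      show "AE u in lborel. K (-1 + 2 * u) * cos (2 * pi * x * (-1 + 2 * u)) =
        indicator {0..<1} u *\<^sub>R (k u * cos (2 * pi * x * (2 * u - 1)))"
        using AE_lborel_singleton[of 1]
      proof eventually_elim
        case (elim u)
        show ?case
        proof (cases "u \<in> {0..<1}")
          case False
          with elim have "\<bar>2 * u - 1\<bar> > 1" by (auto simp: abs_real_def split: if_splits)
          then show ?thesis using K_support[of "2 * u - 1"] False by (simp add: algebra_simps)
        qed (simp add: k_def algebra_simps)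
      qed
    qed (use km in measurable)
    finally show ?thesis .
  qed
  have "(\<epsilon> / 4)\<^sup>2 > 0" using assms by simp
  from trig_closure_proj[OF trig_complete[OF km ks] this] obtain c
    where c: "(\<integral>t. (k t - proj c k t)\<^sup>2 \<partial>unit_measure) < (\<epsilon> / 4)\<^sup>2" .
  define S where "S = (\<Sum>j\<in>low c. \<bar>hartley k j\<bar>)"
  have "S \<ge> 0" by (simp add: S_def sum_nonneg)
  \<comment> \<open>The part |c| + 1 puts x above every frequency of the polynomial; 16 S /
    \<epsilon> makes the bound S * 4 / |x| at most \<epsilon> / 4.\<close>
  define w where "w = \<bar>c\<bar> + 1 + 16 * S / \<epsilon>"
  have "w > 0" using \<open>S \<ge> 0\<close> assms by (simp add: w_def add_pos_nonneg)
  have "\<bar>Khat x\<bar> \<le> \<epsilon>" if "\<bar>x\<bar> \<ge> w" for x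
  proof -
    define g where "g = (\<lambda>u. cos (2 * pi * x * (2 * u - 1)))"
    have gm: "g \<in> borel_measurable borel" by (simp add: g_def)
    have gs: "g \<in> sqint unit_measure"
      by (rule unit.sqint_bounded[where B=1]) (use gm in \<open>auto simp: g_def intro: unit_measurable\<close>)
    have g1: "(\<integral>u. (g u)\<^sup>2 \<partial>unit_measure) \<le> 1"
    proof -
      have "(\<integral>u. (g u)\<^sup>2 \<partial>unit_measure) \<le> (\<integral>u. 1 \<partial>unit_measure)"
        by (intro integral_mono sqint_integrable_power2 gs) (auto simp: g_def abs_square_le_1)
      then show ?thesis using unit.prob_space by (simp add: space_unit)
    qed
    have "x \<noteq> 0" using that \<open>w > 0\<close> by auto
    have "\<bar>x\<bar> \<ge> \<bar>c\<bar>" "\<bar>x\<bar> \<ge> 16 * S / \<epsilon>" using that \<open>S \<ge> 0\<close> assms by (auto simp: w_def) (smt (verit) divide_nonneg_pos)+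
    have "\<bar>\<integral>u. (k u - proj c k u) * g u \<partial>unit_measure\<bar>
      \<le> sqrt (\<integral>u. (k u - proj c k u)\<^sup>2 \<partial>unit_measure) * sqrt (\<integral>u. (g u)\<^sup>2 \<partial>unit_measure)"
      by (intro sqint_Cauchy_Schwarz_abs sqint_diff ks proj_sqint gs)
    also have "\<dots> \<le> (\<epsilon> / 4) * 1"
      using real_sqrt_le_mono[OF less_imp_le[OF c]] g1 assms by (intro mult_mono) auto
    finally have 1: "\<bar>\<integral>u. (k u - proj c k u) * g u \<partial>unit_measure\<bar> \<le> \<epsilon> / 4" by simp
    have "(\<integral>u. g u * proj c k u \<partial>unit_measure) = (\<Sum>j\<in>low c. hartley k j * (\<integral>u. g u * cas j u \<partial>unit_measure))"
      unfolding proj_def by (rule orthonormal_inner[OF finite_low cas_sqint gs])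
    also have "\<bar>\<dots>\<bar> \<le> (\<Sum>j\<in>low c. \<bar>hartley k j\<bar> * (4 / \<bar>x\<bar>))"
    proof (rule order_trans[OF sum_abs sum_mono])
      fix j assume "j \<in> low c"
      then have "\<bar>of_int j\<bar> \<le> \<bar>x\<bar>" using \<open>\<bar>x\<bar> \<ge> \<bar>c\<bar>\<close> by auto
      from unit_integral_cas_cos_bound[OF this \<open>x \<noteq> 0\<close>]
      have "\<bar>\<integral>u. g u * cas j u \<partial>unit_measure\<bar> \<le> 4 / \<bar>x\<bar>"
        by (simp add: g_def mult.commute)
      then show "\<bar>hartley k j * (\<integral>u. g u * cas j u \<partial>unit_measure)\<bar> \<le> \<bar>hartley k j\<bar> * (4 / \<bar>x\<bar>)"
        unfolding abs_mult by (intro mult_left_mono) auto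
    qed
    also have "\<dots> = S * (4 / \<bar>x\<bar>)" by (simp only: S_def sum_distrib_right)
    also have "\<dots> \<le> \<epsilon> / 4"
      using \<open>\<bar>x\<bar> \<ge> 16 * S / \<epsilon>\<close> assms \<open>x \<noteq> 0\<close> by (simp add: field_simps)
    finally have 2: "\<bar>\<integral>u. g u * proj c k u \<partial>unit_measure\<bar> \<le> \<epsilon> / 4" .
    have "(\<integral>u. k u * g u \<partial>unit_measure) = (\<integral>u. (k u - proj c k u) * g u \<partial>unit_measure) + (\<integral>u. g u * proj c k u \<partial>unit_measure)"
      using sqint_integrable_mult[OF sqint_diff[OF ks proj_sqint] gs, of c k] sqint_integrable_mult[OF gs proj_sqint, of c k]
      by (simp flip: Bochner_Integration.integral_add) (simp add: algebra_simps)
    with 1 2 have "\<bar>2 * (\<integral>u. k u * g u \<partial>unit_measure)\<bar> \<le> \<epsilon>" by linarith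
    then show ?thesis unfolding eq g_def .
  qed
  with \<open>w > 0\<close> show ?thesis by blast
qed

text \<open>The function of \<open>u\<close> to which \<open>line_integral\<close> applies the
  observation when the estimator is evaluated at \<open>t\<close>.\<close>

definition per :: "real \<Rightarrow> real \<Rightarrow> real \<Rightarrow> real" where
  "per h t u = (\<Sum>\<^sub>\<infinity>k::int. K ((t - (u + of_int k)) / h))"

lemma per_finite:
  assumes "h > 0" "finite A" "\<And>k::int. \<bar>t - u - of_int k\<bar> \<le> h \<Longrightarrow> k \<in> A"
  shows "per h t u = (\<Sum>k\<in>A. K ((t - (u + of_int k)) / h))"
proof -
  have "per h t u = (\<Sum>\<^sub>\<infinity>k\<in>A. K ((t - (u + of_int k)) / h))"
    unfolding per_def
  proof (rule infsum_cong_neutral)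
    fix k assume "k \<in> UNIV - A"
    then have "\<bar>t - u - of_int k\<bar> > h"
      using assms(3)[of k] by (meson DiffE not_less)
    then have "\<bar>(t - (u + of_int k)) / h\<bar> > 1"
      using \<open>h > 0\<close> by (simp add: abs_divide diff_diff_eq)
    then show "K ((t - (u + of_int k)) / h) = 0" by (rule K_support)
  qed auto
  then show ?thesis using assms(2) by simp
qed

lemma per_finite_interval:
  assumes "h > 0" "\<bar>t\<bar> \<le> R" "\<bar>u\<bar> \<le> R" "2 * R + h \<le> real m"
  shows "per h t u = (\<Sum>k\<in>{-int m..int m}. K ((t - (u + of_int k)) / h))"
proof (rule per_finite[OF assms(1)])
  fix k :: int assume "\<bar>t - u - of_int k\<bar> \<le> h"
  then have "\<bar>real_of_int k\<bar> \<le> real m" using assms by linarith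
  then show "k \<in> {-int m..int m}" by (auto; linarith)
qed simp

text \<open>Joint measurability in (t, u) is what the process axiom of the noise asks for. At each
  point the symmetric partial sums are eventually constant.\<close>

lemma measurable_per:
  assumes "h > 0" shows "case_prod (per h) \<in> borel_measurable (borel \<Otimes>\<^sub>M borel)"
proof (rule borel_measurable_LIMSEQ_real)
  fix p :: "real \<times> real"
  obtain t u where p: "p = (t, u)" by (cases p)
  define m0 where "m0 = nat \<lceil>2 * max \<bar>t\<bar> \<bar>u\<bar> + h\<rceil>"
  have "per h t u = (\<Sum>k\<in>{-int m..int m}. K ((t - (u + of_int k)) / h))" if "m \<ge> m0" for m
  proof (rule per_finite_interval[OF assms])
    show "2 * max \<bar>t\<bar> \<bar>u\<bar> + h \<le> real m" using that unfolding m0_def by linarith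
  qed auto
  then have "eventually (\<lambda>m. (\<Sum>k\<in>{-int m..int m}. K ((t - (u + of_int k)) / h)) = per h t u) sequentially"
    unfolding eventually_sequentially by metis
  then show "(\<lambda>m. (\<lambda>(t, u). \<Sum>k\<in>{-int m..int m}. K ((t - (u + of_int k)) / h)) p) \<longlonglongrightarrow> case_prod (per h) p"
    unfolding p by (simp add: tendsto_eventually)
qed measurable

lemma measurable_per2 [measurable]: "h > 0 \<Longrightarrow> per h t \<in> borel_measurable borel"
  using measurable_per[of h] by measurable

lemma per_periodic: "per h t (u + 1) = per h t u"
proof -
  have "bij_betw (\<lambda>k::int. k + 1) UNIV UNIV"
    by (rule bij_betw_byWitness[where f'="\<lambda>k. k - 1"]) auto
  from infsum_reindex_bij_betw[OF this, of "\<lambda>k. K ((t - (u + of_int k)) / h)"]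
  show ?thesis by (simp add: per_def algebra_simps)
qed

lemma per_L2_per:
  assumes "h > 0" shows "per h t \<in> L2_per"
proof -
  define m where "m = nat \<lceil>2 * (\<bar>t\<bar> + 1) + h\<rceil>"
  have "\<bar>per h t u\<bar> \<le> (\<Sum>k\<in>{-int m..int m}. bnd)" if "u \<in> {0..<1}" for u
  proof -
    have "per h t u = (\<Sum>k\<in>{-int m..int m}. K ((t - (u + of_int k)) / h))"
    proof (rule per_finite_interval[OF assms])
      show "2 * (\<bar>t\<bar> + 1) + h \<le> real m" unfolding m_def by linarith
    qed (use that in auto)
    then show ?thesis using bnd by (auto intro!: order_trans[OF sum_abs] sum_mono simp del: sum_constant)
  qed
  then have "per h t \<in> sqint unit_measure"
    using assms by (intro unit.sqint_bounded) (auto simp: space_unit intro: unit_measurable)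
  then show ?thesis using assms by (simp add: L2_per_iff per_periodic)
qed

lemma periodic_int:
  fixes e :: "real \<Rightarrow> real"
  assumes "\<And>t. e (t + 1) = e t" shows "e (t + of_int k) = e t"
proof (induction k rule: int_induct[where k=0])
  case (step1 i)
  then show ?case using assms[of "t + of_int i"] by (simp add: add.assoc)
next
  case (step2 i)
  then show ?case using assms[of "t + of_int (i - 1)"] by (simp add: algebra_simps)
qed simp

text \<open>The integer translates of [0, 1) tile the line, so the sum over translates and the
  integral over one period merge into one integral over the line; then x = t - h v.\<close>

lemma per_unfold:
  assumes "h > 0" and e [measurable]: "e \<in> borel_measurable borel"
    and pe: "\<And>t. e (t + 1) = e t" and be: "\<And>t. \<bar>e t\<bar> \<le> E"
  shows "(\<integral>u. per h t u * e u \<partial>unit_measure) = h * (\<integral>v. K v * e (t - h * v) \<partial>lborel)"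
proof -
  define F where "F = (\<lambda>x. K ((t - x) / h) * e x)"
  have Fm [measurable]: "F \<in> borel_measurable borel" unfolding F_def by measurable
  have Fb: "\<bar>F x\<bar> \<le> bnd * E" for x
    unfolding F_def abs_mult using bnd be[of x] by (intro mult_mono) (auto intro: order_trans[OF _ be])
  have F0: "F x = 0" if "\<bar>t - x\<bar> > h" for x
    unfolding F_def using K_support[of "(t - x) / h"] that \<open>h > 0\<close> by (simp add: abs_divide field_simps)
  have intF: "integrable lborel F"
    by (rule integrable_bounded_support[OF Fm Fb, of "t - h" "t + h"]) (rule F0, auto)
  define m where "m = nat \<lceil>2 * (\<bar>t\<bar> + 1) + h\<rceil>"
  define A where "A = {-int m..int m}"
  have "(\<integral>u. per h t u * e u \<partial>unit_measure) = (\<integral>u. (\<Sum>k\<in>A. indicator {0..<1} u * F (u + of_int k)) \<partial>lborel)"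
    unfolding unit_integral set_lebesgue_integral_def
  proof (intro Bochner_Integration.integral_cong refl)
    fix u :: real
    show "indicator {0..<1} u *\<^sub>R (per h t u * e u) = (\<Sum>k\<in>A. indicator {0..<1} u * F (u + of_int k))"
    proof (cases "u \<in> {0..<1}")
      case True
      have "per h t u = (\<Sum>k\<in>A. K ((t - (u + of_int k)) / h))"
        unfolding A_def
      proof (rule per_finite_interval[OF assms(1)])
        show "2 * (\<bar>t\<bar> + 1) + h \<le> real m" unfolding m_def by linarith
      qed (use True in auto)
      then show ?thesis using True by (simp add: F_def periodic_int[of e, OF pe] sum_distrib_right)
    qed simp
  qed
  also have "\<dots> = (\<Sum>k\<in>A. \<integral>u. indicator {0..<1} u * F (u + of_int k) \<partial>lborel)"
  proof (rule Bochner_Integration.integral_sum)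
    fix k assume "k \<in> A"
    show "integrable lborel (\<lambda>u. indicator {0..<1} u * F (u + of_int k))"
      by (rule integrable_bounded_support[where B="bnd * E" and a=0 and b=1])
         (use Fb in \<open>auto simp: indicator_def intro: order_trans[OF _ Fb[of 0]]\<close>)
  qed
  also have "\<dots> = (\<Sum>k\<in>A. \<integral>x. indicator {of_int k..<of_int k + 1} x * F x \<partial>lborel)"
  proof (rule sum.cong[OF refl])
    fix k
    have "(\<integral>x. indicator {of_int k..<of_int k + 1} x * F x \<partial>lborel)
      = (\<integral>u. indicator {of_int k..<of_int k + 1} (of_int k + u) * F (of_int k + u) \<partial>lborel)"
      using lborel_integral_real_affine[of 1 "\<lambda>x. indicator {of_int k..<of_int k + 1} x * F x" "of_int k"] by simp
    also have "(\<lambda>u. indicator {of_int k..<of_int k + 1} (of_int k + u) * F (of_int k + u)) = (\<lambda>u. indicator {0..<1} u * F (u + of_int k))"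
      by (auto simp: indicator_def add.commute)
    finally show "(\<integral>u. indicator {0..<1} u * F (u + of_int k) \<partial>lborel) = (\<integral>x. indicator {of_int k..<of_int k + 1} x * F x \<partial>lborel)" ..
  qed
  also have "\<dots> = (\<integral>x. (\<Sum>k\<in>A. indicator {of_int k..<of_int k + 1} x * F x) \<partial>lborel)"
    by (intro Bochner_Integration.integral_sum[symmetric] integrable_real_mult_indicator[of _ _ F, unfolded mult.commute[of "F _"]] intF)
       auto
  also have "\<dots> = (\<integral>x. F x \<partial>lborel)"
  proof (intro Bochner_Integration.integral_cong refl)
    fix x :: real
    \<comment> \<open>Exactly one half-open cell contains x, the one indexed by the floor of x, and
      that index lies in A whenever x is within h of t.\<close>
    have "(\<Sum>k\<in>A. indicator {of_int k..<of_int k + 1} x * F x) = (\<Sum>k\<in>A. if k = \<lfloor>x\<rfloor> then F x else 0)"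
    proof (intro sum.cong refl)
      fix k
      have "x \<in> {of_int k..<of_int k + 1} \<longleftrightarrow> k = \<lfloor>x\<rfloor>"
        using floor_eq_iff[of x k] by auto
      then show "indicator {of_int k..<of_int k + 1} x * F x = (if k = \<lfloor>x\<rfloor> then F x else 0)"
        by (simp add: indicator_def)
    qed
    also have "\<dots> = (if \<lfloor>x\<rfloor> \<in> A then F x else 0)" by (simp add: A_def)
    also have "\<dots> = F x"
    proof (cases "\<bar>t - x\<bar> > h")
      case False
      then have "\<bar>x\<bar> \<le> \<bar>t\<bar> + h" by linarith
      then have "\<lfloor>x\<rfloor> \<in> A" unfolding A_def m_def using \<open>h > 0\<close> by (auto; linarith)
      then show ?thesis by simp
    qed (simp add: F0)
    finally show "(\<Sum>k\<in>A. indicator {of_int k..<of_int k + 1} x * F x) = F x" .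
  qed
  also have "\<dots> = h * (\<integral>v. K v * e (t - h * v) \<partial>lborel)"
    using lborel_integral_real_affine[of "- h" F t] \<open>h > 0\<close> by (simp add: F_def)
  finally show ?thesis .
qed

text \<open>Shifting the argument of \<open>cas j\<close> by h v produces a cosine and a sine in v;
  the sine integrates to 0 against the even kernel, which leaves a multiple of
  \<open>cas j t\<close>. This diagonalizes the smoother.\<close>

lemma hartley_per:
  assumes "h > 0" shows "hartley (per h t) j = h * Khat (of_int j * h) * cas j t"
proof -
  have "hartley (per h t) j = h * (\<integral>v. K v * cas j (t - h * v) \<partial>lborel)"
    unfolding hartley_def
    by (rule per_unfold[OF assms, where E=2]) (use cas_periodic[of j _ 1] abs_cas_le in auto)
  also have "(\<integral>v. K v * cas j (t - h * v) \<partial>lborel) =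
    (\<integral>v. cas j t * (K v * cos (2 * pi * (of_int j * h) * v)) +
       (sin (2 * pi * of_int j * t) - cos (2 * pi * of_int j * t)) * (K v * sin (2 * pi * (of_int j * h) * v)) \<partial>lborel)"
  proof (intro Bochner_Integration.integral_cong refl)
    fix v
    have "2 * pi * of_int j * (t - h * v) = 2 * pi * of_int j * t - 2 * pi * (of_int j * h) * v"
      by (simp add: algebra_simps)
    then show "K v * cas j (t - h * v) = cas j t * (K v * cos (2 * pi * (of_int j * h) * v)) +
       (sin (2 * pi * of_int j * t) - cos (2 * pi * of_int j * t)) * (K v * sin (2 * pi * (of_int j * h) * v))"
      unfolding cas_def by (simp add: sin_diff cos_diff algebra_simps)
  qed
  also have "\<dots> = cas j t * Khat (of_int j * h)"
    using K_cos_integrable[of "2 * pi * (of_int j * h)"] K_sin_integrable[of "2 * pi * (of_int j * h)"]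
      K_sin_integral[of "2 * pi * (of_int j * h)"]
    by (simp add: Khat_def)
  finally show ?thesis by simp
qed

text \<open>For h < 1/2 no point lies in two translates of the support, so at most one summand is
  non-zero.\<close>

lemma per_bound:
  assumes "h > 0" "h < 1 / 2" shows "\<bar>per h t u\<bar> \<le> bnd"
proof (cases "\<exists>k::int. \<bar>t - u - of_int k\<bar> \<le> h")
  case True
  then obtain k :: int where k: "\<bar>t - u - of_int k\<bar> \<le> h" by blast
  have "per h t u = (\<Sum>k\<in>{k}. K ((t - (u + of_int k)) / h))"
  proof (rule per_finite[OF assms(1)])
    fix l :: int assume "\<bar>t - u - of_int l\<bar> \<le> h"
    with k assms(2) have "\<bar>real_of_int l - of_int k\<bar> < 1" by linarith
    then show "l \<in> {k}" by (auto; linarith)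
  qed simp
  then show ?thesis using bnd by simp
next
  case False
  then have "per h t u = (\<Sum>k\<in>{}. K ((t - (u + of_int k)) / h))"
    by (intro per_finite assms) auto
  then show ?thesis using bnd(2) by simp
qed

text \<open>Unfolding one of the two factors leaves an integral of \<open>K\<close> against a
  bounded function. The factor h gained over the trivial bound \<open>bnd\<^sup>2\<close> is what
  makes the sum in \<open>Khat_sum_bound\<close> of order 1 / h.\<close>

lemma per_norm:
  assumes "h > 0" "h < 1 / 2"
  shows "(L2_norm (per h t))\<^sup>2 \<le> h * (mass * bnd)"
proof -
  have "(L2_norm (per h t))\<^sup>2 = h * (\<integral>v. K v * per h t (t - h * v) \<partial>lborel)"
    unfolding L2_norm_power2 unfolding power2_eq_square
    by (rule per_unfold[OF assms(1) measurable_per2[OF assms(1)], where E=bnd])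
       (rule per_periodic per_bound[OF assms])+
  also have "\<dots> \<le> h * (\<integral>v. \<bar>K v\<bar> * bnd \<partial>lborel)"
  proof (intro mult_left_mono integral_mono)
    show "integrable lborel (\<lambda>v. K v * per h t (t - h * v))"
    proof (rule K_mult_integrable[where E=bnd])
      show "(\<lambda>v. per h t (t - h * v)) \<in> borel_measurable borel"
        using measurable_per2[OF assms(1), of t] by measurable
    qed (rule per_bound[OF assms])
    show "integrable lborel (\<lambda>v. \<bar>K v\<bar> * bnd)"
      using K_integrable by auto
    show "K v * per h t (t - h * v) \<le> \<bar>K v\<bar> * bnd" for v
      using abs_ge_self[of "K v * per h t (t - h * v)"] mult_left_mono[OF per_bound[OF assms, of t "t - h * v"], of "\<bar>K v\<bar>"]
      unfolding abs_mult by linarith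
  qed (use assms in auto)
  also have "\<dots> = h * (mass * bnd)" by (simp add: mass_def)
  finally show ?thesis .
qed

text \<open>Bessel's inequality for \<open>per h 0\<close>, whose coefficients are h times the
  values of the transform since \<open>cas j 0 = 1\<close>. It later bounds the variance of the null
  statistic uniformly in h.\<close>

lemma Khat_sum_bound:
  assumes "h > 0" "h < 1 / 2"
  shows "(\<Sum>j\<in>low c. (Khat (of_int j * h))\<^sup>2) \<le> mass * bnd / h"
proof -
  have "h\<^sup>2 * (\<Sum>j\<in>low c. (Khat (of_int j * h))\<^sup>2) = low_energy (per h 0) c"
    using assms by (simp add: low_energy_def hartley_per power_mult_distrib sum_distrib_left)
  also have "\<dots> \<le> (L2_norm (per h 0))\<^sup>2"
    by (intro low_energy_le_norm per_L2_per assms)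
  also have "\<dots> \<le> h * (mass * bnd)" by (rule per_norm[OF assms])
  finally show ?thesis using assms by (simp add: field_simps power2_eq_square)
qed

text \<open>The self-convolution of \<open>K\<close> integrates to the square of the integral of
  \<open>K\<close>, which is 1, so it cannot vanish almost everywhere.\<close>

lemma kappa_pos: "kernel_kappa K > 0"
proof -
  define c where "c = (\<lambda>t. \<integral>s. K (t - s) * K s \<partial>lborel)"
  have c_m [measurable]: "c \<in> borel_measurable borel" unfolding c_def by measurable
  have ci: "integrable lborel (\<lambda>s. K (t - s) * K s)" for t
    using K_mult_integrable[of "\<lambda>s. K (t - s)" bnd] bnd by (simp add: mult.commute)
  have c_b: "\<bar>c t\<bar> \<le> bnd * mass" for t
  proof -
    have "\<bar>c t\<bar> \<le> (\<integral>s. \<bar>K (t - s) * K s\<bar> \<partial>lborel)"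
      unfolding c_def by (rule integral_abs_bound)
    also have "\<dots> \<le> (\<integral>s. bnd * \<bar>K s\<bar> \<partial>lborel)"
      using bnd by (intro integral_mono integrable_abs ci) (auto simp: abs_mult K_integrable intro: mult_right_mono)
    finally show ?thesis by (simp add: mass_def)
  qed
  have c_0: "c t = 0" if "t \<notin> {-2..2}" for t
  proof -
    have z: "K (t - s) * K s = 0" for s
      using K_support[of s] K_support[of "t - s"] that by (auto; linarith)
    show ?thesis unfolding c_def z by simp
  qed
  have c2i: "integrable lborel (\<lambda>t. (c t)\<^sup>2)"
  proof (rule integrable_bounded_support[where a="-2" and b=2])
    show "\<bar>(c t)\<^sup>2\<bar> \<le> (bnd * mass)\<^sup>2" for t
      using c_b[of t] by (simp add: power2_le_iff_abs_le abs_le_square_iff[symmetric])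
  qed (use c_0 in auto)
  have tr: "(\<integral>t. K (t - s) \<partial>lborel) = 1" "(\<integral>t. \<bar>K (t - s)\<bar> \<partial>lborel) = mass" "integrable lborel (\<lambda>t. K (t - s))" for s
    using lborel_integral_real_affine[of 1 K "- s"] lborel_integral_real_affine[of 1 "\<lambda>x. \<bar>K x\<bar>" "- s"]
      lborel_integrable_real_affine[OF K_integrable, of 1 "- s"] K_integral
    by (simp_all add: mass_def add.commute)
  have int2: "integrable (lborel \<Otimes>\<^sub>M lborel) (case_prod (\<lambda>s t. K (t - s) * K s))"
  proof (rule lborel_pair.Fubini_integrable)
    show "integrable lborel (\<lambda>s. \<integral>t. norm (case (s, t) of (s, t) \<Rightarrow> K (t - s) * K s) \<partial>lborel)"
      using K_integrable by (simp add: abs_mult tr)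
    show "AE s in lborel. integrable lborel (\<lambda>t. case (s, t) of (s, t) \<Rightarrow> K (t - s) * K s)"
      using tr(3) by simp
  qed measurable
  have c1: "(\<integral>t. c t \<partial>lborel) = 1"
    unfolding c_def lborel_pair.Fubini_integral[OF int2] using K_integral by (simp add: tr)
  have "(\<integral>t. (c t)\<^sup>2 \<partial>lborel) \<noteq> 0"
  proof
    assume "(\<integral>t. (c t)\<^sup>2 \<partial>lborel) = 0"
    then have ae: "AE t in lborel. c t = 0"
      using integral_nonneg_eq_0_iff_AE[OF c2i] by simp
    have "(\<integral>t. c t \<partial>lborel) = 0"
      by (rule integral_eq_zero_AE[OF ae])
    with c1 show False by simp
  qed
  moreover have "(\<integral>t. (c t)\<^sup>2 \<partial>lborel) \<ge> 0" by simp
  ultimately have "(\<integral>t. (c t)\<^sup>2 \<partial>lborel) > 0" by linarith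
  then show ?thesis by (simp add: kernel_kappa_def c_def)
qed

end

subsection \<open>Jointly normal variables\<close>

lemma iexp_measurable [measurable]: "iexp \<in> borel_measurable borel"
  by (intro borel_measurable_continuous_onI continuous_intros)

context prob_space
begin

lemma integrable_weight_iexp:
  assumes "w \<in> borel_measurable M" "\<And>\<omega>. \<bar>w \<omega>\<bar> \<le> B" "X \<in> borel_measurable M"
  shows "integrable M (\<lambda>\<omega>. w \<omega> *\<^sub>R iexp (X \<omega>))"
proof (rule integrable_const_bound[where B=B])
  show "AE \<omega> in M. norm (w \<omega> *\<^sub>R iexp (X \<omega>)) \<le> B"
    using assms(2) by (simp add: norm_exp_i_times)
qed (use assms in measurable)

text \<open>Divided by its mean, \<open>v\<close> is a probability density, and under the new
  measure X has the standard normal characteristic function.\<close>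

lemma weighted_std_normal:
  assumes [measurable]: "v \<in> borel_measurable M" "X \<in> borel_measurable M"
    and v0: "\<And>\<omega>. 0 \<le> v \<omega>" and vB: "\<And>\<omega>. v \<omega> \<le> B"
    and ch: "\<And>s. (\<integral>\<omega>. v \<omega> *\<^sub>R iexp (s * X \<omega>) \<partial>M) = of_real ((\<integral>\<omega>. v \<omega> \<partial>M) * exp (- s\<^sup>2 / 2))"
    and A [measurable]: "A \<in> sets borel"
  shows "(\<integral>\<omega>. v \<omega> * indicator A (X \<omega>) \<partial>M) = (\<integral>\<omega>. v \<omega> \<partial>M) * measure std_normal_distribution A"
proof -
  define m where "m = (\<integral>\<omega>. v \<omega> \<partial>M)"
  have iv: "integrable M v"
    by (rule integrable_const_bound[where B=B]) (use v0 vB in auto)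
  have "m \<ge> 0" using v0 by (simp add: m_def)
  show ?thesis
  proof (cases "m = 0")
    case True
    then have ae: "AE \<omega> in M. v \<omega> = 0"
      using integral_nonneg_eq_0_iff_AE[OF iv] v0 by (simp add: m_def)
    have "(\<integral>\<omega>. v \<omega> * indicator A (X \<omega>) \<partial>M) = 0"
      by (rule integral_eq_zero_AE) (use ae in eventually_elim, simp)
    with True show ?thesis by (simp add: m_def)
  next
    case False
    with \<open>m \<ge> 0\<close> have "m > 0" by simp
    define D where "D = density M (\<lambda>\<omega>. ennreal (v \<omega> / m))"
    have "emeasure D (space D) = 1"
    proof -
      have "emeasure D (space D) = (\<integral>\<^sup>+\<omega>. ennreal (v \<omega> / m) \<partial>M)"
        by (simp add: D_def emeasure_density cong: nn_integral_cong)
      also have "\<dots> = ennreal (\<integral>\<omega>. v \<omega> / m \<partial>M)"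
        using iv v0 \<open>m > 0\<close> by (intro nn_integral_eq_integral) auto
      finally show ?thesis using \<open>m > 0\<close> by (simp add: m_def)
    qed
    then interpret D: prob_space D by (rule prob_spaceI)
    have [measurable_cong]: "sets D = sets M" by (simp add: D_def)
    have int: "(\<integral>\<omega>. g \<omega> \<partial>D) = (\<integral>\<omega>. (v \<omega> / m) *\<^sub>R g \<omega> \<partial>M)" if [measurable]: "g \<in> borel_measurable M"
      for g :: "'a \<Rightarrow> 'c::{banach, second_countable_topology}"
      unfolding D_def using v0 \<open>m > 0\<close> by (intro integral_density) auto
    have "distr D borel X = std_normal_distribution"
    proof (rule Levy_uniqueness)
      show "real_distribution (distr D borel X)"
        unfolding real_distribution_def real_distribution_axioms_def by (auto intro!: D.prob_space_distr)
      show "char (distr D borel X) = char std_normal_distribution"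
      proof
        fix s
        have "char (distr D borel X) s = (\<integral>\<omega>. iexp (s * X \<omega>) \<partial>D)"
          unfolding char_def by (subst integral_distr) auto
        also have "\<dots> = (\<integral>\<omega>. (v \<omega> / m) *\<^sub>R iexp (s * X \<omega>) \<partial>M)"
          by (rule int) measurable
        also have "\<dots> = (\<integral>\<omega>. (1 / m) *\<^sub>R (v \<omega> *\<^sub>R iexp (s * X \<omega>)) \<partial>M)"
          by simp
        also have "\<dots> = (1 / m) *\<^sub>R (\<integral>\<omega>. v \<omega> *\<^sub>R iexp (s * X \<omega>) \<partial>M)"
          by (rule integral_scaleR_right)
        also have "\<dots> = char std_normal_distribution s"
          unfolding ch char_std_normal_distribution m_def[symmetric] using \<open>m > 0\<close>
          by (simp add: scaleR_conv_of_real)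
        finally show "char (distr D borel X) s = char std_normal_distribution s" .
      qed
    qed (rule real_dist_normal_dist)
    then have "measure std_normal_distribution A = measure (distr D borel X) A" by simp
    also have "\<dots> = (\<integral>\<omega>. indicator A (X \<omega>) \<partial>D)"
    proof -
      have "measure (distr D borel X) A = measure D (X -` A \<inter> space D)"
        by (rule measure_distr) auto
      also have "\<dots> = (\<integral>\<omega>. indicator (X -` A \<inter> space D) \<omega> \<partial>D)" by simp
      also have "\<dots> = (\<integral>\<omega>. indicator A (X \<omega>) \<partial>D)"
        by (intro Bochner_Integration.integral_cong) (auto simp: indicator_def)
      finally show ?thesis .
    qed
    also have "\<dots> = (\<integral>\<omega>. (v \<omega> / m) * indicator A (X \<omega>) \<partial>M)"
      by (subst int) auto
    also have "\<dots> = (\<integral>\<omega>. v \<omega> * indicator A (X \<omega>) \<partial>M) / m" by simp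
    finally show ?thesis using \<open>m > 0\<close> by (simp add: m_def)
  qed
qed

text \<open>Only one-dimensional uniqueness of characteristic functions is used: with \<open>L\<close> a linear form in
  the other variables, \<open>1 + cos L\<close> and \<open>1 + sin L\<close> are non-negative weights under which the remaining
  variable is still standard normal.\<close>

lemma joint_normal_product:
  fixes \<xi> :: "'i \<Rightarrow> 'a \<Rightarrow> real"
  assumes "finite I" and \<xi>: "\<And>i. i \<in> I \<Longrightarrow> \<xi> i \<in> borel_measurable M"
    and w: "w \<in> borel_measurable M" "\<And>\<omega>. 0 \<le> w \<omega>" "\<And>\<omega>. w \<omega> \<le> 1"
    and ch: "\<And>a. (\<integral>\<omega>. w \<omega> *\<^sub>R iexp (\<Sum>i\<in>I. a i * \<xi> i \<omega>) \<partial>M) =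
      of_real ((\<integral>\<omega>. w \<omega> \<partial>M) * exp (- (\<Sum>i\<in>I. (a i)\<^sup>2) / 2))"
    and A: "\<And>i. i \<in> I \<Longrightarrow> A i \<in> sets borel"
  shows "(\<integral>\<omega>. w \<omega> * (\<Prod>i\<in>I. indicator (A i) (\<xi> i \<omega>)) \<partial>M) =
    (\<integral>\<omega>. w \<omega> \<partial>M) * (\<Prod>i\<in>I. measure std_normal_distribution (A i))"
  using assms
proof (induction I arbitrary: w rule: finite_induct)
  case empty
  then show ?case by simp
next
  case (insert x F)
  note [measurable] = insert.prems(1)[of x] insert.prems(2) insert.prems(6)[of x]
  have [measurable]: "\<xi> i \<in> borel_measurable M" if "i \<in> F" for i using insert.prems(1) that by auto
  have xm [measurable]: "\<xi> x \<in> borel_measurable M" "A x \<in> sets borel" using insert.prems by auto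
  define m where "m = (\<integral>\<omega>. w \<omega> \<partial>M)"
  define q where "q = measure std_normal_distribution (A x)"
  have wb: "\<bar>w \<omega>\<bar> \<le> 1" for \<omega> using insert.prems by simp
  have iw: "integrable M w"
    by (rule integrable_const_bound[where B=1]) (use wb in auto)
  \<comment> \<open>The indicator of coordinate x is absorbed into the weight; the
    characteristic-function hypothesis must be restored for the remaining coordinates before the
    induction hypothesis applies.\<close>
  have key: "(\<integral>\<omega>. (w \<omega> * indicator (A x) (\<xi> x \<omega>)) *\<^sub>R iexp (\<Sum>i\<in>F. a i * \<xi> i \<omega>) \<partial>M) =
    of_real (q * m * exp (- (\<Sum>i\<in>F. (a i)\<^sup>2) / 2))" for a
  proof -
    define L where "L = (\<lambda>\<omega>. \<Sum>i\<in>F. a i * \<xi> i \<omega>)"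
    have L [measurable]: "L \<in> borel_measurable M" unfolding L_def by measurable
    define E where "E = exp (- (\<Sum>i\<in>F. (a i)\<^sup>2) / 2)"
    \<comment> \<open>The two signs of \<tau> give L and -L; sum and difference of the two
      identities yield the weights cos L and sin L.\<close>
    have base: "(\<integral>\<omega>. w \<omega> *\<^sub>R iexp (s * \<xi> x \<omega> + \<tau> * L \<omega>) \<partial>M) = of_real (m * exp (- s\<^sup>2 / 2) * E)"
      if "\<tau> = 1 \<or> \<tau> = -1" for s \<tau>
    proof -
      have "s * \<xi> x \<omega> + \<tau> * L \<omega> = (\<Sum>i\<in>insert x F. (if i = x then s else \<tau> * a i) * \<xi> i \<omega>)" for \<omega>
        using insert.hyps by (auto simp: L_def sum_distrib_left mult.assoc intro!: sum.cong)
      moreover have "(\<Sum>i\<in>insert x F. (if i = x then s else \<tau> * a i)\<^sup>2) = s\<^sup>2 + (\<Sum>i\<in>F. (a i)\<^sup>2)"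
        using insert.hyps that by (auto intro!: sum.cong)
      ultimately show ?thesis
        using insert.prems(5)[of "\<lambda>i. if i = x then s else \<tau> * a i"]
        by (simp add: m_def E_def exp_add[symmetric] mult.assoc add_divide_distrib)
    qed
    have base0: "(\<integral>\<omega>. w \<omega> *\<^sub>R iexp (s * \<xi> x \<omega>) \<partial>M) = of_real (m * exp (- s\<^sup>2 / 2))" for s
    proof -
      have "s * \<xi> x \<omega> = (\<Sum>i\<in>insert x F. (if i = x then s else 0) * \<xi> i \<omega>)" for \<omega>
        using insert.hyps by (auto intro!: sum.neutral)
      moreover have "(\<Sum>i\<in>insert x F. (if i = x then s else 0)\<^sup>2) = s\<^sup>2"
        using insert.hyps by (auto intro!: sum.neutral)
      ultimately show ?thesis
        using insert.prems(5)[of "\<lambda>i. if i = x then s else 0"] by (simp add: m_def)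
    qed
    have ii: "integrable M (\<lambda>\<omega>. w \<omega> *\<^sub>R iexp (X \<omega>))" if "X \<in> borel_measurable M" for X
      by (rule integrable_weight_iexp[OF _ wb that]) measurable
    have cosL: "(\<integral>\<omega>. (w \<omega> * cos (L \<omega>)) *\<^sub>R iexp (s * \<xi> x \<omega>) \<partial>M) = of_real (m * exp (- s\<^sup>2 / 2) * E)" for s
    proof -
      have "(w \<omega> * cos (L \<omega>)) *\<^sub>R iexp (s * \<xi> x \<omega>) =
        (1/2) *\<^sub>R (w \<omega> *\<^sub>R iexp (s * \<xi> x \<omega> + 1 * L \<omega>) + w \<omega> *\<^sub>R iexp (s * \<xi> x \<omega> + (-1) * L \<omega>))" for \<omega>
        unfolding cis_conv_exp[symmetric] by (simp add: complex_eq_iff cos_add cos_diff sin_add sin_diff algebra_simps)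
      then have "(\<integral>\<omega>. (w \<omega> * cos (L \<omega>)) *\<^sub>R iexp (s * \<xi> x \<omega>) \<partial>M) =
        (1/2) *\<^sub>R ((\<integral>\<omega>. w \<omega> *\<^sub>R iexp (s * \<xi> x \<omega> + 1 * L \<omega>) \<partial>M) + (\<integral>\<omega>. w \<omega> *\<^sub>R iexp (s * \<xi> x \<omega> + (-1) * L \<omega>) \<partial>M))"
        by (simp only:) (subst integral_scaleR_right, subst Bochner_Integration.integral_add; (intro ii)?; measurable)
      also have "\<dots> = of_real (m * exp (- s\<^sup>2 / 2) * E)"
        unfolding base[OF disjI1[OF refl]] base[OF disjI2[OF refl]] by (simp add: scaleR_conv_of_real)
      finally show ?thesis .
    qed
    have sinL: "(\<integral>\<omega>. (w \<omega> * sin (L \<omega>)) *\<^sub>R iexp (s * \<xi> x \<omega>) \<partial>M) = 0" for s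
    proof -
      have "(w \<omega> * sin (L \<omega>)) *\<^sub>R iexp (s * \<xi> x \<omega>) =
        (- \<i> / 2) * (w \<omega> *\<^sub>R iexp (s * \<xi> x \<omega> + 1 * L \<omega>) - w \<omega> *\<^sub>R iexp (s * \<xi> x \<omega> + (-1) * L \<omega>))" for \<omega>
        unfolding cis_conv_exp[symmetric] by (simp add: complex_eq_iff cos_add cos_diff sin_add sin_diff field_simps)
      then have "(\<integral>\<omega>. (w \<omega> * sin (L \<omega>)) *\<^sub>R iexp (s * \<xi> x \<omega>) \<partial>M) =
        (- \<i> / 2) * ((\<integral>\<omega>. w \<omega> *\<^sub>R iexp (s * \<xi> x \<omega> + 1 * L \<omega>) \<partial>M) - (\<integral>\<omega>. w \<omega> *\<^sub>R iexp (s * \<xi> x \<omega> + (-1) * L \<omega>) \<partial>M))"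
        by (simp only:) (subst integral_mult_right_zero, subst Bochner_Integration.integral_diff; (intro ii)?; measurable)
      also have "\<dots> = 0"
        unfolding base[OF disjI1[OF refl]] base[OF disjI2[OF refl]] by simp
      finally show ?thesis .
    qed
    have wi: "integrable M (\<lambda>\<omega>. w \<omega> * g \<omega>)" if [measurable]: "g \<in> borel_measurable M" and "\<And>\<omega>. \<bar>g \<omega>\<bar> \<le> 1" for g
    proof (rule integrable_const_bound[where B=1])
      show "AE \<omega> in M. norm (w \<omega> * g \<omega>) \<le> 1"
        using mult_mono[OF wb that(2)] by (simp add: abs_mult)
    qed measurable
    have cos0: "(\<integral>\<omega>. w \<omega> * cos (L \<omega>) \<partial>M) = m * E"
    proof -
      have "of_real (\<integral>\<omega>. w \<omega> * cos (L \<omega>) \<partial>M) = (of_real (m * E) :: complex)"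
        using cosL[of 0] by (simp add: scaleR_conv_of_real integral_complex_of_real del: of_real_mult)
      then show ?thesis by (simp only: of_real_eq_iff)
    qed
    have sin0: "(\<integral>\<omega>. w \<omega> * sin (L \<omega>) \<partial>M) = 0"
    proof -
      have "of_real (\<integral>\<omega>. w \<omega> * sin (L \<omega>) \<partial>M) = (0 :: complex)"
        using sinL[of 0] by (simp add: scaleR_conv_of_real integral_complex_of_real del: of_real_mult)
      then show ?thesis by simp
    qed
    \<comment> \<open>The weight \<open>w * (1 + g)\<close> is non-negative with total mass m + e,
      so one-dimensional uniqueness applies; subtracting the case g = 0 afterwards isolates the
      signed weight \<open>w * g\<close>.\<close>
    have main: "(\<integral>\<omega>. (w \<omega> * (1 + g \<omega>)) * indicator (A x) (\<xi> x \<omega>) \<partial>M) = (m + e) * q"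
      if [measurable]: "g \<in> borel_measurable M" and g1: "\<And>\<omega>. \<bar>g \<omega>\<bar> \<le> 1"
        and ge: "(\<integral>\<omega>. w \<omega> * g \<omega> \<partial>M) = e"
        and gch: "\<And>s. (\<integral>\<omega>. (w \<omega> * g \<omega>) *\<^sub>R iexp (s * \<xi> x \<omega>) \<partial>M) = of_real (e * exp (- s\<^sup>2 / 2))" for g e
    proof -
      have s: "(\<integral>\<omega>. w \<omega> * (1 + g \<omega>) \<partial>M) = m + e"
        using wi[OF that(1) g1] iw ge by (simp add: distrib_left m_def)
      have ig: "integrable M (\<lambda>\<omega>. (w \<omega> * g \<omega>) *\<^sub>R iexp (s * \<xi> x \<omega>))" for s
        by (rule integrable_weight_iexp[where B=1])
           (use mult_mono[OF wb g1] in \<open>auto simp: abs_mult\<close>)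
      have "(\<integral>\<omega>. (w \<omega> * (1 + g \<omega>)) * indicator (A x) (\<xi> x \<omega>) \<partial>M) = (\<integral>\<omega>. w \<omega> * (1 + g \<omega>) \<partial>M) * measure std_normal_distribution (A x)"
      proof (rule weighted_std_normal[where B=2])
        show "0 \<le> w \<omega> * (1 + g \<omega>)" for \<omega> using insert.prems(3)[of \<omega>] g1[of \<omega>] by auto
        show "w \<omega> * (1 + g \<omega>) \<le> 2" for \<omega>
          using mult_mono[of "w \<omega>" 1 "1 + g \<omega>" 2] insert.prems(3,4)[of \<omega>] g1[of \<omega>] by auto
        fix s
        have "(\<integral>\<omega>. (w \<omega> * (1 + g \<omega>)) *\<^sub>R iexp (s * \<xi> x \<omega>) \<partial>M) =
          (\<integral>\<omega>. w \<omega> *\<^sub>R iexp (s * \<xi> x \<omega>) + (w \<omega> * g \<omega>) *\<^sub>R iexp (s * \<xi> x \<omega>) \<partial>M)"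
          by (simp add: distrib_left scaleR_add_left)
        also have "\<dots> = (\<integral>\<omega>. w \<omega> *\<^sub>R iexp (s * \<xi> x \<omega>) \<partial>M) + (\<integral>\<omega>. (w \<omega> * g \<omega>) *\<^sub>R iexp (s * \<xi> x \<omega>) \<partial>M)"
          by (intro Bochner_Integration.integral_add ii ig) measurable
        also have "\<dots> = of_real ((m + e) * exp (- s\<^sup>2 / 2))"
          unfolding base0 gch by (simp add: distrib_right)
        finally show "(\<integral>\<omega>. (w \<omega> * (1 + g \<omega>)) *\<^sub>R iexp (s * \<xi> x \<omega>) \<partial>M) =
          of_real ((\<integral>\<omega>. w \<omega> * (1 + g \<omega>) \<partial>M) * exp (- s\<^sup>2 / 2))" unfolding s .
      qed measurable
      then show ?thesis unfolding s q_def .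
    qed
    let ?i = "\<lambda>\<omega>. indicator (A x) (\<xi> x \<omega>) :: real"
    have one: "(\<integral>\<omega>. w \<omega> * ?i \<omega> \<partial>M) = m * q"
      using main[of "\<lambda>_. 0" 0] by simp
    have i1: "integrable M (\<lambda>\<omega>. w \<omega> * ?i \<omega>)" by (rule wi) (auto simp: indicator_def)
    have gi: "integrable M (\<lambda>\<omega>. w \<omega> * ?i \<omega> * g \<omega>)" if [measurable]: "g \<in> borel_measurable M" and "\<And>\<omega>. \<bar>g \<omega>\<bar> \<le> 1" for g
      using wi[of "\<lambda>\<omega>. ?i \<omega> * g \<omega>"] that(2) by (auto simp: indicator_def mult.assoc)
    have sub: "(\<integral>\<omega>. w \<omega> * ?i \<omega> * g \<omega> \<partial>M) = e * q"
      if [measurable]: "g \<in> borel_measurable M" and g1: "\<And>\<omega>. \<bar>g \<omega>\<bar> \<le> 1"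
        and mm: "(\<integral>\<omega>. (w \<omega> * (1 + g \<omega>)) * ?i \<omega> \<partial>M) = (m + e) * q" for g e
    proof -
      have "(\<integral>\<omega>. (w \<omega> * (1 + g \<omega>)) * ?i \<omega> \<partial>M) = (\<integral>\<omega>. w \<omega> * ?i \<omega> + w \<omega> * ?i \<omega> * g \<omega> \<partial>M)"
        by (intro Bochner_Integration.integral_cong refl) (simp add: algebra_simps)
      also have "\<dots> = m * q + (\<integral>\<omega>. w \<omega> * ?i \<omega> * g \<omega> \<partial>M)"
        using i1 gi[OF that(1) g1] one by simp
      finally show ?thesis using mm by (simp add: distrib_right)
    qed
    have c: "(\<integral>\<omega>. w \<omega> * ?i \<omega> * cos (L \<omega>) \<partial>M) = m * E * q"
    proof (rule sub[OF _ _ main])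
      show "(\<integral>\<omega>. (w \<omega> * cos (L \<omega>)) *\<^sub>R iexp (s * \<xi> x \<omega>) \<partial>M) = of_real (m * E * exp (- s\<^sup>2 / 2))" for s
        unfolding cosL by (simp add: mult_ac)
    qed (use cos0 in auto)
    have s: "(\<integral>\<omega>. w \<omega> * ?i \<omega> * sin (L \<omega>) \<partial>M) = 0 * q"
    proof (rule sub[OF _ _ main])
      show "(\<integral>\<omega>. (w \<omega> * sin (L \<omega>)) *\<^sub>R iexp (s * \<xi> x \<omega>) \<partial>M) = of_real (0 * exp (- s\<^sup>2 / 2))" for s
        unfolding sinL by simp
    qed (use sin0 in auto)
    have "(\<integral>\<omega>. (w \<omega> * ?i \<omega>) *\<^sub>R iexp (L \<omega>) \<partial>M) =
      (\<integral>\<omega>. complex_of_real (w \<omega> * ?i \<omega> * cos (L \<omega>)) + \<i> * complex_of_real (w \<omega> * ?i \<omega> * sin (L \<omega>)) \<partial>M)"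
      unfolding cis_conv_exp[symmetric]
      by (intro Bochner_Integration.integral_cong refl) (simp add: complex_eq_iff)
    also have "\<dots> = of_real (\<integral>\<omega>. w \<omega> * ?i \<omega> * cos (L \<omega>) \<partial>M) + \<i> * of_real (\<integral>\<omega>. w \<omega> * ?i \<omega> * sin (L \<omega>) \<partial>M)"
      using gi[of "\<lambda>\<omega>. cos (L \<omega>)"] gi[of "\<lambda>\<omega>. sin (L \<omega>)"] by (simp del: of_real_mult)
    also have "\<dots> = of_real (q * m * E)" unfolding c s by simp
    finally show ?thesis unfolding L_def E_def .
  qed
  have wx: "(\<integral>\<omega>. w \<omega> * indicator (A x) (\<xi> x \<omega>) \<partial>M) = q * m"
  proof -
    have "of_real (\<integral>\<omega>. w \<omega> * indicator (A x) (\<xi> x \<omega>) \<partial>M) = (of_real (q * m) :: complex)"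
      using key[of "\<lambda>_. 0"] by (simp add: scaleR_conv_of_real integral_complex_of_real del: of_real_mult)
    then show ?thesis by (simp only: of_real_eq_iff)
  qed
  have "(\<integral>\<omega>. (w \<omega> * indicator (A x) (\<xi> x \<omega>)) * (\<Prod>i\<in>F. indicator (A i) (\<xi> i \<omega>)) \<partial>M) =
    (\<integral>\<omega>. w \<omega> * indicator (A x) (\<xi> x \<omega>) \<partial>M) * (\<Prod>i\<in>F. measure std_normal_distribution (A i))"
  proof (rule insert.IH)
    show "(\<integral>\<omega>. (w \<omega> * indicator (A x) (\<xi> x \<omega>)) *\<^sub>R iexp (\<Sum>i\<in>F. a i * \<xi> i \<omega>) \<partial>M) =
      of_real ((\<integral>\<omega>. w \<omega> * indicator (A x) (\<xi> x \<omega>) \<partial>M) * exp (- (\<Sum>i\<in>F. (a i)\<^sup>2) / 2))" for a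
      unfolding wx by (rule key)
  qed (use insert.prems in \<open>auto simp: indicator_def\<close>)
  then show ?case
    unfolding wx using insert.hyps by (simp add: m_def q_def mult_ac)
qed

text \<open>By the product formula with weight 1, the law of the vector agrees with the product of
  standard normal laws on rectangles.\<close>

theorem joint_normal_indep:
  fixes \<xi> :: "'i \<Rightarrow> 'a \<Rightarrow> real"
  assumes I: "finite I" "I \<noteq> {}" and \<xi> [measurable]: "\<And>i. \<xi> i \<in> borel_measurable M"
    and ch: "\<And>a. (\<integral>\<omega>. iexp (\<Sum>i\<in>I. a i * \<xi> i \<omega>) \<partial>M) = of_real (exp (- (\<Sum>i\<in>I. (a i)\<^sup>2) / 2))"
  shows "indep_vars (\<lambda>_. borel) \<xi> I" and "\<And>i. i \<in> I \<Longrightarrow> distr M borel (\<xi> i) = std_normal_distribution"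
proof -
  have prod: "(\<integral>\<omega>. (\<Prod>i\<in>I. indicator (A i) (\<xi> i \<omega>)) \<partial>M) = (\<Prod>i\<in>I. measure std_normal_distribution (A i))"
    if "\<And>i. i \<in> I \<Longrightarrow> A i \<in> sets borel" for A
    using joint_normal_product[of I \<xi> "\<lambda>_. 1" A] I ch that \<xi> by (simp add: prob_space)
  interpret N: real_distribution std_normal_distribution by (rule real_dist_normal_dist)
  show d: "distr M borel (\<xi> i) = std_normal_distribution" if "i \<in> I" for i
  proof (rule measure_eqI)
    fix A assume A: "A \<in> sets (distr M borel (\<xi> i))"
    then have [measurable]: "A \<in> sets borel" by simp
    interpret X: prob_space "distr M borel (\<xi> i)" by (rule prob_space_distr) simp
    have "measure (distr M borel (\<xi> i)) A = measure M (\<xi> i -` A \<inter> space M)"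
      by (rule measure_distr) auto
    also have "\<dots> = (\<integral>\<omega>. indicator (\<xi> i -` A \<inter> space M) \<omega> \<partial>M)" by simp
    also have "\<dots> = (\<integral>\<omega>. (\<Prod>j\<in>I. indicator (if j = i then A else UNIV) (\<xi> j \<omega>)) \<partial>M)"
    proof (intro Bochner_Integration.integral_cong refl)
      fix \<omega> assume "\<omega> \<in> space M"
      have "(\<Prod>j\<in>I. indicator (if j = i then A else UNIV) (\<xi> j \<omega>)) = (\<Prod>j\<in>I. if j = i then indicator A (\<xi> i \<omega>) else (1::real))"
        by (intro prod.cong) auto
      then show "indicator (\<xi> i -` A \<inter> space M) \<omega> = (\<Prod>j\<in>I. indicator (if j = i then A else UNIV) (\<xi> j \<omega>) :: real)"
        using I that \<open>\<omega> \<in> space M\<close> by (simp add: indicator_def)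
    qed
    also have "\<dots> = (\<Prod>j\<in>I. measure std_normal_distribution (if j = i then A else UNIV))"
      by (rule prod) auto
    also have "\<dots> = (\<Prod>j\<in>I. if j = i then measure std_normal_distribution A else 1)"
      using N.prob_space by (intro prod.cong) auto
    also have "\<dots> = measure std_normal_distribution A" using I that by simp
    finally show "emeasure (distr M borel (\<xi> i)) A = emeasure std_normal_distribution A"
      by (simp add: X.emeasure_eq_measure N.emeasure_eq_measure)
  qed simp
  interpret P: product_prob_space "\<lambda>_. std_normal_distribution" I
    by (intro product_prob_spaceI) (rule N.prob_space_axioms)
  have "distr M (\<Pi>\<^sub>M i\<in>I. borel) (\<lambda>x. \<lambda>i\<in>I. \<xi> i x) = (\<Pi>\<^sub>M i\<in>I. std_normal_distribution)"
  proof (rule P.PiM_eqI)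
    show "sets (distr M (\<Pi>\<^sub>M i\<in>I. borel) (\<lambda>x. \<lambda>i\<in>I. \<xi> i x)) = sets (\<Pi>\<^sub>M i\<in>I. std_normal_distribution)"
      by (simp add: cong: sets_PiM_cong)
    fix A :: "'i \<Rightarrow> real set" assume "\<And>i. i \<in> I \<Longrightarrow> A i \<in> sets std_normal_distribution"
    then have A [measurable]: "\<And>i. i \<in> I \<Longrightarrow> A i \<in> sets borel" by simp
    have [measurable]: "Pi\<^sub>E I A \<in> sets (\<Pi>\<^sub>M i\<in>I. borel)" using I by (intro sets_PiM_I_finite) auto
    have "emeasure (distr M (\<Pi>\<^sub>M i\<in>I. borel) (\<lambda>x. \<lambda>i\<in>I. \<xi> i x)) (Pi\<^sub>E I A)
      = emeasure M ((\<lambda>x. \<lambda>i\<in>I. \<xi> i x) -` Pi\<^sub>E I A \<inter> space M)"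
      by (rule emeasure_distr) measurable
    also have "\<dots> = ennreal (measure M ((\<lambda>x. \<lambda>i\<in>I. \<xi> i x) -` Pi\<^sub>E I A \<inter> space M))"
      by (rule emeasure_eq_measure)
    also have "measure M ((\<lambda>x. \<lambda>i\<in>I. \<xi> i x) -` Pi\<^sub>E I A \<inter> space M) = (\<integral>\<omega>. indicator ((\<lambda>x. \<lambda>i\<in>I. \<xi> i x) -` Pi\<^sub>E I A \<inter> space M) \<omega> \<partial>M)"
      by simp
    also have "\<dots> = (\<integral>\<omega>. (\<Prod>i\<in>I. indicator (A i) (\<xi> i \<omega>)) \<partial>M)"
    proof (intro Bochner_Integration.integral_cong refl)
      fix \<omega> assume "\<omega> \<in> space M"
      then show "indicator ((\<lambda>x. \<lambda>i\<in>I. \<xi> i x) -` Pi\<^sub>E I A \<inter> space M) \<omega> = (\<Prod>i\<in>I. indicator (A i) (\<xi> i \<omega>) :: real)"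
        using I by (auto simp: indicator_def prod_zero_iff PiE_iff extensional_def)
    qed
    also have "\<dots> = (\<Prod>i\<in>I. measure std_normal_distribution (A i))" by (rule prod[OF A])
    finally show "emeasure (distr M (\<Pi>\<^sub>M i\<in>I. borel) (\<lambda>x. \<lambda>i\<in>I. \<xi> i x)) (Pi\<^sub>E I A) = (\<Prod>i\<in>I. emeasure std_normal_distribution (A i))"
      by (simp only: N.emeasure_eq_measure prod_ennreal measure_nonneg)
  qed (rule I)
  also have "(\<Pi>\<^sub>M i\<in>I. std_normal_distribution) = (\<Pi>\<^sub>M i\<in>I. distr M borel (\<xi> i))"
    by (rule PiM_cong) (simp_all add: d)
  finally show "indep_vars (\<lambda>_. borel) \<xi> I"
    by (subst indep_vars_iff_distr_eq_PiM[OF I(2)]) auto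
qed

end

subsection \<open>Concentration of quadratic forms\<close>

lemma iexp_diff: "iexp (a - b) = iexp a * cnj (iexp b)"
  unfolding cis_conv_exp[symmetric] by (simp add: complex_eq_iff cos_diff sin_diff)

text \<open>\<open>\<bar>E exp(i u x\<^sup>2)\<bar>\<^sup>2\<close> is the integral of \<open>exp(i u (x\<^sup>2 - y\<^sup>2))\<close> against the planar Gaussian;
  in the coordinates \<open>v = x - y\<close>, \<open>w = (x + y) / \<surd>2\<close> the phase is bilinear.\<close>

lemma chi_square_char:
  "(cmod (\<integral>x. std_normal_density x *\<^sub>R iexp (u * x\<^sup>2) \<partial>lborel))\<^sup>2 = 1 / sqrt (1 + 4 * u\<^sup>2)"
proof -
  let ?p = std_normal_density
  define Z where "Z = (\<integral>x. ?p x *\<^sub>R iexp (u * x\<^sup>2) \<partial>lborel)"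
  \<comment> \<open>Integrand of Z times its conjugate after x = y + v: the phase u (x^2 - y^2)
    becomes u (v^2 + 2 y v), linear in y.\<close>
  define G where "G y v = (?p (y + v) * ?p y) *\<^sub>R iexp (u * (v\<^sup>2 + 2 * y * v))" for y v
  have pm [measurable]: "?p \<in> borel_measurable borel" by simp
  have Gm: "case_prod G \<in> borel_measurable (lborel \<Otimes>\<^sub>M lborel)"
    unfolding G_def by measurable
  have nG: "norm (G y v) = ?p (y + v) * ?p y" for y v
    by (simp add: G_def norm_exp_i_times)
  have shift: "integrable lborel (\<lambda>v. ?p (y + v))" "(\<integral>v. ?p (y + v) \<partial>lborel) = 1" for y
    using lborel_integrable_real_affine[of ?p 1 y] lborel_integral_real_affine[of 1 ?p y] by simp_all
  have int: "integrable (lborel \<Otimes>\<^sub>M lborel) (case_prod G)"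
  proof (rule lborel_pair.Fubini_integrable[OF Gm])
    show "integrable lborel (\<lambda>y. \<integral>v. norm (case (y, v) of (y, v) \<Rightarrow> G y v) \<partial>lborel)"
      by (simp add: nG shift)
    show "AE y in lborel. integrable lborel (\<lambda>v. case (y, v) of (y, v) \<Rightarrow> G y v)"
    proof (rule AE_I2)
      fix y
      have "integrable lborel (\<lambda>v. norm (G y v))" unfolding nG using shift by simp
      moreover have "G y \<in> borel_measurable lborel" unfolding G_def by measurable
      ultimately show "integrable lborel (\<lambda>v. case (y, v) of (y, v) \<Rightarrow> G y v)"
        by (simp add: integrable_norm_iff)
    qed
  qed
  have inner: "(\<integral>v. G y v \<partial>lborel) = Z * cnj (?p y *\<^sub>R iexp (u * y\<^sup>2))" for y
  proof -
    have "Z = (\<integral>v. ?p (y + v) *\<^sub>R iexp (u * (y + v)\<^sup>2) \<partial>lborel)"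
      unfolding Z_def using lborel_integral_real_affine[of 1 "\<lambda>x. ?p x *\<^sub>R iexp (u * x\<^sup>2)" y] by simp
    then have "Z * cnj (?p y *\<^sub>R iexp (u * y\<^sup>2)) = (\<integral>v. (?p (y + v) *\<^sub>R iexp (u * (y + v)\<^sup>2)) * cnj (?p y *\<^sub>R iexp (u * y\<^sup>2)) \<partial>lborel)"
      by (simp only: integral_mult_left_zero)
    also have "\<dots> = (\<integral>v. G y v \<partial>lborel)"
    proof (intro Bochner_Integration.integral_cong refl)
      fix v
      have "u * (v\<^sup>2 + 2 * y * v) = u * (y + v)\<^sup>2 - u * y\<^sup>2"
        by (simp add: power2_eq_square algebra_simps)
      then have "G y v = (?p (y + v) * ?p y) *\<^sub>R (iexp (u * (y + v)\<^sup>2) * cnj (iexp (u * y\<^sup>2)))"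
        unfolding G_def by (simp only: iexp_diff)
      then show "(?p (y + v) *\<^sub>R iexp (u * (y + v)\<^sup>2)) * cnj (?p y *\<^sub>R iexp (u * y\<^sup>2)) = G y v"
        by (simp add: mult_ac)
    qed
    finally show ?thesis ..
  qed
  have outer: "(\<integral>y. G y v \<partial>lborel) = of_real ((1 / sqrt 2) * (1 / sqrt (2 * pi)) * exp (- v\<^sup>2 * (1 / 4 + u\<^sup>2)))" for v
  proof -
    \<comment> \<open>Centring y at -v / 2 and rescaling by 1 / sqrt 2 decouples the two Gaussians
      and turns the phase into sqrt 2 * u * v * w, so the integral over w is a normal characteristic
      function.\<close>
    have "(\<integral>y. G y v \<partial>lborel) = (1 / sqrt 2) *\<^sub>R (\<integral>w. G (- v / 2 + (1 / sqrt 2) * w) v \<partial>lborel)"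
      using lborel_integral_real_affine[of "1 / sqrt 2" "\<lambda>y. G y v" "- v / 2"] by simp
    also have "(\<integral>w. G (- v / 2 + (1 / sqrt 2) * w) v \<partial>lborel) =
      (\<integral>w. ((1 / sqrt (2 * pi)) * exp (- v\<^sup>2 / 4)) *\<^sub>R (?p w *\<^sub>R iexp ((sqrt 2 * u * v) * w)) \<partial>lborel)"
    proof (intro Bochner_Integration.integral_cong refl)
      fix w
      define y where "y = - v / 2 + (1 / sqrt 2) * w"
      have sq: "(1 / sqrt 2)\<^sup>2 = (1 / 2 :: real)" by (simp add: power_divide)
      have "(y + v)\<^sup>2 + y\<^sup>2 = 2 * ((1 / sqrt 2)\<^sup>2 * w\<^sup>2) + v\<^sup>2 / 2"
        unfolding y_def by (simp add: power2_eq_square field_simps)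
      then have e: "- (y + v)\<^sup>2 / 2 + - y\<^sup>2 / 2 = - w\<^sup>2 / 2 + - v\<^sup>2 / 4"
        unfolding sq by (simp add: field_simps)
      have d: "?p (y + v) * ?p y = (1 / sqrt (2 * pi)) * exp (- v\<^sup>2 / 4) * ?p w"
      proof -
        have "?p (y + v) * ?p y = (1 / sqrt (2 * pi)) * (1 / sqrt (2 * pi)) * exp (- (y + v)\<^sup>2 / 2 + - y\<^sup>2 / 2)"
          unfolding std_normal_density_def exp_add by simp
        also have "\<dots> = (1 / sqrt (2 * pi)) * exp (- v\<^sup>2 / 4) * ?p w"
          unfolding e exp_add std_normal_density_def by simp
        finally show ?thesis .
      qed
      have "v\<^sup>2 + 2 * y * v = (2 / sqrt 2) * w * v"
        unfolding y_def by (simp add: power2_eq_square field_simps)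
      also have "2 / sqrt 2 = sqrt 2" by (rule real_div_sqrt) simp
      finally have ph: "u * (v\<^sup>2 + 2 * y * v) = (sqrt 2 * u * v) * w" by simp
      show "G (- v / 2 + (1 / sqrt 2) * w) v = ((1 / sqrt (2 * pi)) * exp (- v\<^sup>2 / 4)) *\<^sub>R (?p w *\<^sub>R iexp ((sqrt 2 * u * v) * w))"
        unfolding y_def[symmetric] G_def d ph by simp
    qed
    also have "\<dots> = ((1 / sqrt (2 * pi)) * exp (- v\<^sup>2 / 4)) *\<^sub>R (\<integral>w. ?p w *\<^sub>R iexp ((sqrt 2 * u * v) * w) \<partial>lborel)"
      by (rule integral_scaleR_right)
    also have "(\<integral>w. ?p w *\<^sub>R iexp ((sqrt 2 * u * v) * w) \<partial>lborel) = char std_normal_distribution (sqrt 2 * u * v)"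
      unfolding char_def by (subst integral_density) auto
    also have "\<dots> = of_real (exp (- (u\<^sup>2 * v\<^sup>2)))"
      by (simp add: char_std_normal_distribution power_mult_distrib)
    finally have "(\<integral>y. G y v \<partial>lborel) = of_real ((1 / sqrt 2) * (1 / sqrt (2 * pi)) * (exp (- v\<^sup>2 / 4) * exp (- (u\<^sup>2 * v\<^sup>2))))"
      by (simp add: scaleR_conv_of_real)
    also have "exp (- v\<^sup>2 / 4) * exp (- (u\<^sup>2 * v\<^sup>2)) = exp (- v\<^sup>2 * (1 / 4 + u\<^sup>2))"
      by (simp add: exp_add[symmetric] algebra_simps)
    finally show ?thesis .
  qed
  define b where "b = 1 / 4 + u\<^sup>2"
  have "b > 0" unfolding b_def by (rule add_pos_nonneg) auto
  have gauss: "(\<integral>v. exp (- v\<^sup>2 * b) \<partial>lborel) = sqrt (pi / b)"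
  proof -
    define \<tau> where "\<tau> = sqrt (1 / (2 * b))"
    have t: "\<tau> > 0" "\<tau>\<^sup>2 = 1 / (2 * b)" using \<open>b > 0\<close> by (simp_all add: \<tau>_def)
    have "exp (- v\<^sup>2 * b) = sqrt (pi / b) * normal_density 0 \<tau> v" for v
      using \<open>b > 0\<close> by (simp add: normal_density_def t field_simps)
    then show ?thesis using t(1) by simp
  qed
  have "Z * cnj Z = Z * cnj (\<integral>y. ?p y *\<^sub>R iexp (u * y\<^sup>2) \<partial>lborel)" by (simp add: Z_def)
  also have "\<dots> = Z * (\<integral>y. cnj (?p y *\<^sub>R iexp (u * y\<^sup>2)) \<partial>lborel)"
    by (simp only: Bochner_Integration.integral_cnj)
  also have "\<dots> = (\<integral>y. (\<integral>v. G y v \<partial>lborel) \<partial>lborel)"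
    unfolding inner by (simp only: integral_mult_right_zero)
  also have "\<dots> = (\<integral>v. (\<integral>y. G y v \<partial>lborel) \<partial>lborel)"
    by (rule lborel_pair.Fubini_integral[OF int, symmetric])
  also have "\<dots> = of_real ((1 / sqrt 2) * (1 / sqrt (2 * pi)) * (\<integral>v. exp (- v\<^sup>2 * b) \<partial>lborel))"
    unfolding outer b_def[symmetric] by (simp only: integral_complex_of_real integral_mult_right_zero)
  also have "(1 / sqrt 2) * (1 / sqrt (2 * pi)) * (\<integral>v. exp (- v\<^sup>2 * b) \<partial>lborel) = 1 / sqrt (1 + 4 * u\<^sup>2)"
  proof -
    have "(1 / sqrt 2) * (1 / sqrt (2 * pi)) * sqrt (pi / b) = 1 / sqrt (4 * b)"
      by (simp add: real_sqrt_mult real_sqrt_divide)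
    also have "4 * b = 1 + 4 * u\<^sup>2" by (simp add: b_def)
    finally show ?thesis unfolding gauss .
  qed
  finally have "complex_of_real ((cmod Z)\<^sup>2) = complex_of_real (1 / sqrt (1 + 4 * u\<^sup>2))"
    by (simp only: complex_norm_square)
  then show ?thesis unfolding Z_def by (simp only: of_real_eq_iff)
qed

text \<open>Total mass of the Cauchy kernel, that is pi; it is carried as a symbol through the
  concentration bounds.\<close>

definition lorentz_mass :: real where
  "lorentz_mass = (\<integral>x. 1 / (1 + x\<^sup>2) \<partial>lborel)"

lemma integrable_lorentz: "integrable lborel (\<lambda>x::real. 1 / (1 + x\<^sup>2))"
proof -
  have p: "set_integrable lborel {0<..} (\<lambda>x::real. 1 / (1 + x\<^sup>2))"
    using integrable_I0i_1_div_plus_square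
    by (simp add: interval_lebesgue_integrable_def zero_ereal_def)
  then have p': "integrable lborel (\<lambda>x::real. indicator {0<..} x * (1 / (1 + x\<^sup>2)))"
    by (simp add: set_integrable_def)
  from lborel_integrable_real_affine[OF this, of "-1" 0]
  have n': "integrable lborel (\<lambda>x::real. indicator {0<..} (- x) * (1 / (1 + x\<^sup>2)))"
    by simp
  show ?thesis
  proof (rule integrable_cong_AE_imp[OF Bochner_Integration.integrable_add[OF p' n']])
    show "AE x in lborel. indicator {0<..} x * (1 / (1 + x\<^sup>2)) + indicator {0<..} (- x) * (1 / (1 + x\<^sup>2)) = (1 / (1 + x\<^sup>2) :: real)"
      using AE_lborel_singleton[of 0] by eventually_elim (auto simp: indicator_def)
  qed measurable
qed

lemma lorentz_mass_nonneg: "lorentz_mass \<ge> 0"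
  unfolding lorentz_mass_def by (intro Bochner_Integration.integral_nonneg) (simp add: add_nonneg_nonneg)

context prob_space
begin

text \<open>Esseen-type bound, with a Gaussian as smoothing kernel.\<close>

lemma concentration_char:
  assumes X [measurable]: "X \<in> borel_measurable M" and "\<epsilon> > 0" "b > 0"
    and ch: "\<And>t. cmod (\<integral>\<omega>. iexp (t * X \<omega>) \<partial>M) \<le> 1 / (1 + (b * t)\<^sup>2)"
  shows "prob {\<omega> \<in> space M. \<bar>X \<omega> - c\<bar> \<le> \<epsilon>} \<le> \<epsilon> / b * lorentz_mass"
proof -
  let ?p = std_normal_density
  define s where "s = (\<lambda>\<omega>. (X \<omega> - c) / \<epsilon>)"
  have sm [measurable]: "s \<in> borel_measurable M" unfolding s_def by measurable
  have pm [measurable]: "?p \<in> borel_measurable borel" by simp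
  interpret pair_sigma_finite M lborel ..
  define E where "E = (\<integral>\<omega>. exp (- (s \<omega>)\<^sup>2 / 2) \<partial>M)"
  have iE: "integrable M (\<lambda>\<omega>. exp (- (s \<omega>)\<^sup>2 / 2))"
    by (rule integrable_const_bound[where B=1]) auto
  have "prob {\<omega> \<in> space M. \<bar>X \<omega> - c\<bar> \<le> \<epsilon>} = (\<integral>\<omega>. indicator {\<omega> \<in> space M. \<bar>X \<omega> - c\<bar> \<le> \<epsilon>} \<omega> \<partial>M)"
    by simp
  \<comment> \<open>On the event |s| \<le> 1, so there exp (-s^2 / 2) is at least exp
    (-1/2).\<close>
  also have "\<dots> \<le> (\<integral>\<omega>. exp (1 / 2) * exp (- (s \<omega>)\<^sup>2 / 2) \<partial>M)"
  proof (rule integral_mono)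
    show "indicator {\<omega> \<in> space M. \<bar>X \<omega> - c\<bar> \<le> \<epsilon>} \<omega> \<le> exp (1 / 2) * exp (- (s \<omega>)\<^sup>2 / 2)" for \<omega>
    proof (cases "\<bar>X \<omega> - c\<bar> \<le> \<epsilon>")
      case True
      then have "\<bar>s \<omega>\<bar> \<le> 1" using \<open>\<epsilon> > 0\<close> by (simp add: s_def abs_divide)
      then have "(s \<omega>)\<^sup>2 \<le> 1" by (simp add: abs_square_le_1)
      then have "1 \<le> exp (1 / 2 + - (s \<omega>)\<^sup>2 / 2)" by simp
      then show ?thesis unfolding exp_add by (simp add: indicator_def)
    qed (simp add: indicator_def)
    show "integrable M (indicator {\<omega> \<in> space M. \<bar>X \<omega> - c\<bar> \<le> \<epsilon>} :: 'a \<Rightarrow> real)"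
      by (intro integrable_real_indicator) (auto simp: emeasure_eq_measure)
    show "integrable M (\<lambda>\<omega>. exp (1 / 2) * exp (- (s \<omega>)\<^sup>2 / 2))"
      using iE by simp
  qed
  also have "\<dots> = exp (1 / 2) * E" by (simp add: E_def)
  finally have 1: "prob {\<omega> \<in> space M. \<bar>X \<omega> - c\<bar> \<le> \<epsilon>} \<le> exp (1 / 2) * E" .
  have iF: "integrable (M \<Otimes>\<^sub>M lborel) (\<lambda>(\<omega>, t). ?p t *\<^sub>R iexp (s \<omega> * t))"
  proof (rule Fubini_integrable)
    show "integrable M (\<lambda>\<omega>. \<integral>t. norm (case (\<omega>, t) of (\<omega>, t) \<Rightarrow> ?p t *\<^sub>R iexp (s \<omega> * t)) \<partial>lborel)"
      by (simp add: norm_exp_i_times)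
    show "AE \<omega> in M. integrable lborel (\<lambda>t. case (\<omega>, t) of (\<omega>, t) \<Rightarrow> ?p t *\<^sub>R iexp (s \<omega> * t))"
    proof (rule AE_I2)
      fix \<omega>
      have "integrable lborel (\<lambda>t. norm (?p t *\<^sub>R iexp (s \<omega> * t)))" by (simp add: norm_exp_i_times)
      then show "integrable lborel (\<lambda>t. case (\<omega>, t) of (\<omega>, t) \<Rightarrow> ?p t *\<^sub>R iexp (s \<omega> * t))"
        by (subst (asm) integrable_norm_iff) auto
    qed
  qed measurable
  \<comment> \<open>exp (-s^2 / 2) is the average of exp (i s t) over a standard normal t; Fubini
    then brings in the characteristic function of X at t / \<epsilon>.\<close>
  have "complex_of_real E = (\<integral>\<omega>. complex_of_real (exp (- (s \<omega>)\<^sup>2 / 2)) \<partial>M)"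
    unfolding E_def by (rule integral_complex_of_real[symmetric])
  also have "\<dots> = (\<integral>\<omega>. (\<integral>t. ?p t *\<^sub>R iexp (s \<omega> * t) \<partial>lborel) \<partial>M)"
  proof (intro Bochner_Integration.integral_cong refl)
    fix \<omega>
    have "char std_normal_distribution (s \<omega>) = (\<integral>t. ?p t *\<^sub>R iexp (s \<omega> * t) \<partial>lborel)"
      unfolding char_def by (subst integral_density) auto
    then show "complex_of_real (exp (- (s \<omega>)\<^sup>2 / 2)) = (\<integral>t. ?p t *\<^sub>R iexp (s \<omega> * t) \<partial>lborel)"
      by (simp add: char_std_normal_distribution)
  qed
  also have "\<dots> = (\<integral>t. (\<integral>\<omega>. ?p t *\<^sub>R iexp (s \<omega> * t) \<partial>M) \<partial>lborel)"
    by (rule Fubini_integral[OF iF, symmetric])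
  finally have "E \<le> cmod (\<integral>t. (\<integral>\<omega>. ?p t *\<^sub>R iexp (s \<omega> * t) \<partial>M) \<partial>lborel)"
    by (metis abs_ge_self norm_of_real)
  also have "\<dots> \<le> (\<integral>t. (1 / sqrt (2 * pi)) * (1 / (1 + (b / \<epsilon> * t)\<^sup>2)) \<partial>lborel)"
  proof (rule order_trans[OF integral_norm_bound integral_mono])
    show "integrable lborel (\<lambda>t. norm (\<integral>\<omega>. ?p t *\<^sub>R iexp (s \<omega> * t) \<partial>M))"
      using integrable_snd[OF iF] by (intro integrable_norm)
    show "integrable lborel (\<lambda>t. (1 / sqrt (2 * pi)) * (1 / (1 + (b / \<epsilon> * t)\<^sup>2)))"
      using lborel_integrable_real_affine[OF integrable_lorentz, of "b / \<epsilon>" 0] \<open>\<epsilon> > 0\<close> \<open>b > 0\<close>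
      by (intro integrable_mult_right) simp
    fix t
    have "(\<integral>\<omega>. ?p t *\<^sub>R iexp (s \<omega> * t) \<partial>M) = (\<integral>\<omega>. (?p t *\<^sub>R iexp (- c * t / \<epsilon>)) * iexp (t / \<epsilon> * X \<omega>) \<partial>M)"
    proof (intro Bochner_Integration.integral_cong refl)
      fix \<omega>
      have "s \<omega> * t = - c * t / \<epsilon> + t / \<epsilon> * X \<omega>" using \<open>\<epsilon> > 0\<close> by (simp add: s_def field_simps)
      then have "iexp (s \<omega> * t) = iexp (- c * t / \<epsilon>) * iexp (t / \<epsilon> * X \<omega>)"
        by (simp only: of_real_add distrib_left exp_add)
      then show "?p t *\<^sub>R iexp (s \<omega> * t) = (?p t *\<^sub>R iexp (- c * t / \<epsilon>)) * iexp (t / \<epsilon> * X \<omega>)" by simp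
    qed
    also have "\<dots> = (?p t *\<^sub>R iexp (- c * t / \<epsilon>)) * (\<integral>\<omega>. iexp (t / \<epsilon> * X \<omega>) \<partial>M)"
      by (rule integral_mult_right_zero)
    finally have "norm (\<integral>\<omega>. ?p t *\<^sub>R iexp (s \<omega> * t) \<partial>M) = ?p t * cmod (\<integral>\<omega>. iexp (t / \<epsilon> * X \<omega>) \<partial>M)"
      by (simp only: norm_mult norm_scaleR norm_exp_i_times) simp
    also have "\<dots> \<le> (1 / sqrt (2 * pi)) * (1 / (1 + (b * (t / \<epsilon>))\<^sup>2))"
    proof (rule mult_mono[OF _ ch])
      show "?p t \<le> 1 / sqrt (2 * pi)" by (simp add: std_normal_density_def divide_right_mono)
    qed auto
    finally show "norm (\<integral>\<omega>. ?p t *\<^sub>R iexp (s \<omega> * t) \<partial>M) \<le> (1 / sqrt (2 * pi)) * (1 / (1 + (b / \<epsilon> * t)\<^sup>2))"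
      by simp
  qed
  also have "\<dots> = (1 / sqrt (2 * pi)) * (\<integral>t. 1 / (1 + (b / \<epsilon> * t)\<^sup>2) \<partial>lborel)"
    by (rule integral_mult_right_zero)
  also have "(\<integral>t. 1 / (1 + (b / \<epsilon> * t)\<^sup>2) \<partial>lborel) = \<epsilon> / b * lorentz_mass"
  proof -
    have "lorentz_mass = (b / \<epsilon>) * (\<integral>t. 1 / (1 + (b / \<epsilon> * t)\<^sup>2) \<partial>lborel)"
      unfolding lorentz_mass_def
      by (subst lborel_integral_real_affine[of "b / \<epsilon>" _ 0]) (use \<open>\<epsilon> > 0\<close> \<open>b > 0\<close> in auto)
    moreover have "\<epsilon> / b * (b / \<epsilon> * z) = z" for z
      using \<open>\<epsilon> > 0\<close> \<open>b > 0\<close> by simp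
    ultimately show ?thesis by metis
  qed
  finally have E: "E \<le> (1 / sqrt (2 * pi)) * (\<epsilon> / b * lorentz_mass)" .
  \<comment> \<open>The factor exp (1/2) from the event and 1 / sqrt (2 pi) from the density
    together are at most 1, because e \<le> 2 pi.\<close>
  have "exp (1 / 2) \<le> sqrt (2 * pi)"
  proof (rule real_le_rsqrt)
    have "(exp (1 / 2))\<^sup>2 = exp (1 :: real)" by (simp add: power2_eq_square flip: exp_add)
    also have "\<dots> \<le> 2 * pi" using exp_le pi_gt3 by simp
    finally show "(exp (1 / 2))\<^sup>2 \<le> 2 * pi" .
  qed
  then have e: "exp (1 / 2) * (1 / sqrt (2 * pi)) \<le> 1" by (simp add: field_simps)
  have nn: "\<epsilon> / b * lorentz_mass \<ge> 0" using \<open>\<epsilon> > 0\<close> \<open>b > 0\<close> lorentz_mass_nonneg by simp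
  have "exp (1 / 2) * E \<le> exp (1 / 2) * ((1 / sqrt (2 * pi)) * (\<epsilon> / b * lorentz_mass))"
    using E by (intro mult_left_mono) auto
  also have "\<dots> \<le> 1 * (\<epsilon> / b * lorentz_mass)"
    unfolding mult.assoc[symmetric, of "exp _"] by (rule mult_right_mono[OF e nn])
  finally show ?thesis using 1 by simp
qed

text \<open>One squared normal with coefficient a contributes a factor of modulus (1 + 4 a^2
  t^2)^(-1/4), too slow to integrate. Four indices of \<open>J\<close> together give at most 1 / (1
  + 4 \<alpha>^2 t^2), and Bernoulli's inequality turns k such groups into decay at the scale 1 /
  (\<alpha> sqrt k). Indices outside \<open>J\<close> contribute factors at most 1.\<close>

lemma chi_square_combination_char:
  assumes I: "finite I" "J \<subseteq> I" "4 * k \<le> card J" "k \<ge> 1" "\<alpha> > 0"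
    and ind: "indep_vars (\<lambda>_. borel) \<xi> I"
    and d: "\<And>i. i \<in> I \<Longrightarrow> distr M borel (\<xi> i) = std_normal_distribution"
    and a: "\<And>i. i \<in> J \<Longrightarrow> \<alpha> \<le> a i"
  shows "cmod (\<integral>\<omega>. iexp (t * (\<Sum>i\<in>I. a i * (\<xi> i \<omega>)\<^sup>2)) \<partial>M) \<le> 1 / (1 + (2 * \<alpha> * sqrt k * t)\<^sup>2)"
proof -
  have \<xi>m: "\<xi> i \<in> borel_measurable M" if "i \<in> I" for i
    using ind that by (auto simp: indep_vars_def)
  define q where "q = (\<lambda>i. 1 / (1 + 4 * (t * a i)\<^sup>2))"
  have q: "0 < q i" "q i \<le> 1" for i
    by (auto simp: q_def add_pos_nonneg)
  have f: "(cmod (char (distr M borel (\<lambda>\<omega>. a i * (\<xi> i \<omega>)\<^sup>2)) t)) ^ 4 = q i" if "i \<in> I" for i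
  proof -
    note [measurable] = \<xi>m[OF that]
    have "char (distr M borel (\<lambda>\<omega>. a i * (\<xi> i \<omega>)\<^sup>2)) t = (\<integral>\<omega>. iexp (t * (a i * (\<xi> i \<omega>)\<^sup>2)) \<partial>M)"
      unfolding char_def by (subst integral_distr) auto
    also have "\<dots> = (\<integral>x. iexp (t * (a i * x\<^sup>2)) \<partial>distr M borel (\<xi> i))"
      by (subst integral_distr) auto
    also have "\<dots> = (\<integral>x. std_normal_density x *\<^sub>R iexp ((t * a i) * x\<^sup>2) \<partial>lborel)"
      unfolding d[OF that] by (subst integral_density) (auto simp: mult.assoc)
    finally have "(cmod (char (distr M borel (\<lambda>\<omega>. a i * (\<xi> i \<omega>)\<^sup>2)) t))\<^sup>2 = 1 / sqrt (1 + 4 * (t * a i)\<^sup>2)"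
      by (simp only: chi_square_char)
    then have "((cmod (char (distr M borel (\<lambda>\<omega>. a i * (\<xi> i \<omega>)\<^sup>2)) t))\<^sup>2)\<^sup>2 = q i"
      by (simp add: power_divide q_def add_nonneg_nonneg)
    then show ?thesis by simp
  qed
  have ind2: "indep_vars (\<lambda>_. borel) (\<lambda>i \<omega>. a i * (\<xi> i \<omega>)\<^sup>2) I"
    by (rule indep_vars_compose2[OF ind]) measurable
  have [measurable]: "(\<lambda>\<omega>. \<Sum>i\<in>I. a i * (\<xi> i \<omega>)\<^sup>2) \<in> borel_measurable M"
    using \<xi>m by (intro borel_measurable_sum) measurable
  define z where "z = cmod (\<integral>\<omega>. iexp (t * (\<Sum>i\<in>I. a i * (\<xi> i \<omega>)\<^sup>2)) \<partial>M)"
  have "z = cmod (char (distr M borel (\<lambda>\<omega>. \<Sum>i\<in>I. a i * (\<xi> i \<omega>)\<^sup>2)) t)"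
    unfolding char_def z_def by (subst integral_distr) auto
  also have "\<dots> = (\<Prod>i\<in>I. cmod (char (distr M borel (\<lambda>\<omega>. a i * (\<xi> i \<omega>)\<^sup>2)) t))"
    unfolding char_distr_sum[OF ind2] by (simp add: prod_norm)
  finally have "z ^ 4 = (\<Prod>i\<in>I. q i)"
    using f by (simp add: prod_power_distrib)
  also have "\<dots> \<le> (\<Prod>i\<in>J. q i)"
  proof -
    have "(\<Prod>i\<in>I. q i) = (\<Prod>i\<in>J. q i) * (\<Prod>i\<in>I - J. q i)"
      using I by (metis mult.commute prod.subset_diff)
    also have "\<dots> \<le> (\<Prod>i\<in>J. q i) * 1"
      using q by (intro mult_left_mono prod_le_1 prod_nonneg) (auto intro: less_imp_le)
    finally show ?thesis by simp
  qed
  also have "\<dots> \<le> (\<Prod>i\<in>J. 1 / (1 + 4 * (t * \<alpha>)\<^sup>2))"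
  proof (rule prod_mono)
    fix i assume "i \<in> J"
    then have "(t * \<alpha>)\<^sup>2 \<le> (t * a i)\<^sup>2"
      using a[of i] \<open>\<alpha> > 0\<close> by (simp add: power_mult_distrib mult_left_mono power_mono)
    then show "0 \<le> q i \<and> q i \<le> 1 / (1 + 4 * (t * \<alpha>)\<^sup>2)"
      using q(1)[of i] unfolding q_def by (auto intro!: divide_left_mono mult_pos_pos add_pos_nonneg)
  qed
  also have "\<dots> = (1 / (1 + 4 * (t * \<alpha>)\<^sup>2)) ^ card J" by simp
  also have "\<dots> \<le> (1 / (1 + 4 * (t * \<alpha>)\<^sup>2)) ^ (4 * k)"
    using I by (intro power_decreasing) (auto simp: add_pos_nonneg)
  also have "\<dots> = ((1 / (1 + 4 * (t * \<alpha>)\<^sup>2)) ^ k) ^ 4"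
    by (simp add: power_mult[symmetric] mult.commute)
  finally have "z ^ 4 \<le> ((1 / (1 + 4 * (t * \<alpha>)\<^sup>2)) ^ k) ^ 4" .
  then have "z \<le> (1 / (1 + 4 * (t * \<alpha>)\<^sup>2)) ^ k"
    by (rule power_le_imp_le_base[of _ 3, simplified]) (simp add: add_nonneg_nonneg)
  also have "\<dots> = 1 / (1 + 4 * (t * \<alpha>)\<^sup>2) ^ k" by (simp add: power_divide)
  also have "\<dots> \<le> 1 / (1 + real k * (4 * (t * \<alpha>)\<^sup>2))"
  proof (rule divide_left_mono)
    show "1 + real k * (4 * (t * \<alpha>)\<^sup>2) \<le> (1 + 4 * (t * \<alpha>)\<^sup>2) ^ k"
      using Bernoulli_inequality[of "4 * (t * \<alpha>)\<^sup>2" k] zero_le_power2[of "t * \<alpha>"] by linarith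
  qed (auto intro!: mult_pos_pos add_pos_nonneg zero_less_power)
  also have "real k * (4 * (t * \<alpha>)\<^sup>2) = (2 * \<alpha> * sqrt k * t)\<^sup>2"
    by (simp add: power_mult_distrib)
  finally show ?thesis unfolding z_def .
qed

lemma chi_square_combination_concentration:
  assumes I: "finite I" "J \<subseteq> I" "4 * k \<le> card J" "k \<ge> 1" "\<alpha> > 0" "\<epsilon> > 0"
    and ind: "indep_vars (\<lambda>_. borel) \<xi> I"
    and d: "\<And>i. i \<in> I \<Longrightarrow> distr M borel (\<xi> i) = std_normal_distribution"
    and a: "\<And>i. i \<in> J \<Longrightarrow> \<alpha> \<le> a i"
  shows "prob {\<omega> \<in> space M. \<bar>(\<Sum>i\<in>I. a i * (\<xi> i \<omega>)\<^sup>2) - c\<bar> \<le> \<epsilon>} \<le> \<epsilon> / (2 * \<alpha> * sqrt k) * lorentz_mass"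
proof (rule concentration_char)
  have "\<xi> i \<in> borel_measurable M" if "i \<in> I" for i
    using ind that by (auto simp: indep_vars_def)
  then show "(\<lambda>\<omega>. \<Sum>i\<in>I. a i * (\<xi> i \<omega>)\<^sup>2) \<in> borel_measurable M"
    by (intro borel_measurable_sum) measurable
  show "cmod (\<integral>\<omega>. iexp (t * (\<Sum>i\<in>I. a i * (\<xi> i \<omega>)\<^sup>2)) \<partial>M) \<le> 1 / (1 + (2 * \<alpha> * sqrt k * t)\<^sup>2)" for t
    by (rule chi_square_combination_char[OF I(1-5) ind d a])
qed (use I in auto)

end

subsection \<open>White noise\<close>

lemma sqint_abs: "f \<in> sqint M \<Longrightarrow> (\<lambda>x. \<bar>f x\<bar>) \<in> sqint M"
  by (auto simp add: sqint_def)

section \<open>Limits of squared path norms and of probabilities\<close>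

context pair_prob_space
begin

text \<open>Since F^2 - G^2 = 2 (F - G) F - (F - G)^2, mean-square closeness on the product space
  gives \<open>L1\<close> closeness of the squared path norms by Cauchy-Schwarz. Sections are
  integrable only almost surely, hence the detour through almost-everywhere statements.\<close>

lemma path_norm_limit:
  assumes F: "F \<in> sqint (M1 \<Otimes>\<^sub>M M2)" and G: "\<And>N. G N \<in> sqint (M1 \<Otimes>\<^sub>M M2)"
    and lim: "(\<lambda>N::nat. \<integral>p. (F p - G N p)\<^sup>2 \<partial>(M1 \<Otimes>\<^sub>M M2)) \<longlonglongrightarrow> 0"
  shows "(\<lambda>N. \<integral>y. \<bar>(\<integral>x. (F (x, y))\<^sup>2 \<partial>M1) - (\<integral>x. (G N (x, y))\<^sup>2 \<partial>M1)\<bar> \<partial>M2) \<longlonglongrightarrow> 0"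
    and "integrable M2 (\<lambda>y. \<integral>x. (F (x, y))\<^sup>2 \<partial>M1)"
    and "\<And>N. integrable M2 (\<lambda>y. \<integral>x. (G N (x, y))\<^sup>2 \<partial>M1)"
proof -
  let ?P = "M1 \<Otimes>\<^sub>M M2"
  have int: "integrable M2 (\<lambda>y. \<integral>x. (H (x, y))\<^sup>2 \<partial>M1)" if "H \<in> sqint ?P" for H
    using integrable_snd[of "\<lambda>x y. (H (x, y))\<^sup>2"] sqint_integrable_power2[OF that] by (simp add: case_prod_beta')
  show iF: "integrable M2 (\<lambda>y. \<integral>x. (F (x, y))\<^sup>2 \<partial>M1)" by (rule int[OF F])
  show iG: "integrable M2 (\<lambda>y. \<integral>x. (G N (x, y))\<^sup>2 \<partial>M1)" for N by (rule int[OF G])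
  define e where "e N = (\<integral>p. (F p - G N p)\<^sup>2 \<partial>?P)" for N
  define f where "f = (\<integral>p. (F p)\<^sup>2 \<partial>?P)"
  have sD: "(\<lambda>p. F p - G N p) \<in> sqint ?P" for N by (intro sqint_diff F G)
  have sE: "(\<lambda>p. 2 * F p - (F p - G N p)) \<in> sqint ?P" for N by (intro sqint_diff sqint_cmult F G)
  have bound: "(\<integral>y. \<bar>(\<integral>x. (F (x, y))\<^sup>2 \<partial>M1) - (\<integral>x. (G N (x, y))\<^sup>2 \<partial>M1)\<bar> \<partial>M2) \<le> 2 * (sqrt (e N) * sqrt f) + e N" for N
  proof -
    define d where "d p = (F p)\<^sup>2 - (G N p)\<^sup>2" for p
    have di: "integrable ?P d"
      unfolding d_def using F G by (intro Bochner_Integration.integrable_diff sqint_integrable_power2)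
    have AEs: "AE y in M2. integrable M1 (\<lambda>x. (F (x, y))\<^sup>2)" "AE y in M2. integrable M1 (\<lambda>x. (G N (x, y))\<^sup>2)"
      using AE_integrable_snd[of "\<lambda>x y. (F (x, y))\<^sup>2"] AE_integrable_snd[of "\<lambda>x y. (G N (x, y))\<^sup>2"]
        sqint_integrable_power2[OF F] sqint_integrable_power2[OF G] by (simp_all add: case_prod_beta')
    have ad: "integrable ?P (\<lambda>(x, y). \<bar>d (x, y)\<bar>)"
      using integrable_abs[OF di] by (simp add: case_prod_beta')
    have "(\<integral>y. \<bar>(\<integral>x. (F (x, y))\<^sup>2 \<partial>M1) - (\<integral>x. (G N (x, y))\<^sup>2 \<partial>M1)\<bar> \<partial>M2) \<le> (\<integral>y. (\<integral>x. \<bar>d (x, y)\<bar> \<partial>M1) \<partial>M2)"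
    proof (rule integral_mono_AE)
      show "integrable M2 (\<lambda>y. \<integral>x. \<bar>d (x, y)\<bar> \<partial>M1)" by (rule integrable_snd[OF ad])
      show "AE y in M2. \<bar>(\<integral>x. (F (x, y))\<^sup>2 \<partial>M1) - (\<integral>x. (G N (x, y))\<^sup>2 \<partial>M1)\<bar> \<le> (\<integral>x. \<bar>d (x, y)\<bar> \<partial>M1)"
        using AEs
      proof eventually_elim
        case (elim y)
        then have "(\<integral>x. (F (x, y))\<^sup>2 \<partial>M1) - (\<integral>x. (G N (x, y))\<^sup>2 \<partial>M1) = (\<integral>x. d (x, y) \<partial>M1)"
          by (simp add: d_def)
        then show ?case using integral_abs_bound[of M1 "\<lambda>x. d (x, y)"] by simp
      qed
    qed (use iF iG in auto)
    also have "\<dots> = (\<integral>p. \<bar>d p\<bar> \<partial>?P)"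
      using integral_snd[OF ad] by (simp add: case_prod_beta')
    also have "\<dots> \<le> (\<integral>p. 2 * (\<bar>F p - G N p\<bar> * \<bar>F p\<bar>) + (F p - G N p)\<^sup>2 \<partial>?P)"
    proof (rule integral_mono)
      show "integrable ?P (\<lambda>p. 2 * (\<bar>F p - G N p\<bar> * \<bar>F p\<bar>) + (F p - G N p)\<^sup>2)"
        using integrable_abs[OF sqint_integrable_mult[OF sD F]] sqint_integrable_power2[OF sD]
        by (simp add: abs_mult)
      fix p
      have "d p = 2 * ((F p - G N p) * F p) - (F p - G N p)\<^sup>2"
        by (simp add: d_def power2_eq_square algebra_simps)
      then show "\<bar>d p\<bar> \<le> 2 * (\<bar>F p - G N p\<bar> * \<bar>F p\<bar>) + (F p - G N p)\<^sup>2"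
        using abs_triangle_ineq4[of "2 * ((F p - G N p) * F p)" "(F p - G N p)\<^sup>2"] by (simp add: abs_mult)
    qed (use di in auto)
    also have "\<dots> = 2 * (\<integral>p. \<bar>F p - G N p\<bar> * \<bar>F p\<bar> \<partial>?P) + e N"
      using integrable_abs[OF sqint_integrable_mult[OF sD F]] sqint_integrable_power2[OF sD]
      by (simp add: abs_mult e_def)
    also have "(\<integral>p. \<bar>F p - G N p\<bar> * \<bar>F p\<bar> \<partial>?P) \<le> sqrt (e N) * sqrt f"
    proof -
      have "(\<lambda>p. \<bar>F p - G N p\<bar>) \<in> sqint ?P" "(\<lambda>p. \<bar>F p\<bar>) \<in> sqint ?P"
        by (intro sqint_abs sD F)+
      from sqint_Cauchy_Schwarz_abs[OF this] show ?thesis by (simp add: e_def f_def)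
    qed
    finally show ?thesis by simp
  qed
  show "(\<lambda>N. \<integral>y. \<bar>(\<integral>x. (F (x, y))\<^sup>2 \<partial>M1) - (\<integral>x. (G N (x, y))\<^sup>2 \<partial>M1)\<bar> \<partial>M2) \<longlonglongrightarrow> 0"
  proof (rule tendsto_sandwich[OF _ _ tendsto_const])
    have "e \<longlonglongrightarrow> 0" using lim by (simp add: e_def[abs_def])
    then have "(\<lambda>N. 2 * (sqrt (e N) * sqrt f) + e N) \<longlonglongrightarrow> 2 * (sqrt 0 * sqrt f) + 0"
      by (intro tendsto_intros)
    then show "(\<lambda>N. 2 * (sqrt (e N) * sqrt f) + e N) \<longlonglongrightarrow> 0" by simp
  qed (use bound in auto)
qed

end

context prob_space
begin

lemma mean_abs_Markov:
  assumes "integrable M X" "\<eta> > 0"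
  shows "prob {\<omega> \<in> space M. \<bar>X \<omega>\<bar> \<ge> \<eta>} \<le> (\<integral>\<omega>. \<bar>X \<omega>\<bar> \<partial>M) / \<eta>"
  by (rule integral_Markov_inequality_measure[of _ _ "space M - {}", simplified])
     (use assms in auto)

lemma second_moment_Markov:
  assumes "X \<in> sqint M" "\<eta> > 0"
  shows "prob {\<omega> \<in> space M. \<bar>X \<omega>\<bar> \<ge> \<eta>} \<le> (\<integral>\<omega>. (X \<omega>)\<^sup>2 \<partial>M) / \<eta>\<^sup>2"
proof -
  have "prob {\<omega> \<in> space M. \<bar>(X \<omega>)\<^sup>2\<bar> \<ge> \<eta>\<^sup>2} \<le> (\<integral>\<omega>. \<bar>(X \<omega>)\<^sup>2\<bar> \<partial>M) / \<eta>\<^sup>2"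
    using assms by (intro mean_abs_Markov sqint_integrable_power2) auto
  moreover have "\<bar>x\<^sup>2\<bar> \<ge> \<eta>\<^sup>2 \<longleftrightarrow> \<bar>x\<bar> \<ge> \<eta>" for x :: real
    using abs_le_square_iff[of \<eta> x] \<open>\<eta> > 0\<close> by simp
  ultimately show ?thesis by simp
qed

text \<open>\<open>L1\<close> convergence implies convergence in probability; the margin \<eta>
  between \<open>S\<close> and \<open>S'\<close> absorbs the error and takes the place of continuity
  of the limit law at the boundary of \<open>S\<close>.\<close>

lemma prob_le_of_limit:
  fixes X :: "'a \<Rightarrow> real"
  assumes X: "integrable M X" and XN: "\<And>N. integrable M (XN N)"
    and lim: "(\<lambda>N::nat. \<integral>\<omega>. \<bar>X \<omega> - XN N \<omega>\<bar> \<partial>M) \<longlonglongrightarrow> 0"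
    and S: "S \<in> sets borel" "S' \<in> sets borel" "\<eta> > 0" "\<And>x y. x \<in> S \<Longrightarrow> \<bar>x - y\<bar> < \<eta> \<Longrightarrow> y \<in> S'"
    and B: "eventually (\<lambda>N. prob {\<omega> \<in> space M. XN N \<omega> \<in> S'} \<le> B) sequentially"
  shows "prob {\<omega> \<in> space M. X \<omega> \<in> S} \<le> B"
proof -
  have [measurable]: "X \<in> borel_measurable M" "\<And>N. XN N \<in> borel_measurable M" "S \<in> sets borel" "S' \<in> sets borel"
    using X XN S by auto
  have step: "prob {\<omega> \<in> space M. X \<omega> \<in> S} \<le> prob {\<omega> \<in> space M. XN N \<omega> \<in> S'} + (\<integral>\<omega>. \<bar>X \<omega> - XN N \<omega>\<bar> \<partial>M) / \<eta>" for N
  proof -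
    have "prob {\<omega> \<in> space M. X \<omega> \<in> S} \<le> prob ({\<omega> \<in> space M. XN N \<omega> \<in> S'} \<union> {\<omega> \<in> space M. \<bar>X \<omega> - XN N \<omega>\<bar> \<ge> \<eta>})"
    proof (rule finite_measure_mono, rule subsetI)
      fix \<omega> assume "\<omega> \<in> {\<omega> \<in> space M. X \<omega> \<in> S}"
      then show "\<omega> \<in> {\<omega> \<in> space M. XN N \<omega> \<in> S'} \<union> {\<omega> \<in> space M. \<bar>X \<omega> - XN N \<omega>\<bar> \<ge> \<eta>}"
        using S(4)[of "X \<omega>" "XN N \<omega>"] by (cases "\<bar>X \<omega> - XN N \<omega>\<bar> < \<eta>") auto
    next
      show "{\<omega> \<in> space M. XN N \<omega> \<in> S'} \<union> {\<omega> \<in> space M. \<bar>X \<omega> - XN N \<omega>\<bar> \<ge> \<eta>} \<in> events"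
        by (intro sets.Un) measurable
    qed
    also have "\<dots> \<le> prob {\<omega> \<in> space M. XN N \<omega> \<in> S'} + prob {\<omega> \<in> space M. \<bar>X \<omega> - XN N \<omega>\<bar> \<ge> \<eta>}"
      by (rule measure_Un_le) auto
    also have "prob {\<omega> \<in> space M. \<bar>X \<omega> - XN N \<omega>\<bar> \<ge> \<eta>} \<le> (\<integral>\<omega>. \<bar>X \<omega> - XN N \<omega>\<bar> \<partial>M) / \<eta>"
      using X XN S by (intro mean_abs_Markov) auto
    finally show ?thesis by simp
  qed
  have "(\<lambda>N. B + (\<integral>\<omega>. \<bar>X \<omega> - XN N \<omega>\<bar> \<partial>M) / \<eta>) \<longlonglongrightarrow> B + 0 / \<eta>"
    using S by (intro tendsto_intros lim) auto
  moreover have "eventually (\<lambda>N. prob {\<omega> \<in> space M. X \<omega> \<in> S} \<le> B + (\<integral>\<omega>. \<bar>X \<omega> - XN N \<omega>\<bar> \<partial>M) / \<eta>) sequentially"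
    using B
  proof eventually_elim
    case (elim N)
    then show ?case using step[of N] by linarith
  qed
  ultimately show ?thesis
    using tendsto_lowerbound[of "\<lambda>N. B + (\<integral>\<omega>. \<bar>X \<omega> - XN N \<omega>\<bar> \<partial>M) / \<eta>" B] by simp
qed

end

context gaussian_white_noise
begin

text \<open>The process axiom for a family that does not depend on \<open>t\<close> yields
  measurability of a single variable.\<close>

lemma measurable_W [measurable (raw)]: "g \<in> L2_per \<Longrightarrow> (\<lambda>\<omega>. W \<omega> g) \<in> borel_measurable M"
proof -
  assume g: "g \<in> L2_per"
  then have [measurable]: "g \<in> borel_measurable borel" by (simp add: L2_per_iff)
  have "(\<lambda>(t::real, \<omega>). W \<omega> g) \<in> borel_measurable (borel \<Otimes>\<^sub>M M)"
    by (rule measurable_process[of "\<lambda>_. g"]) (use g in auto)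
  then have "(\<lambda>\<omega>. (\<lambda>(t::real, \<omega>). W \<omega> g) (0, \<omega>)) \<in> borel_measurable M"
    by (rule measurable_compose[rotated]) simp
  then show ?thesis by simp
qed

lemma std_normal_W:
  assumes g: "g \<in> L2_per" and n: "L2_norm g > 0"
  shows "distributed M lborel (\<lambda>\<omega>. W \<omega> g / L2_norm g) std_normal_density"
  using normal_standard_normal_convert[OF n, of "\<lambda>\<omega>. W \<omega> g" 0] gaussian[OF g n] by simp

lemma char_W:
  assumes g: "g \<in> L2_per"
  shows "(\<integral>\<omega>. iexp (W \<omega> g) \<partial>M) = of_real (exp (- (L2_norm g)\<^sup>2 / 2))"
proof (cases "L2_norm g = 0")
  case True
  have "(\<integral>\<omega>. iexp (W \<omega> g) \<partial>M) = (\<integral>\<omega>. 1 \<partial>M)"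
    by (intro integral_cong_AE) (use degenerate[OF g True] g in \<open>auto elim: eventually_mono\<close>)
  then show ?thesis using True by (simp add: prob_space)
next
  case False
  then have n: "L2_norm g > 0" using L2_norm_nonneg[of g] by simp
  define Y where "Y = (\<lambda>\<omega>. W \<omega> g / L2_norm g)"
  have Y [measurable]: "Y \<in> borel_measurable M" using g by (simp add: Y_def)
  have d: "distr M lborel Y = std_normal_distribution"
    using distributed_distr_eq_density[OF std_normal_W[OF g n]] by (simp add: Y_def)
  have "(\<integral>\<omega>. iexp (W \<omega> g) \<partial>M) = (\<integral>\<omega>. iexp (L2_norm g * Y \<omega>) \<partial>M)"
    using n by (simp add: Y_def)
  also have "\<dots> = (\<integral>y. iexp (L2_norm g * y) \<partial>distr M lborel Y)"
    by (subst integral_distr) auto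
  also have "\<dots> = char std_normal_distribution (L2_norm g)"
    unfolding d char_def ..
  finally show ?thesis by (simp add: char_std_normal_distribution)
qed

lemma W_second_moment:
  assumes g: "g \<in> L2_per"
  shows "(\<lambda>\<omega>. W \<omega> g) \<in> sqint M" and "(\<integral>\<omega>. (W \<omega> g)\<^sup>2 \<partial>M) = (L2_norm g)\<^sup>2"
proof -
  have [measurable]: "(\<lambda>\<omega>. W \<omega> g) \<in> borel_measurable M" by (rule measurable_W[OF g])
  have "integrable M (\<lambda>\<omega>. (W \<omega> g)\<^sup>2) \<and> (\<integral>\<omega>. (W \<omega> g)\<^sup>2 \<partial>M) = (L2_norm g)\<^sup>2"
  proof (cases "L2_norm g = 0")
    case True
    have ae: "AE \<omega> in M. (W \<omega> g)\<^sup>2 = 0"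
      using degenerate[OF g True] by eventually_elim simp
    have "integrable M (\<lambda>\<omega>. (W \<omega> g)\<^sup>2)"
      by (subst integrable_cong_AE[of _ _ "\<lambda>_. 0"]) (use ae in auto)
    then show ?thesis using integral_eq_zero_AE[OF ae] True by simp
  next
    case False
    then have n: "L2_norm g > 0" using L2_norm_nonneg[of g] by simp
    note d = std_normal_W[OF g n]
    have i: "integrable lborel (\<lambda>x. std_normal_density x * x ^ 2)"
      by (rule integrable_std_normal_moment)
    have "integrable M (\<lambda>\<omega>. (W \<omega> g / L2_norm g) ^ 2)"
      by (subst distributed_integrable[OF d, of "\<lambda>x. x ^ 2", symmetric]) (use i in auto)
    moreover have "(\<integral>\<omega>. (W \<omega> g / L2_norm g) ^ 2 \<partial>M) = 1"
      by (subst distributed_integral[OF d, of "\<lambda>x. x ^ 2", symmetric])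
         (use integral_std_normal_moment_even[of 1] in \<open>auto simp: fact_numeral\<close>)
    moreover have eq: "(\<lambda>\<omega>. (W \<omega> g)\<^sup>2) = (\<lambda>\<omega>. (L2_norm g)\<^sup>2 * (W \<omega> g / L2_norm g) ^ 2)"
      using n by (simp add: power_divide)
    ultimately show ?thesis
      unfolding eq integral_mult_right_zero by (intro conjI integrable_mult_right) (simp_all only: mult_1_right)
  qed
  then show "(\<lambda>\<omega>. W \<omega> g) \<in> sqint M" "(\<integral>\<omega>. (W \<omega> g)\<^sup>2 \<partial>M) = (L2_norm g)\<^sup>2"
    by (auto simp: sqint_def)
qed

lemma zero_L2_per: "(\<lambda>_. 0) \<in> L2_per"
  by (simp add: L2_per_iff sqint_zero)

text \<open>Each use of the linearity axiom has its own exceptional null set; finitely many of them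
  are collected by induction.\<close>

lemma W_sum:
  assumes "finite J" "\<And>j. j \<in> J \<Longrightarrow> e j \<in> L2_per"
  shows "(\<lambda>t. \<Sum>j\<in>J. a j * e j t) \<in> L2_per \<and> (AE \<omega> in M. W \<omega> (\<lambda>t. \<Sum>j\<in>J. a j * e j t) = (\<Sum>j\<in>J. a j * W \<omega> (e j)))"
  using assms
proof (induction J rule: finite_induct)
  case empty
  have "AE \<omega> in M. W \<omega> (\<lambda>_. 0) = 0"
    by (rule degenerate[OF zero_L2_per]) (simp add: L2_norm_unit)
  then show ?case by (simp add: zero_L2_per)
next
  case (insert x F)
  then have F: "(\<lambda>t. \<Sum>j\<in>F. a j * e j t) \<in> L2_per"
    and ae: "AE \<omega> in M. W \<omega> (\<lambda>t. \<Sum>j\<in>F. a j * e j t) = (\<Sum>j\<in>F. a j * W \<omega> (e j))" and x: "e x \<in> L2_per"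
    by auto
  have "AE \<omega> in M. W \<omega> (\<lambda>t. a x * e x t + 1 * (\<Sum>j\<in>F. a j * e j t)) = a x * W \<omega> (e x) + 1 * W \<omega> (\<lambda>t. \<Sum>j\<in>F. a j * e j t)"
    by (rule linear[OF x F])
  with ae have "AE \<omega> in M. W \<omega> (\<lambda>t. a x * e x t + 1 * (\<Sum>j\<in>F. a j * e j t)) = a x * W \<omega> (e x) + (\<Sum>j\<in>F. a j * W \<omega> (e j))"
    by eventually_elim simp
  moreover have "(\<lambda>t. a x * e x t + 1 * (\<Sum>j\<in>F. a j * e j t)) \<in> L2_per"
    by (rule L2_per_lin[OF x F])
  ultimately show ?case using insert.hyps by simp
qed

section \<open>Gaussian coordinates of the noise\<close>

definition \<xi> :: "int \<Rightarrow> 'w \<Rightarrow> real" where "\<xi> j \<omega> = W \<omega> (cas j)"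

lemma measurable_\<xi> [measurable]: "\<xi> j \<in> borel_measurable M"
  unfolding \<xi>_def[abs_def] by (rule measurable_W[OF cas_L2_per])

lemma \<xi>_sqint: "\<xi> j \<in> sqint M"
  unfolding \<xi>_def[abs_def] by (rule W_second_moment[OF cas_L2_per])

lemma W_trig:
  shows "AE \<omega> in M. W \<omega> (\<lambda>t. \<Sum>j\<in>low c. a j * cas j t) = (\<Sum>j\<in>low c. a j * \<xi> j \<omega>)"
    and "(\<lambda>t. \<Sum>j\<in>low c. a j * cas j t) \<in> L2_per"
    and "(L2_norm (\<lambda>t. \<Sum>j\<in>low c. a j * cas j t))\<^sup>2 = (\<Sum>j\<in>low c. (a j)\<^sup>2)"
  using W_sum[of "low c" cas a] cas_L2_per orthonormal_norm[OF finite_low cas_sqint cas_orthonormal]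
  by (auto simp: \<xi>_def L2_norm_power2)

text \<open>A finite linear form in the coordinates is almost surely the noise of a trigonometric
  polynomial, whose squared norm is the sum of the squared coefficients. This is the input for
  independence.\<close>

lemma char_\<xi>: "(\<integral>\<omega>. iexp (\<Sum>j\<in>low c. a j * \<xi> j \<omega>) \<partial>M) = of_real (exp (- (\<Sum>j\<in>low c. (a j)\<^sup>2) / 2))"
proof -
  have "(\<integral>\<omega>. iexp (\<Sum>j\<in>low c. a j * \<xi> j \<omega>) \<partial>M) = (\<integral>\<omega>. iexp (W \<omega> (\<lambda>t. \<Sum>j\<in>low c. a j * cas j t)) \<partial>M)"
  proof (rule integral_cong_AE)
    show "AE \<omega> in M. iexp (\<Sum>j\<in>low c. a j * \<xi> j \<omega>) = iexp (W \<omega> (\<lambda>t. \<Sum>j\<in>low c. a j * cas j t))"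
      using W_trig(1)[where c=c and a=a] by eventually_elim (simp only:)
    show "(\<lambda>\<omega>. iexp (W \<omega> (\<lambda>t. \<Sum>j\<in>low c. a j * cas j t))) \<in> borel_measurable M"
      using measurable_W[OF W_trig(2)] by measurable
  qed measurable
  then show ?thesis by (simp only: char_W[OF W_trig(2)] W_trig(3))
qed

lemma \<xi>_indep:
  assumes "c \<ge> 0"
  shows "indep_vars (\<lambda>_. borel) \<xi> (low c)" and "j \<in> low c \<Longrightarrow> distr M borel (\<xi> j) = std_normal_distribution"
proof -
  have "low c \<noteq> {}" using assms by (auto intro!: exI[of _ 0])
  from joint_normal_indep[OF finite_low this measurable_\<xi> char_\<xi>]
  show "indep_vars (\<lambda>_. borel) \<xi> (low c)" "j \<in> low c \<Longrightarrow> distr M borel (\<xi> j) = std_normal_distribution" by auto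
qed

lemma \<xi>_std_normal: "distr M borel (\<xi> j) = std_normal_distribution"
  by (rule \<xi>_indep(2)[of "\<bar>of_int j\<bar>"]) auto

lemma \<xi>_sum_second_moment:
  "(\<integral>\<omega>. (\<Sum>j\<in>low c. a j * \<xi> j \<omega>)\<^sup>2 \<partial>M) = (\<Sum>j\<in>low c. (a j)\<^sup>2)"
proof -
  have "(\<integral>\<omega>. (\<Sum>j\<in>low c. a j * \<xi> j \<omega>)\<^sup>2 \<partial>M) = (\<integral>\<omega>. (W \<omega> (\<lambda>t. \<Sum>j\<in>low c. a j * cas j t))\<^sup>2 \<partial>M)"
  proof (rule integral_cong_AE)
    show "AE \<omega> in M. (\<Sum>j\<in>low c. a j * \<xi> j \<omega>)\<^sup>2 = (W \<omega> (\<lambda>t. \<Sum>j\<in>low c. a j * cas j t))\<^sup>2"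
      using W_trig(1)[where c=c and a=a] by eventually_elim (simp only:)
    show "(\<lambda>\<omega>. (W \<omega> (\<lambda>t. \<Sum>j\<in>low c. a j * cas j t))\<^sup>2) \<in> borel_measurable M"
      using measurable_W[OF W_trig(2)] by measurable
  qed measurable
  then show ?thesis by (simp only: W_second_moment(2)[OF W_trig(2)] W_trig(3))
qed

lemma \<xi>_moment: "integrable M (\<lambda>\<omega>. \<xi> j \<omega> ^ k)"
  and \<xi>_moment4: "(\<integral>\<omega>. (\<xi> j \<omega>) ^ 4 \<partial>M) = 3"
  and \<xi>_moment2: "(\<integral>\<omega>. (\<xi> j \<omega>)\<^sup>2 \<partial>M) = 1"
proof -
  have "integrable (distr M borel (\<xi> j)) (\<lambda>x. x ^ k)"
    unfolding \<xi>_std_normal by (rule integrable_std_normal_distribution_moment)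
  then show "integrable M (\<lambda>\<omega>. \<xi> j \<omega> ^ k)" by (subst (asm) integrable_distr_eq) auto
  have m: "(\<integral>\<omega>. \<xi> j \<omega> ^ (2 * k) \<partial>M) = fact (2 * k) / (2 ^ k * fact k)" for k
  proof -
    have "(\<integral>\<omega>. \<xi> j \<omega> ^ (2 * k) \<partial>M) = (\<integral>x. x ^ (2 * k) \<partial>distr M borel (\<xi> j))"
      by (subst integral_distr) auto
    then show ?thesis unfolding \<xi>_std_normal by (simp add: std_normal_distribution_even_moments)
  qed
  show "(\<integral>\<omega>. (\<xi> j \<omega>) ^ 4 \<partial>M) = 3" using m[of 2] by (simp add: fact_numeral)
  show "(\<integral>\<omega>. (\<xi> j \<omega>)\<^sup>2 \<partial>M) = 1" using m[of 1] by simp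
qed

text \<open>The variables (\<xi>_j^2 - 1) / sqrt 2 are orthonormal: the normalization comes from the
  fourth moment 3, orthogonality from independence.\<close>

lemma chi_square_variance:
  assumes "c \<ge> 0"
  shows "(\<lambda>\<omega>. \<Sum>j\<in>low c. a j * ((\<xi> j \<omega>)\<^sup>2 - 1)) \<in> sqint M"
    and "(\<integral>\<omega>. (\<Sum>j\<in>low c. a j * ((\<xi> j \<omega>)\<^sup>2 - 1))\<^sup>2 \<partial>M) = 2 * (\<Sum>j\<in>low c. (a j)\<^sup>2)"
proof -
  define e where "e j \<omega> = ((\<xi> j \<omega>)\<^sup>2 - 1) / sqrt 2" for j \<omega>
  have em [measurable]: "e j \<in> borel_measurable M" for j unfolding e_def[abs_def] by measurable
  have sq: "(\<xi> j \<omega>)\<^sup>2 * (\<xi> j \<omega>)\<^sup>2 = \<xi> j \<omega> ^ 4" for j \<omega> by simp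
  have e2: "(e j \<omega>)\<^sup>2 = (\<xi> j \<omega> ^ 4 - 2 * (\<xi> j \<omega>)\<^sup>2 + 1) / 2" for j \<omega>
    by (simp add: e_def power_divide power2_diff)
  have es: "e j \<in> sqint M" for j
  proof -
    have "integrable M (\<lambda>\<omega>. (e j \<omega>)\<^sup>2)"
      unfolding e2
      by (intro integrable_divide Bochner_Integration.integrable_add Bochner_Integration.integrable_diff
          integrable_mult_right \<xi>_moment integrable_const)
    then show ?thesis by (simp add: sqint_def)
  qed
  have "(\<integral>\<omega>. (e j \<omega>)\<^sup>2 \<partial>M) = 1" for j
    unfolding e2 using \<xi>_moment[of j 4] \<xi>_moment[of j 2] by (simp add: \<xi>_moment2 \<xi>_moment4 prob_space)
  moreover have "(\<integral>\<omega>. e i \<omega> * e j \<omega> \<partial>M) = 0" if "i \<in> low c" "j \<in> low c" "i \<noteq> j" for i j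
  proof -
    have "indep_vars (\<lambda>_. borel) e {i, j}"
    proof -
      have "indep_vars (\<lambda>_. borel) \<xi> {i, j}"
        by (rule indep_vars_subset[OF \<xi>_indep(1)[OF assms]]) (use that in auto)
      then show ?thesis unfolding e_def[abs_def] by (rule indep_vars_compose2) measurable
    qed
    from indep_vars_lebesgue_integral[OF _ this sqint_integrable[OF es]]
    have "(\<integral>\<omega>. e i \<omega> * e j \<omega> \<partial>M) = (\<integral>\<omega>. e i \<omega> \<partial>M) * (\<integral>\<omega>. e j \<omega> \<partial>M)"
      using that by simp
    moreover have "(\<integral>\<omega>. e i \<omega> \<partial>M) = 0"
      unfolding e_def using \<xi>_moment[of i 2] by (simp add: \<xi>_moment2 prob_space)
    ultimately show ?thesis by simp
  qed
  ultimately have orth: "(\<integral>\<omega>. e i \<omega> * e j \<omega> \<partial>M) = (if i = j then 1 else 0)" if "i \<in> low c" "j \<in> low c" for i j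
    using that by (simp add: power2_eq_square[symmetric])
  have eq: "(\<Sum>j\<in>low c. a j * ((\<xi> j \<omega>)\<^sup>2 - 1)) = (\<Sum>j\<in>low c. (sqrt 2 * a j) * e j \<omega>)" for \<omega>
    by (simp add: e_def)
  show "(\<lambda>\<omega>. \<Sum>j\<in>low c. a j * ((\<xi> j \<omega>)\<^sup>2 - 1)) \<in> sqint M"
    unfolding eq by (rule sqint_lin[OF es])
  show "(\<integral>\<omega>. (\<Sum>j\<in>low c. a j * ((\<xi> j \<omega>)\<^sup>2 - 1))\<^sup>2 \<partial>M) = 2 * (\<Sum>j\<in>low c. (a j)\<^sup>2)"
    unfolding eq using orthonormal_norm[of "low c" e M "\<lambda>j. sqrt 2 * a j"] es orth
    by (simp add: power_mult_distrib sum_distrib_left)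
qed

end

subsection \<open>Fourier truncation of the statistic\<close>

lemma measurable_unit_pair:
  "g \<in> borel_measurable (borel \<Otimes>\<^sub>M N) \<Longrightarrow> g \<in> borel_measurable (unit_measure \<Otimes>\<^sub>M N)"
proof -
  assume g: "g \<in> borel_measurable (borel \<Otimes>\<^sub>M N)"
  have [measurable]: "(\<lambda>x. x) \<in> measurable unit_measure borel"
    by (rule measurable_restrict_space1) simp
  have "(\<lambda>p. (fst p, snd p)) \<in> measurable (unit_measure \<Otimes>\<^sub>M N) (borel \<Otimes>\<^sub>M N)"
    by (intro measurable_Pair measurable_compose[OF measurable_fst]) auto
  from measurable_compose[OF this g] show ?thesis by simp
qed

locale kernel_noise = gaussian_white_noise M W + kernel K
  for M :: "'w measure" and W :: "'w \<Rightarrow> observation" and K :: "real \<Rightarrow> real" +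
  fixes \<sigma> :: real
  assumes sigma_pos: "\<sigma> > 0"
begin

sublocale P: pair_prob_space unit_measure M ..

text \<open>The kernel estimator as a function of time and sample point jointly; \<open>b\<close>
  stands for the noise level \<sigma> / sqrt n.\<close>

definition path :: "(real \<Rightarrow> real) \<Rightarrow> real \<Rightarrow> real \<Rightarrow> real \<times> 'w \<Rightarrow> real" where
  "path f h b = (\<lambda>(t, \<omega>). (L2_inner f (per h t) + b * W \<omega> (per h t)) / h)"

definition trunc_path :: "(real \<Rightarrow> real) \<Rightarrow> real \<Rightarrow> real \<Rightarrow> nat \<Rightarrow> real \<times> 'w \<Rightarrow> real" where
  "trunc_path f h b N = (\<lambda>(t, \<omega>). \<Sum>j\<in>low (real N). (Khat (of_int j * h) * (hartley f j + b * \<xi> j \<omega>)) * cas j t)"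

definition trunc_norm :: "(real \<Rightarrow> real) \<Rightarrow> real \<Rightarrow> real \<Rightarrow> nat \<Rightarrow> 'w \<Rightarrow> real" where
  "trunc_norm f h b N \<omega> = (\<Sum>j\<in>low (real N). (Khat (of_int j * h))\<^sup>2 * (hartley f j + b * \<xi> j \<omega>)\<^sup>2)"

definition path_norm :: "(real \<Rightarrow> real) \<Rightarrow> real \<Rightarrow> real \<Rightarrow> 'w \<Rightarrow> real" where
  "path_norm f h b \<omega> = (\<integral>t. (path f h b (t, \<omega>))\<^sup>2 \<partial>unit_measure)"

lemma trunc_path_norm: "(\<integral>t. (trunc_path f h b N (t, \<omega>))\<^sup>2 \<partial>unit_measure) = trunc_norm f h b N \<omega>"
  unfolding trunc_path_def trunc_norm_def
  using orthonormal_norm[OF finite_low[of "real N"] cas_sqint cas_orthonormal, where a="\<lambda>j. Khat (of_int j * h) * (hartley f j + b * \<xi> j \<omega>)"]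
  by (simp add: power_mult_distrib)

lemma path_measurable:
  assumes f: "f \<in> L2_per" and h: "h > 0"
  shows "path f h b \<in> borel_measurable (unit_measure \<Otimes>\<^sub>M M)"
proof (rule measurable_unit_pair)
  have [measurable]: "(\<lambda>(t, \<omega>). W \<omega> (per h t)) \<in> borel_measurable (borel \<Otimes>\<^sub>M M)"
    by (rule measurable_process[OF measurable_per[OF h] per_L2_per[OF h]])
  have fm: "f \<in> borel_measurable borel" using f by (simp add: L2_per_iff)
  have m: "(\<lambda>t. L2_inner f (per h t)) \<in> borel_measurable borel"
    unfolding L2_inner_unit
  proof (rule unit.borel_measurable_lebesgue_integral)
    have id [measurable]: "(\<lambda>x. x) \<in> measurable unit_measure borel"
      by (rule measurable_restrict_space1) simp
    have "(\<lambda>p. (fst p, snd p)) \<in> measurable (borel \<Otimes>\<^sub>M unit_measure) (borel \<Otimes>\<^sub>M borel)"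
      by (intro measurable_Pair measurable_compose[OF measurable_snd]) auto
    moreover have "(\<lambda>(t, u). f u * per h t u) \<in> borel_measurable (borel \<Otimes>\<^sub>M borel)"
      using fm measurable_per[OF h] by measurable
    ultimately have "(\<lambda>p. (\<lambda>(t, u). f u * per h t u) (fst p, snd p)) \<in> borel_measurable (borel \<Otimes>\<^sub>M unit_measure)"
      by (rule measurable_compose)
    then show "(\<lambda>(t, u). f u * per h t u) \<in> borel_measurable (borel \<Otimes>\<^sub>M unit_measure)" by simp
  qed
  then have [measurable]: "(\<lambda>p. L2_inner f (per h (fst p))) \<in> borel_measurable (borel \<Otimes>\<^sub>M M)"
    by measurable
  have "(\<lambda>p. (L2_inner f (per h (fst p)) + b * (case p of (t, \<omega>) \<Rightarrow> W \<omega> (per h t))) / h) \<in> borel_measurable (borel \<Otimes>\<^sub>M M)"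
    by measurable
  then show "path f h b \<in> borel_measurable (borel \<Otimes>\<^sub>M M)"
    by (simp add: path_def case_prod_beta')
qed

lemma trunc_path_measurable: "trunc_path f h b N \<in> borel_measurable (unit_measure \<Otimes>\<^sub>M M)"
  by (rule measurable_unit_pair) (unfold trunc_path_def, measurable)

lemma snd_sqint:
  assumes u: "u \<in> sqint M" shows "(\<lambda>p. u (snd p)) \<in> sqint (unit_measure \<Otimes>\<^sub>M M)"
proof -
  have [measurable]: "u \<in> borel_measurable M" by (rule sqint_measurable[OF u])
  have "integrable (unit_measure \<Otimes>\<^sub>M M) (\<lambda>p. (u (snd p))\<^sup>2)"
    by (rule P.Fubini_integrable) (use sqint_integrable_power2[OF u] in auto)
  then show ?thesis by (simp add: sqint_def)
qed

lemma trunc_path_sqint: "trunc_path f h b N \<in> sqint (unit_measure \<Otimes>\<^sub>M M)"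
proof -
  have "(\<lambda>p. \<Sum>j\<in>low (real N). cas j (fst p) * (Khat (of_int j * h) * (hartley f j + b * \<xi> j (snd p)))) \<in> sqint (unit_measure \<Otimes>\<^sub>M M)"
  proof (rule sqint_sum, rule sqint_mult_bounded(1)[where B=2])
    fix j :: int
    show "(\<lambda>p. cas j (fst p)) \<in> borel_measurable (unit_measure \<Otimes>\<^sub>M M)"
      by (rule measurable_unit_pair) measurable
    have "(\<lambda>_. hartley f j) \<in> sqint M" by (simp add: sqint_def)
    then have "(\<lambda>\<omega>. Khat (of_int j * h) * (hartley f j + b * \<xi> j \<omega>)) \<in> sqint M"
      by (intro sqint_cmult sqint_add \<xi>_sqint)
    from snd_sqint[OF this]
    show "(\<lambda>p. Khat (of_int j * h) * (hartley f j + b * \<xi> j (snd p))) \<in> sqint (unit_measure \<Otimes>\<^sub>M M)" .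
  qed (rule abs_cas_le)
  then show ?thesis by (simp add: trunc_path_def case_prod_beta' mult.commute)
qed

text \<open>The squared distance of \<open>per h t\<close> from its truncation; it governs the
  truncation error at time \<open>t\<close>.\<close>

definition gap :: "real \<Rightarrow> nat \<Rightarrow> real \<Rightarrow> real" where
  "gap h N t = (L2_norm (per h t))\<^sup>2 - low_energy (per h t) (real N)"

lemma gap_nonneg: "h > 0 \<Longrightarrow> gap h N t \<ge> 0"
  by (simp add: gap_def low_energy_le_norm per_L2_per)

text \<open>At a fixed \<open>t\<close> the error is the observation applied to
  \<open>per h t\<close> minus its truncation: a deterministic part bounded by Cauchy-Schwarz and a
  Gaussian part of known variance. Linearity of the noise is invoked only at this single
  \<open>t\<close>, where a null set is harmless.\<close>

lemma path_gap:
  assumes f: "f \<in> L2_per" and h: "h > 0"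
  shows "(\<lambda>\<omega>. path f h b (t, \<omega>) - trunc_path f h b N (t, \<omega>)) \<in> sqint M"
    and "(\<integral>\<omega>. (path f h b (t, \<omega>) - trunc_path f h b N (t, \<omega>))\<^sup>2 \<partial>M) \<le> 2 * ((L2_norm f)\<^sup>2 + b\<^sup>2) / h\<^sup>2 * gap h N t"
proof -
  let ?g = "per h t" and ?p = "proj (real N) (per h t)"
  note g = per_L2_per[OF h, of t]
  have d: "(\<lambda>u. ?g u - ?p u) \<in> L2_per" by (intro L2_per_diff g proj_L2_per)
  have nd: "(L2_norm (\<lambda>u. ?g u - ?p u))\<^sup>2 = gap h N t"
    unfolding gap_def by (rule L2_norm_diff_proj[OF g])
  define x where "x = L2_inner f (\<lambda>u. ?g u - ?p u) / h"
  have x2: "x\<^sup>2 \<le> (L2_norm f)\<^sup>2 * gap h N t / h\<^sup>2"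
  proof -
    have "(L2_inner f (\<lambda>u. ?g u - ?p u))\<^sup>2 \<le> (L2_norm f * L2_norm (\<lambda>u. ?g u - ?p u))\<^sup>2"
      using L2_Cauchy_Schwarz[OF f d] by (simp add: abs_le_square_iff[symmetric] abs_mult L2_norm_nonneg)
    then show ?thesis by (simp add: x_def power_divide power_mult_distrib nd divide_right_mono)
  qed
  define u where "u \<omega> = (b / h) * W \<omega> (\<lambda>u. ?g u - ?p u)" for \<omega>
  have us: "u \<in> sqint M" unfolding u_def by (intro sqint_cmult W_second_moment d)
  have u2: "(\<integral>\<omega>. (u \<omega>)\<^sup>2 \<partial>M) = b\<^sup>2 / h\<^sup>2 * gap h N t"
    using W_second_moment(2)[OF d] by (simp add: u_def power_mult_distrib power_divide nd)
  have xs: "(\<lambda>_. x) \<in> sqint M" by (simp add: sqint_def)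
  have H: "hartley ?g j = h * (Khat (of_int j * h) * cas j t)" for j
    using hartley_per[OF h, of t j] by (simp add: mult.assoc)
  have "AE \<omega> in M. W \<omega> (\<lambda>u. 1 * ?g u + (-1) * ?p u) = 1 * W \<omega> ?g + (-1) * W \<omega> ?p"
    by (rule linear[OF g proj_L2_per])
  moreover have "AE \<omega> in M. W \<omega> ?p = (\<Sum>j\<in>low (real N). hartley ?g j * \<xi> j \<omega>)"
    using W_trig(1)[where c="real N" and a="hartley ?g"] by (simp add: proj_def[abs_def])
  ultimately have ae: "AE \<omega> in M. path f h b (t, \<omega>) - trunc_path f h b N (t, \<omega>) = x + u \<omega>"
  proof eventually_elim
    case (elim \<omega>)
    have a: "L2_inner f ?p / h = (\<Sum>j\<in>low (real N). Khat (of_int j * h) * hartley f j * cas j t)"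
      using h unfolding inner_proj[OF f] H by (simp add: sum_divide_distrib mult_ac)
    have c: "W \<omega> ?p / h = (\<Sum>j\<in>low (real N). Khat (of_int j * h) * \<xi> j \<omega> * cas j t)"
      using h unfolding elim(2) H by (simp add: sum_divide_distrib mult_ac)
    have "trunc_path f h b N (t, \<omega>) = L2_inner f ?p / h + b * (W \<omega> ?p / h)"
      unfolding a c trunc_path_def by (simp add: algebra_simps sum.distrib sum_distrib_left)
    moreover have Wg: "W \<omega> ?g = W \<omega> ?p + W \<omega> (\<lambda>u. ?g u - ?p u)" using elim(1) by simp
    ultimately show ?case
      unfolding x_def u_def L2_inner_diff_right[OF f g proj_L2_per] path_def
      by (simp add: Wg diff_divide_distrib add_divide_distrib distrib_left)
  qed
  have [measurable]: "(\<lambda>\<omega>. path f h b (t, \<omega>)) \<in> borel_measurable M"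
    using measurable_W[OF g] by (simp add: path_def)
  have [measurable]: "(\<lambda>\<omega>. trunc_path f h b N (t, \<omega>)) \<in> borel_measurable M"
    unfolding trunc_path_def by simp
  have [measurable]: "u \<in> borel_measurable M" by (rule sqint_measurable[OF us])
  have ae2: "AE \<omega> in M. (path f h b (t, \<omega>) - trunc_path f h b N (t, \<omega>))\<^sup>2 = (x + u \<omega>)\<^sup>2"
    using ae by eventually_elim simp
  have "integrable M (\<lambda>\<omega>. (path f h b (t, \<omega>) - trunc_path f h b N (t, \<omega>))\<^sup>2)"
    by (subst integrable_cong_AE[OF _ _ ae2]) (use sqint_integrable_power2[OF sqint_add[OF xs us]] in auto)
  then show "(\<lambda>\<omega>. path f h b (t, \<omega>) - trunc_path f h b N (t, \<omega>)) \<in> sqint M"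
    by (simp add: sqint_def)
  have "(\<integral>\<omega>. (path f h b (t, \<omega>) - trunc_path f h b N (t, \<omega>))\<^sup>2 \<partial>M) = (\<integral>\<omega>. (x + u \<omega>)\<^sup>2 \<partial>M)"
    by (rule integral_cong_AE[OF _ _ ae2]) auto
  also have "\<dots> \<le> 2 * (\<integral>\<omega>. x\<^sup>2 \<partial>M) + 2 * (\<integral>\<omega>. (u \<omega>)\<^sup>2 \<partial>M)"
    by (rule sqint_add_bound[OF xs us])
  also have "\<dots> \<le> 2 * ((L2_norm f)\<^sup>2 * gap h N t / h\<^sup>2) + 2 * (b\<^sup>2 / h\<^sup>2 * gap h N t)"
    using x2 u2 by (simp add: prob_space)
  also have "\<dots> = 2 * ((L2_norm f)\<^sup>2 + b\<^sup>2) / h\<^sup>2 * gap h N t"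
    by (simp add: add_divide_distrib algebra_simps)
  finally show "(\<integral>\<omega>. (path f h b (t, \<omega>) - trunc_path f h b N (t, \<omega>))\<^sup>2 \<partial>M) \<le> 2 * ((L2_norm f)\<^sup>2 + b\<^sup>2) / h\<^sup>2 * gap h N t" .
qed

lemma gap_measurable:
  assumes h: "h > 0" shows "gap h N \<in> borel_measurable borel"
proof -
  have "(\<lambda>t. \<integral>u. (per h t u)\<^sup>2 \<partial>unit_measure) \<in> borel_measurable borel"
  proof (rule unit.borel_measurable_lebesgue_integral)
    have id [measurable]: "(\<lambda>x. x) \<in> measurable unit_measure borel"
      by (rule measurable_restrict_space1) simp
    have "(\<lambda>p. (fst p, snd p)) \<in> measurable (borel \<Otimes>\<^sub>M unit_measure) (borel \<Otimes>\<^sub>M borel)"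
      by (intro measurable_Pair measurable_compose[OF measurable_snd]) auto
    moreover have "(\<lambda>(t, u). (per h t u)\<^sup>2) \<in> borel_measurable (borel \<Otimes>\<^sub>M borel)"
      using measurable_per[OF h] by measurable
    ultimately have "(\<lambda>p. (\<lambda>(t, u). (per h t u)\<^sup>2) (fst p, snd p)) \<in> borel_measurable (borel \<Otimes>\<^sub>M unit_measure)"
      by (rule measurable_compose)
    then show "(\<lambda>(t, u). (per h t u)\<^sup>2) \<in> borel_measurable (borel \<Otimes>\<^sub>M unit_measure)" by simp
  qed
  then show ?thesis
    unfolding gap_def[abs_def] L2_norm_power2 low_energy_def hartley_per[OF h] by measurable
qed

text \<open>Parseval gives the limit at each \<open>t\<close>, and \<open>per_norm\<close> gives the
  dominating constant.\<close>

lemma gap_integral_limit: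
  assumes h: "h > 0" "h < 1 / 2"
  shows "(\<lambda>N. \<integral>t. gap h N t \<partial>unit_measure) \<longlonglongrightarrow> 0"
    and "integrable unit_measure (gap h N)"
proof -
  have b: "norm (gap h N t) \<le> h * (mass * bnd)" for N t
    using gap_nonneg[OF h(1), of N t] per_norm[OF h, of t] low_energy_nonneg[of "per h t" "real N"]
    by (simp add: gap_def)
  show "integrable unit_measure (gap h N)"
    by (rule unit.integrable_const_bound[where B="h * (mass * bnd)"])
       (use b in \<open>auto intro: unit_measurable gap_measurable h\<close>)
  have "(\<lambda>N. \<integral>t. gap h N t \<partial>unit_measure) \<longlonglongrightarrow> (\<integral>t. 0 \<partial>unit_measure)"
  proof (rule integral_dominated_convergence[where w="\<lambda>_. h * (mass * bnd)"])
    show "AE t in unit_measure. (\<lambda>N. gap h N t) \<longlonglongrightarrow> 0"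
    proof (rule AE_I2)
      fix t
      have "(\<lambda>N. gap h N t) \<longlonglongrightarrow> (L2_norm (per h t))\<^sup>2 - (L2_norm (per h t))\<^sup>2"
        unfolding gap_def by (intro tendsto_intros Parseval_limit per_L2_per h)
      then show "(\<lambda>N. gap h N t) \<longlonglongrightarrow> 0" by simp
    qed
  qed (use b in \<open>auto intro: unit_measurable gap_measurable h\<close>)
  then show "(\<lambda>N. \<integral>t. gap h N t \<partial>unit_measure) \<longlonglongrightarrow> 0" by simp
qed

text \<open>The mean-square bound of \<open>path_gap\<close> is integrated over \<open>t\<close>, so
  the exceptional null sets, which vary with \<open>t\<close>, never have to be united.\<close>

lemma path_norm_truncation:
  assumes f: "f \<in> L2_per" and h: "h > 0" "h < 1 / 2"
  shows "(\<lambda>N. \<integral>\<omega>. \<bar>path_norm f h b \<omega> - trunc_norm f h b N \<omega>\<bar> \<partial>M) \<longlonglongrightarrow> 0"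
    and "integrable M (path_norm f h b)"
    and "integrable M (trunc_norm f h b N)"
proof -
  let ?P = "unit_measure \<Otimes>\<^sub>M M"
  define C where "C = 2 * ((L2_norm f)\<^sup>2 + b\<^sup>2) / h\<^sup>2"
  define d where "d N p = path f h b p - trunc_path f h b N p" for N p
  have dm: "d N \<in> borel_measurable ?P" for N
    unfolding d_def[abs_def] using path_measurable[OF f h(1)] trunc_path_measurable by measurable
  have dle: "(\<integral>\<omega>. (d N (t, \<omega>))\<^sup>2 \<partial>M) \<le> C * gap h N t" for N t
    unfolding d_def C_def by (rule path_gap(2)[OF f h(1)])
  have rm: "(\<lambda>t. \<integral>\<omega>. (d N (t, \<omega>))\<^sup>2 \<partial>M) \<in> borel_measurable unit_measure" for N
    by (rule borel_measurable_lebesgue_integral) (use dm[of N] in measurable)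
  have ri: "integrable unit_measure (\<lambda>t. \<integral>\<omega>. (d N (t, \<omega>))\<^sup>2 \<partial>M)" for N
  proof (rule Bochner_Integration.integrable_bound[OF integrable_mult_right[OF gap_integral_limit(2)[OF h], of C]])
    show "AE t in unit_measure. norm (\<integral>\<omega>. (d N (t, \<omega>))\<^sup>2 \<partial>M) \<le> norm (C * gap h N t)"
    proof (rule AE_I2)
      fix t
      have "0 \<le> (\<integral>\<omega>. (d N (t, \<omega>))\<^sup>2 \<partial>M)" by simp
      with dle[of N t] show "norm (\<integral>\<omega>. (d N (t, \<omega>))\<^sup>2 \<partial>M) \<le> norm (C * gap h N t)" by simp
    qed
  qed (rule rm)
  have d2i: "integrable ?P (\<lambda>p. (d N p)\<^sup>2)" for N
  proof (rule P.Fubini_integrable)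
    show "(\<lambda>p. (d N p)\<^sup>2) \<in> borel_measurable ?P" using dm by measurable
    show "integrable unit_measure (\<lambda>t. \<integral>\<omega>. norm ((d N (t, \<omega>))\<^sup>2) \<partial>M)" using ri by simp
    show "AE t in unit_measure. integrable M (\<lambda>\<omega>. (d N (t, \<omega>))\<^sup>2)"
      unfolding d_def by (intro AE_I2 sqint_integrable_power2 path_gap f h)
  qed
  have ds: "d N \<in> sqint ?P" for N using dm d2i by (simp add: sqint_def)
  \<comment> \<open>The path is the error at truncation level 0 plus the truncated path, both square
    integrable.\<close>
  have ps: "path f h b \<in> sqint ?P"
    using sqint_add[OF ds trunc_path_sqint, of 0 f h b 0] by (simp add: d_def)
  have lim: "(\<lambda>N. \<integral>p. (path f h b p - trunc_path f h b N p)\<^sup>2 \<partial>?P) \<longlonglongrightarrow> 0"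
  proof (rule tendsto_sandwich[OF _ _ tendsto_const])
    show "eventually (\<lambda>N. (\<integral>p. (path f h b p - trunc_path f h b N p)\<^sup>2 \<partial>?P) \<le> C * (\<integral>t. gap h N t \<partial>unit_measure)) sequentially"
    proof (rule always_eventually, rule allI)
      fix N
      have "(\<integral>p. (d N p)\<^sup>2 \<partial>?P) = (\<integral>t. (\<integral>\<omega>. (d N (t, \<omega>))\<^sup>2 \<partial>M) \<partial>unit_measure)"
        using P.integral_fst'[OF d2i] by simp
      also have "\<dots> \<le> (\<integral>t. C * gap h N t \<partial>unit_measure)"
        by (intro integral_mono ri dle integrable_mult_right gap_integral_limit h)
      finally show "(\<integral>p. (path f h b p - trunc_path f h b N p)\<^sup>2 \<partial>?P) \<le> C * (\<integral>t. gap h N t \<partial>unit_measure)"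
        by (simp add: d_def)
    qed
    have "(\<lambda>N. C * (\<integral>t. gap h N t \<partial>unit_measure)) \<longlonglongrightarrow> C * 0"
      by (intro tendsto_intros gap_integral_limit h)
    then show "(\<lambda>N. C * (\<integral>t. gap h N t \<partial>unit_measure)) \<longlonglongrightarrow> 0" by simp
  qed simp
  from P.path_norm_limit[OF ps trunc_path_sqint lim]
  show "(\<lambda>N. \<integral>\<omega>. \<bar>path_norm f h b \<omega> - trunc_norm f h b N \<omega>\<bar> \<partial>M) \<longlonglongrightarrow> 0"
    "integrable M (path_norm f h b)" "integrable M (trunc_norm f h b N)"
    by (simp_all add: path_norm_def[abs_def] trunc_path_norm)
qed

section \<open>The statistic as an affine function of the squared path norm\<close>

definition scaling :: "nat \<Rightarrow> real \<Rightarrow> real" where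
  "scaling n h = real n * sqrt h / (\<sigma>\<^sup>2 * kernel_kappa K)"

definition centering :: "nat \<Rightarrow> real \<Rightarrow> real" where
  "centering n h = scaling n h * (\<sigma>\<^sup>2 / (real n * h) * (\<integral>t. (K t)\<^sup>2 \<partial>lborel))"

definition stat :: "nat \<Rightarrow> real \<Rightarrow> (real \<Rightarrow> real) \<Rightarrow> 'w \<Rightarrow> real" where
  "stat n h f \<omega> = kernel_statistic K \<sigma> n h (observe W \<sigma> n f \<omega>)"

lemma stat_eq: "stat n h f \<omega> = scaling n h * path_norm f h (\<sigma> / sqrt (real n)) \<omega> - centering n h"
proof -
  have "kernel_estimator K h (observe W \<sigma> n f \<omega>) t = path f h (\<sigma> / sqrt (real n)) (t, \<omega>)" for t
    by (simp add: kernel_estimator_def line_integral_def observe_def path_def per_def[abs_def])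
  then have "(LINT t:{0<..<1}|lborel. (kernel_estimator K h (observe W \<sigma> n f \<omega>) t)\<^sup>2)
    = (LINT t:{0<..<1}|lborel. (path f h (\<sigma> / sqrt (real n)) (t, \<omega>))\<^sup>2)" by simp
  \<comment> \<open>The open interval in the statistic and [0, 1) differ by the point 0.\<close>
  also have "\<dots> = path_norm f h (\<sigma> / sqrt (real n)) \<omega>"
    unfolding path_norm_def unit_integral
    by (rule set_integral_discrete_difference[of "{0}"]) auto
  finally show ?thesis
    by (simp add: stat_def kernel_statistic_def scaling_def centering_def right_diff_distrib)
qed

end

subsection \<open>Error probabilities for a fixed sample size\<close>

lemma card_low_ge: "x \<ge> 0 \<Longrightarrow> real (card (low x)) \<ge> x"
proof -
  assume "x \<ge> 0"
  have "{-\<lfloor>x\<rfloor>..\<lfloor>x\<rfloor>} \<subseteq> low x"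
  proof
    fix j assume "j \<in> {-\<lfloor>x\<rfloor>..\<lfloor>x\<rfloor>}"
    then have "\<bar>j\<bar> \<le> \<lfloor>x\<rfloor>" by auto
    then have "real_of_int \<bar>j\<bar> \<le> x" by linarith
    then show "j \<in> low x" by simp
  qed
  then have "card {-\<lfloor>x\<rfloor>..\<lfloor>x\<rfloor>} \<le> card (low x)" by (intro card_mono) auto
  moreover have "real (card {-\<lfloor>x\<rfloor>..\<lfloor>x\<rfloor>}) \<ge> x"
  proof -
    have f0: "\<lfloor>x\<rfloor> \<ge> 0" using \<open>x \<ge> 0\<close> by simp
    then have "real (card {-\<lfloor>x\<rfloor>..\<lfloor>x\<rfloor>}) = 2 * real_of_int \<lfloor>x\<rfloor> + 1" by simp
    moreover have "x < real_of_int \<lfloor>x\<rfloor> + 1" "0 \<le> real_of_int \<lfloor>x\<rfloor>" using f0 by (linarith, simp only: of_int_0_le_iff)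
    ultimately show ?thesis by linarith
  qed
  ultimately show ?thesis by linarith
qed

context kernel_noise
begin

abbreviation \<kappa> :: real where "\<kappa> \<equiv> kernel_kappa K"

definition trunc_stat :: "nat \<Rightarrow> real \<Rightarrow> (real \<Rightarrow> real) \<Rightarrow> nat \<Rightarrow> 'w \<Rightarrow> real" where
  "trunc_stat n h f N \<omega> = scaling n h * trunc_norm f h (\<sigma> / sqrt (real n)) N \<omega> - centering n h"

text \<open>The limit exists because the partial sums increase and stay below a multiple of the
  squared norm, see \<open>signal_limit\<close>.\<close>

definition signal :: "real \<Rightarrow> (real \<Rightarrow> real) \<Rightarrow> real" where
  "signal h f = lim (\<lambda>N::nat. \<Sum>j\<in>low (real N). (Khat (of_int j * h))\<^sup>2 * (hartley f j)\<^sup>2)"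

lemma scaling_pos: "n \<ge> 1 \<Longrightarrow> h > 0 \<Longrightarrow> scaling n h > 0"
  using kappa_pos sigma_pos by (simp add: scaling_def)

text \<open>The variance \<sigma>^2 / n of one noise coordinate and the normalization combine to
  sqrt h / \<kappa>; squared and summed over about 1 / h frequencies this is of order 1.\<close>

lemma scaling_noise: "n \<ge> 1 \<Longrightarrow> scaling n h * (\<sigma> / sqrt (real n))\<^sup>2 = sqrt h / \<kappa>"
  using sigma_pos by (simp add: scaling_def power_divide)

lemma partial_signal_le:
  "(\<Sum>j\<in>low c. (Khat (of_int j * h))\<^sup>2 * (hartley f j)\<^sup>2) \<le> mass\<^sup>2 * low_energy f c"
  unfolding low_energy_def sum_distrib_left
  using Khat_le_mass by (intro sum_mono mult_right_mono) (simp_all add: abs_le_square_iff[symmetric] abs_of_nonneg[OF order_trans[OF zero_le_one mass_ge_1]])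

lemma signal_limit:
  assumes f: "f \<in> L2_per"
  shows "(\<lambda>N::nat. \<Sum>j\<in>low (real N). (Khat (of_int j * h))\<^sup>2 * (hartley f j)\<^sup>2) \<longlonglongrightarrow> signal h f" (is "?s \<longlonglongrightarrow> _")
    and "(\<Sum>j\<in>low (real N). (Khat (of_int j * h))\<^sup>2 * (hartley f j)\<^sup>2) \<le> signal h f"
proof -
  have mono: "incseq ?s" by (intro monoI sum_mono2 low_mono) auto
  have le: "?s N \<le> mass\<^sup>2 * (L2_norm f)\<^sup>2" for N
    by (rule order_trans[OF partial_signal_le mult_left_mono[OF low_energy_le_norm[OF f]]]) simp
  obtain L where L: "?s \<longlonglongrightarrow> L"
    using incseq_convergent[OF mono, of "mass\<^sup>2 * (L2_norm f)\<^sup>2"] le by blast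
  then show lim: "?s \<longlonglongrightarrow> signal h f" unfolding signal_def by (simp add: limI)
  show "?s N \<le> signal h f" by (rule incseq_le[OF mono lim])
qed

lemma signal_nonneg: "f \<in> L2_per \<Longrightarrow> signal h f \<ge> 0"
  by (rule order_trans[OF _ signal_limit(2)]) (auto intro: sum_nonneg)

text \<open>On the frequencies below \<open>cutoff / h\<close> the multiplier is at least 1/2, so
  its square loses at most a factor 4.\<close>

lemma signal_ge:
  assumes f: "f \<in> L2_per" and h: "h > 0"
  shows "signal h f \<ge> low_energy f (cutoff / h) / 4"
proof -
  obtain N :: nat where N: "cutoff / h \<le> real N" using real_arch_simple by blast
  have "low_energy f (cutoff / h) / 4 = (\<Sum>j\<in>low (cutoff / h). (1 / 2)\<^sup>2 * (hartley f j)\<^sup>2)"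
    by (simp add: low_energy_def sum_divide_distrib power_divide)
  also have "\<dots> \<le> (\<Sum>j\<in>low (cutoff / h). (Khat (of_int j * h))\<^sup>2 * (hartley f j)\<^sup>2)"
  proof (intro sum_mono mult_right_mono power_mono)
    fix j assume "j \<in> low (cutoff / h)"
    then have "\<bar>of_int j * h\<bar> \<le> cutoff" using h by (simp add: abs_mult field_simps)
    then show "1 / 2 \<le> Khat (of_int j * h)" by (rule Khat_ge_half)
  qed auto
  also have "\<dots> \<le> (\<Sum>j\<in>low (real N). (Khat (of_int j * h))\<^sup>2 * (hartley f j)\<^sup>2)"
    by (intro sum_mono2 low_mono N) auto
  also have "\<dots> \<le> signal h f" by (rule signal_limit(2)[OF f])
  finally show ?thesis .
qed

text \<open>Counterpart of \<open>signal_ge\<close>: below \<open>w / h\<close> the multiplier is at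
  most \<open>mass\<close>, and beyond it the decay of the transform leaves at most the fraction
  \<open>e\<^sup>2\<close> of the energy.\<close>

lemma signal_le:
  assumes f: "f \<in> L2_per" and h: "h > 0" and e: "\<And>x. \<bar>x\<bar> \<ge> w \<Longrightarrow> \<bar>Khat x\<bar> \<le> e"
  shows "signal h f \<le> mass\<^sup>2 * low_energy f (w / h) + e\<^sup>2 * (L2_norm f)\<^sup>2"
proof (rule LIMSEQ_le_const2[OF signal_limit(1)[OF f]], intro exI allI impI)
  fix N :: nat
  let ?t = "\<lambda>j. (Khat (of_int j * h))\<^sup>2 * (hartley f j)\<^sup>2"
  have "(\<Sum>j\<in>low (real N). ?t j) \<le> (\<Sum>j\<in>low (w / h) \<union> (low (real N) - low (w / h)). ?t j)"
    by (intro sum_mono2) auto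
  also have "\<dots> = (\<Sum>j\<in>low (w / h). ?t j) + (\<Sum>j\<in>low (real N) - low (w / h). ?t j)"
    by (intro sum.union_disjoint) auto
  also have "(\<Sum>j\<in>low (real N) - low (w / h). ?t j) \<le> (\<Sum>j\<in>low (real N) - low (w / h). e\<^sup>2 * (hartley f j)\<^sup>2)"
  proof (intro sum_mono mult_right_mono)
    fix j assume "j \<in> low (real N) - low (w / h)"
    then have "\<bar>of_int j * h\<bar> \<ge> w" using h by (simp add: abs_mult field_simps)
    then have "\<bar>Khat (of_int j * h)\<bar> \<le> \<bar>e\<bar>" using e by force
    then show "(Khat (of_int j * h))\<^sup>2 \<le> e\<^sup>2" by (simp only: abs_le_square_iff)
  qed auto
  also have "\<dots> \<le> (\<Sum>j\<in>low (real N). e\<^sup>2 * (hartley f j)\<^sup>2)"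
    by (intro sum_mono2) auto
  also have "\<dots> = e\<^sup>2 * low_energy f (real N)" by (simp add: low_energy_def sum_distrib_left)
  also have "\<dots> \<le> e\<^sup>2 * (L2_norm f)\<^sup>2" by (intro mult_left_mono low_energy_le_norm f) auto
  finally show "(\<Sum>j\<in>low (real N). ?t j) \<le> mass\<^sup>2 * low_energy f (w / h) + e\<^sup>2 * (L2_norm f)\<^sup>2"
    using partial_signal_le[of h f "w / h"] by linarith
qed

lemma stat_limit:
  assumes f: "f \<in> L2_per" and h: "h > 0" "h < 1 / 2" and n: "n \<ge> 1"
  shows "(\<lambda>N. \<integral>\<omega>. \<bar>stat n h f \<omega> - trunc_stat n h f N \<omega>\<bar> \<partial>M) \<longlonglongrightarrow> 0"
    and "integrable M (stat n h f)" and "integrable M (trunc_stat n h f N)"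
proof -
  let ?b = "\<sigma> / sqrt (real n)"
  have "\<bar>stat n h f \<omega> - trunc_stat n h f N \<omega>\<bar> = scaling n h * \<bar>path_norm f h ?b \<omega> - trunc_norm f h ?b N \<omega>\<bar>" for N \<omega>
  proof -
    have "stat n h f \<omega> - trunc_stat n h f N \<omega> = scaling n h * (path_norm f h ?b \<omega> - trunc_norm f h ?b N \<omega>)"
      by (simp add: stat_eq trunc_stat_def right_diff_distrib)
    then show ?thesis using scaling_pos[OF n h(1)] by (simp add: abs_mult)
  qed
  then have "(\<lambda>N. \<integral>\<omega>. \<bar>stat n h f \<omega> - trunc_stat n h f N \<omega>\<bar> \<partial>M)
    = (\<lambda>N. scaling n h * (\<integral>\<omega>. \<bar>path_norm f h ?b \<omega> - trunc_norm f h ?b N \<omega>\<bar> \<partial>M))"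
    by simp
  moreover have "\<dots> \<longlonglongrightarrow> scaling n h * 0"
    by (intro tendsto_intros path_norm_truncation f h)
  ultimately show "(\<lambda>N. \<integral>\<omega>. \<bar>stat n h f \<omega> - trunc_stat n h f N \<omega>\<bar> \<partial>M) \<longlonglongrightarrow> 0" by simp
  show "integrable M (stat n h f)" "integrable M (trunc_stat n h f N)"
    unfolding stat_eq[abs_def] trunc_stat_def[abs_def] using path_norm_truncation(2,3)[OF f h] by auto
qed

lemma stat_measurable:
  assumes "f \<in> L2_per" "h > 0" "h < 1 / 2" "n \<ge> 1"
  shows "stat n h f \<in> borel_measurable M"
  using stat_limit(2)[OF assms] by simp

abbreviation null :: "real \<Rightarrow> real" where "null \<equiv> \<lambda>_. 0"

lemma hartley_null [simp]: "hartley null j = 0"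
  by (simp add: hartley_def)

lemma trunc_stat_null:
  assumes "n \<ge> 1"
  shows "trunc_stat n h null N \<omega> = (\<Sum>j\<in>low (real N). (sqrt h / \<kappa> * (Khat (of_int j * h))\<^sup>2) * (\<xi> j \<omega>)\<^sup>2) - centering n h"
proof -
  have "scaling n h * ((Khat (of_int j * h))\<^sup>2 * (\<sigma> / sqrt (real n) * \<xi> j \<omega>)\<^sup>2)
    = (sqrt h / \<kappa> * (Khat (of_int j * h))\<^sup>2) * (\<xi> j \<omega>)\<^sup>2" for j
    unfolding scaling_noise[OF assms, symmetric] by (simp only: power_mult_distrib mult_ac)
  then show ?thesis by (simp add: trunc_stat_def trunc_norm_def sum_distrib_left)
qed

text \<open>The bound 1/4 keeps h below 1/2, where translates of the kernel do not overlap; cutoff /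
  4 leaves at least one block of four frequencies below \<open>cutoff / h\<close>.\<close>

definition max_bandwidth :: real where "max_bandwidth = min (1 / 4) (cutoff / 4)"

lemma max_bandwidth_pos: "max_bandwidth > 0"
  using cutoff_pos by (simp add: max_bandwidth_def)

definition conc_const :: real where
  "conc_const = 4 * \<kappa> * sqrt (8 / cutoff) * lorentz_mass"

lemma conc_const_nonneg: "conc_const \<ge> 0"
  using kappa_pos cutoff_pos lorentz_mass_nonneg by (simp add: conc_const_def)

text \<open>Of the order of 1 / h coefficients of the quadratic form are at least \<alpha> = sqrt h
  / (4 \<kappa>), so \<alpha> sqrt k is bounded below uniformly in n and h, and one constant serves
  for all of them.\<close>

lemma trunc_concentration:
  assumes h: "h > 0" "h \<le> max_bandwidth" and n: "n \<ge> 1" and N: "cutoff / h \<le> real N" and \<epsilon>: "\<epsilon> > 0"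
  shows "prob {\<omega> \<in> space M. \<bar>trunc_stat n h null N \<omega> - c\<bar> \<le> \<epsilon>} \<le> conc_const * \<epsilon> / 2"
proof -
  \<comment> \<open>The number of blocks of four; rounding down still leaves at least cutoff / (8
    h), half the unrounded value, because that value is at least 1.\<close>
  define k where "k = nat \<lfloor>cutoff / (4 * h)\<rfloor>"
  have hc: "h \<le> cutoff / 4" using h by (simp add: max_bandwidth_def)
  have c1: "cutoff / (4 * h) \<ge> 1" using hc h by (simp add: field_simps)
  have k1: "k \<ge> 1" using c1 by (simp add: k_def le_nat_iff)
  have kle: "real k \<le> cutoff / (4 * h)" using c1 by (simp add: k_def)
  have kge: "real k \<ge> cutoff / (8 * h)"
  proof -
    have "real k > cutoff / (4 * h) - 1" unfolding k_def by linarith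
    moreover have "real k \<ge> 1" using k1 by simp
    moreover have "cutoff / (4 * h) = 2 * (cutoff / (8 * h))" by simp
    ultimately show ?thesis by linarith
  qed
  have "4 * real k \<le> cutoff / h" using kle by (simp add: field_simps)
  also have "\<dots> \<le> real (card (low (cutoff / h)))"
    using cutoff_pos h by (intro card_low_ge) simp
  finally have card: "4 * k \<le> card (low (cutoff / h))" by linarith
  define \<alpha> where "\<alpha> = sqrt h / (4 * \<kappa>)"
  have \<alpha>: "\<alpha> > 0" using h kappa_pos by (simp add: \<alpha>_def)
  have a: "\<alpha> \<le> sqrt h / \<kappa> * (Khat (of_int j * h))\<^sup>2" if "j \<in> low (cutoff / h)" for j
  proof -
    have "\<bar>of_int j * h\<bar> \<le> cutoff" using h that by (simp add: abs_mult field_simps)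
    then have "(1 / 2)\<^sup>2 \<le> (Khat (of_int j * h))\<^sup>2" by (intro power_mono Khat_ge_half) auto
    then have "sqrt h / \<kappa> * (1 / 2)\<^sup>2 \<le> sqrt h / \<kappa> * (Khat (of_int j * h))\<^sup>2"
      using h kappa_pos by (intro mult_left_mono) auto
    then show ?thesis by (simp add: \<alpha>_def power_divide mult.commute)
  qed
  have "prob {\<omega> \<in> space M. \<bar>(\<Sum>j\<in>low (real N). (sqrt h / \<kappa> * (Khat (of_int j * h))\<^sup>2) * (\<xi> j \<omega>)\<^sup>2) - (c + centering n h)\<bar> \<le> \<epsilon>}
    \<le> \<epsilon> / (2 * \<alpha> * sqrt k) * lorentz_mass"
    by (rule chi_square_combination_concentration[OF finite_low low_mono[OF N] card k1 \<alpha> \<epsilon> \<xi>_indep(1) \<xi>_std_normal a]) auto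
  also have "\<dots> \<le> (2 * \<kappa> * sqrt (8 / cutoff) * \<epsilon>) * lorentz_mass"
  proof (rule mult_right_mono[OF _ lorentz_mass_nonneg])
    have "1 / (sqrt h * sqrt k) \<le> sqrt (8 / cutoff)"
    proof -
      have "cutoff / 8 \<le> h * real k" using kge h by (simp add: field_simps)
      then have "sqrt (cutoff / 8) \<le> sqrt h * sqrt k" by (simp flip: real_sqrt_mult)
      then have "1 / (sqrt h * sqrt k) \<le> 1 / sqrt (cutoff / 8)"
        using cutoff_pos h k1 by (intro divide_left_mono) auto
      also have "\<dots> = sqrt (8 / cutoff)" by (simp add: real_sqrt_divide)
      finally show ?thesis .
    qed
    then have "(2 * \<kappa> * \<epsilon>) * (1 / (sqrt h * sqrt k)) \<le> (2 * \<kappa> * \<epsilon>) * sqrt (8 / cutoff)"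
      using kappa_pos \<epsilon> by (intro mult_left_mono) auto
    moreover have "\<epsilon> / (2 * \<alpha> * sqrt k) = (2 * \<kappa> * \<epsilon>) * (1 / (sqrt h * sqrt k))"
      using kappa_pos by (simp add: \<alpha>_def)
    ultimately show "\<epsilon> / (2 * \<alpha> * sqrt k) \<le> 2 * \<kappa> * sqrt (8 / cutoff) * \<epsilon>" by (simp add: mult_ac)
  qed
  also have "\<dots> = conc_const * \<epsilon> / 2" by (simp add: conc_const_def)
  finally show ?thesis by (simp add: trunc_stat_null[OF n] algebra_simps)
qed

lemma max_bandwidth_half: "h \<le> max_bandwidth \<Longrightarrow> h < 1 / 2"
  by (simp add: max_bandwidth_def)

text \<open>The window is doubled when passing to the limit in N, which is why the truncated bound
  carries half the constant.\<close>

lemma stat_concentration: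
  assumes h: "h > 0" "h \<le> max_bandwidth" and n: "n \<ge> 1" and \<epsilon>: "\<epsilon> > 0"
  shows "prob {\<omega> \<in> space M. \<bar>stat n h null \<omega> - c\<bar> \<le> \<epsilon>} \<le> conc_const * \<epsilon>"
proof -
  note lim = stat_limit[OF zero_L2_per h(1) max_bandwidth_half[OF h(2)] n]
  obtain N0 :: nat where N0: "cutoff / h \<le> real N0" using real_arch_simple by blast
  have "prob {\<omega> \<in> space M. stat n h null \<omega> \<in> {x. \<bar>x - c\<bar> \<le> \<epsilon>}} \<le> conc_const * \<epsilon>"
  proof (rule prob_le_of_limit[OF lim(2,3,1), where S'="{x. \<bar>x - c\<bar> \<le> 2 * \<epsilon>}" and \<eta>=\<epsilon>])
    show "eventually (\<lambda>N. prob {\<omega> \<in> space M. trunc_stat n h null N \<omega> \<in> {x. \<bar>x - c\<bar> \<le> 2 * \<epsilon>}} \<le> conc_const * \<epsilon>) sequentially"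
      unfolding eventually_sequentially
    proof (intro exI allI impI)
      fix N assume "N \<ge> N0"
      then have "cutoff / h \<le> real N" using N0 by linarith
      from trunc_concentration[OF h n this, of "2 * \<epsilon>" c]
      show "prob {\<omega> \<in> space M. trunc_stat n h null N \<omega> \<in> {x. \<bar>x - c\<bar> \<le> 2 * \<epsilon>}} \<le> conc_const * \<epsilon>"
        using \<epsilon> by simp
    qed
  qed (use \<epsilon> in auto)
  then show ?thesis by simp
qed

text \<open>Equals 2 (r + 1), where r^2 exceeds four times the variance bound of the truncated null
  statistic and the 1 allows for the truncation error.\<close>

definition spread :: real where
  "spread = 2 * sqrt (8 * mass ^ 3 * bnd / \<kappa>\<^sup>2 + 1) + 2"

lemma spread_pos: "spread > 0"
  using mass_ge_1 bnd(2) by (simp add: spread_def add_nonneg_pos)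

text \<open>Chebyshev's inequality is centred at the actual mean of the truncated form, so the
  location \<open>a\<close> is left unspecified and no asymptotic comparison of that mean with the
  centering enters.\<close>

lemma stat_tight:
  assumes h: "h > 0" "h \<le> max_bandwidth" and n: "n \<ge> 1"
  shows "\<exists>a. prob {\<omega> \<in> space M. a < stat n h null \<omega> \<and> stat n h null \<omega> \<le> a + 2 * spread} \<ge> 1 / 2"
proof -
  note h2 = max_bandwidth_half[OF h(2)]
  note lim = stat_limit[OF zero_L2_per h(1) h2 n]
  have [measurable]: "stat n h null \<in> borel_measurable M" "trunc_stat n h null N \<in> borel_measurable M" for N
    using lim by auto
  define r where "r = sqrt (8 * mass ^ 3 * bnd / \<kappa>\<^sup>2 + 1)"
  define R where "R = 2 * mass ^ 3 * bnd / \<kappa>\<^sup>2"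
  have "R \<ge> 0" using mass_ge_1 bnd(2) by (simp add: R_def)
  have r2: "r\<^sup>2 = 4 * R + 1" "r > 0"
    using \<open>R \<ge> 0\<close> by (simp_all add: r_def R_def)
  \<comment> \<open>A single level N with mean truncation error below 1/4 is fixed; each of the two
    bad events then has probability at most 1/4.\<close>
  have "eventually (\<lambda>N. (\<integral>\<omega>. \<bar>stat n h null \<omega> - trunc_stat n h null N \<omega>\<bar> \<partial>M) < 1 / 4) sequentially"
    by (rule order_tendstoD[OF lim(1)]) simp
  then obtain N where N: "(\<integral>\<omega>. \<bar>stat n h null \<omega> - trunc_stat n h null N \<omega>\<bar> \<partial>M) < 1 / 4"
    by (auto simp: eventually_sequentially)
  have P1: "prob {\<omega> \<in> space M. \<bar>stat n h null \<omega> - trunc_stat n h null N \<omega>\<bar> \<ge> 1} \<le> 1 / 4"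
    using mean_abs_Markov[OF Bochner_Integration.integrable_diff[OF lim(2,3)], of 1 N] N by simp
  define a where "a = (\<lambda>j. sqrt h / \<kappa> * (Khat (of_int j * h))\<^sup>2)"
  define \<mu> where "\<mu> = (\<Sum>j\<in>low (real N). a j) - centering n h"
  have dev: "trunc_stat n h null N \<omega> - \<mu> = (\<Sum>j\<in>low (real N). a j * ((\<xi> j \<omega>)\<^sup>2 - 1))" for \<omega>
    by (simp add: trunc_stat_null[OF n] \<mu>_def a_def right_diff_distrib sum_subtractf)
  have a2: "(\<Sum>j\<in>low (real N). (a j)\<^sup>2) \<le> mass ^ 3 * bnd / \<kappa>\<^sup>2"
  proof -
    have "(a j)\<^sup>2 \<le> h / \<kappa>\<^sup>2 * mass\<^sup>2 * (Khat (of_int j * h))\<^sup>2" for j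
    proof -
      have "(Khat (of_int j * h))\<^sup>2 \<le> mass\<^sup>2"
        using Khat_le_mass[of "of_int j * h"] mass_ge_1 by (simp add: abs_le_square_iff[symmetric])
      then have "(Khat (of_int j * h))\<^sup>2 * (Khat (of_int j * h))\<^sup>2 \<le> mass\<^sup>2 * (Khat (of_int j * h))\<^sup>2"
        by (intro mult_right_mono) auto
      then have "h / \<kappa>\<^sup>2 * ((Khat (of_int j * h))\<^sup>2 * (Khat (of_int j * h))\<^sup>2) \<le> h / \<kappa>\<^sup>2 * (mass\<^sup>2 * (Khat (of_int j * h))\<^sup>2)"
        using h by (intro mult_left_mono) auto
      moreover have "(a j)\<^sup>2 = h / \<kappa>\<^sup>2 * ((Khat (of_int j * h))\<^sup>2 * (Khat (of_int j * h))\<^sup>2)"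
        using h by (simp add: a_def power_mult_distrib power_divide power2_eq_square[of "(Khat _)\<^sup>2"])
      ultimately show ?thesis by (simp add: mult.assoc)
    qed
    then have "(\<Sum>j\<in>low (real N). (a j)\<^sup>2) \<le> (\<Sum>j\<in>low (real N). h / \<kappa>\<^sup>2 * mass\<^sup>2 * (Khat (of_int j * h))\<^sup>2)"
      by (rule sum_mono)
    also have "\<dots> = h / \<kappa>\<^sup>2 * mass\<^sup>2 * (\<Sum>j\<in>low (real N). (Khat (of_int j * h))\<^sup>2)"
      by (rule sum_distrib_left[symmetric])
    also have "\<dots> \<le> h / \<kappa>\<^sup>2 * mass\<^sup>2 * (mass * bnd / h)"
      using h by (intro mult_left_mono Khat_sum_bound h2) auto
    also have "\<dots> = mass ^ 3 * bnd / \<kappa>\<^sup>2" using h by (simp add: power2_eq_square power3_eq_cube)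
    finally show ?thesis .
  qed
  have P2: "prob {\<omega> \<in> space M. \<bar>trunc_stat n h null N \<omega> - \<mu>\<bar> \<ge> r} \<le> 1 / 4"
  proof -
    have "prob {\<omega> \<in> space M. \<bar>trunc_stat n h null N \<omega> - \<mu>\<bar> \<ge> r} \<le> (2 * (\<Sum>j\<in>low (real N). (a j)\<^sup>2)) / r\<^sup>2"
      unfolding dev using second_moment_Markov[OF chi_square_variance(1) r2(2), of "real N" a]
      by (simp add: chi_square_variance(2))
    also have "\<dots> \<le> R / (4 * R + 1)"
      unfolding r2(1) using a2 \<open>R \<ge> 0\<close> by (intro divide_right_mono) (simp_all add: R_def)
    also have "\<dots> \<le> 1 / 4" using \<open>R \<ge> 0\<close> by (simp add: field_simps)
    finally show ?thesis .
  qed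
  define S where "S = {\<omega> \<in> space M. \<mu> - spread < stat n h null \<omega> \<and> stat n h null \<omega> \<le> \<mu> - spread + 2 * spread}"
  have [measurable]: "S \<in> sets M" unfolding S_def by measurable
  have "1 = prob (space M)" by (simp add: prob_space)
  also have "\<dots> \<le> prob (S \<union> ({\<omega> \<in> space M. \<bar>stat n h null \<omega> - trunc_stat n h null N \<omega>\<bar> \<ge> 1} \<union> {\<omega> \<in> space M. \<bar>trunc_stat n h null N \<omega> - \<mu>\<bar> \<ge> r}))"
  proof (rule finite_measure_mono)
    have "spread = 2 * r + 2" by (simp add: spread_def r_def)
    then show "space M \<subseteq> S \<union> ({\<omega> \<in> space M. \<bar>stat n h null \<omega> - trunc_stat n h null N \<omega>\<bar> \<ge> 1} \<union> {\<omega> \<in> space M. \<bar>trunc_stat n h null N \<omega> - \<mu>\<bar> \<ge> r})"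
      using r2(2) unfolding S_def by (auto simp: abs_le_iff not_le abs_less_iff)
  qed measurable
  also have "\<dots> \<le> prob S + (prob {\<omega> \<in> space M. \<bar>stat n h null \<omega> - trunc_stat n h null N \<omega>\<bar> \<ge> 1} + prob {\<omega> \<in> space M. \<bar>trunc_stat n h null N \<omega> - \<mu>\<bar> \<ge> r})"
    by (rule order_trans[OF measure_Un_le add_left_mono[OF measure_Un_le]]) measurable
  also have "\<dots> \<le> prob S + 1 / 2" using P1 P2 by simp
  finally have "prob S \<ge> 1 / 2" by simp
  then show ?thesis unfolding S_def by blast
qed

text \<open>The 16 is 4, from the square of the factor 2 in the cross term, times 4, from halving
  \<epsilon> in the limit.\<close>

definition cross_const :: real where "cross_const = 16 * mass\<^sup>2 / \<kappa>"

lemma cross_const_pos: "cross_const > 0"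
  using mass_ge_1 kappa_pos by (simp add: cross_const_def)

text \<open>Both statistics are driven by the same sample point, so the squares of the noise cancel
  and the difference, less the shift, is linear in the Gaussian coordinates. Its variance is of
  order sqrt h times the shift, small against the squared shift when the shift stays away from
  0.\<close>

lemma stat_shift:
  assumes f: "f \<in> L2_per" and h: "h > 0" "h \<le> max_bandwidth" and n: "n \<ge> 1" and \<epsilon>: "\<epsilon> > 0"
  shows "prob {\<omega> \<in> space M. \<bar>stat n h f \<omega> - stat n h null \<omega> - scaling n h * signal h f\<bar> \<ge> \<epsilon>}
    \<le> cross_const * sqrt h * (scaling n h * signal h f) / \<epsilon>\<^sup>2"
proof -
  let ?b = "\<sigma> / sqrt (real n)"
  let ?A = "scaling n h"
  let ?D = "?A * signal h f"
  note h2 = max_bandwidth_half[OF h(2)]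
  note l0 = stat_limit[OF zero_L2_per h(1) h2 n] and l1 = stat_limit[OF f h(1) h2 n]
  note Apos = scaling_pos[OF n h(1)]
  define s where "s N = (\<Sum>j\<in>low (real N). (Khat (of_int j * h))\<^sup>2 * (hartley f j)\<^sup>2)" for N :: nat
  define X where "X \<omega> = stat n h f \<omega> - stat n h null \<omega> - ?D" for \<omega>
  define XN where "XN N \<omega> = trunc_stat n h f N \<omega> - trunc_stat n h null N \<omega> - ?A * s N" for N \<omega>
  have iX: "integrable M X" unfolding X_def[abs_def] using l0 l1 by auto
  have iXN: "integrable M (XN N)" for N unfolding XN_def[abs_def] using l0 l1 by auto
  have lim: "(\<lambda>N. \<integral>\<omega>. \<bar>X \<omega> - XN N \<omega>\<bar> \<partial>M) \<longlonglongrightarrow> 0"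
  proof (rule tendsto_sandwich[OF _ _ tendsto_const])
    let ?u = "\<lambda>N. (\<integral>\<omega>. \<bar>stat n h f \<omega> - trunc_stat n h f N \<omega>\<bar> \<partial>M) + (\<integral>\<omega>. \<bar>stat n h null \<omega> - trunc_stat n h null N \<omega>\<bar> \<partial>M) + ?A * \<bar>signal h f - s N\<bar>"
    have "?u \<longlonglongrightarrow> 0 + 0 + ?A * \<bar>signal h f - signal h f\<bar>"
      unfolding s_def by (intro tendsto_intros l0 l1 signal_limit f)
    then show "?u \<longlonglongrightarrow> 0" by simp
    show "eventually (\<lambda>N. (\<integral>\<omega>. \<bar>X \<omega> - XN N \<omega>\<bar> \<partial>M) \<le> ?u N) sequentially"
    proof (rule always_eventually, rule allI)
      fix N
      have i1: "integrable M (\<lambda>\<omega>. \<bar>stat n h f \<omega> - trunc_stat n h f N \<omega>\<bar>)" "integrable M (\<lambda>\<omega>. \<bar>stat n h null \<omega> - trunc_stat n h null N \<omega>\<bar>)"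
        by (intro integrable_abs Bochner_Integration.integrable_diff l0 l1)+
      have "(\<integral>\<omega>. \<bar>X \<omega> - XN N \<omega>\<bar> \<partial>M) \<le> (\<integral>\<omega>. \<bar>stat n h f \<omega> - trunc_stat n h f N \<omega>\<bar> + \<bar>stat n h null \<omega> - trunc_stat n h null N \<omega>\<bar> + ?A * \<bar>signal h f - s N\<bar> \<partial>M)"
      proof (rule integral_mono)
        show "integrable M (\<lambda>\<omega>. \<bar>X \<omega> - XN N \<omega>\<bar>)"
          by (intro integrable_abs Bochner_Integration.integrable_diff iX iXN)
        show "integrable M (\<lambda>\<omega>. \<bar>stat n h f \<omega> - trunc_stat n h f N \<omega>\<bar> + \<bar>stat n h null \<omega> - trunc_stat n h null N \<omega>\<bar> + ?A * \<bar>signal h f - s N\<bar>)"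
          using i1 by auto
        fix \<omega>
        have "?A * \<bar>signal h f - s N\<bar> = \<bar>?D - ?A * s N\<bar>"
          using Apos by (simp add: abs_mult flip: right_diff_distrib)
        then show "\<bar>X \<omega> - XN N \<omega>\<bar> \<le> \<bar>stat n h f \<omega> - trunc_stat n h f N \<omega>\<bar> + \<bar>stat n h null \<omega> - trunc_stat n h null N \<omega>\<bar> + ?A * \<bar>signal h f - s N\<bar>"
          unfolding X_def XN_def by linarith
      qed
      also have "\<dots> = ?u N" using i1 by (simp add: prob_space)
      finally show "(\<integral>\<omega>. \<bar>X \<omega> - XN N \<omega>\<bar> \<partial>M) \<le> ?u N" .
    qed
  qed simp
  define q where "q j = 2 * ?A * ?b * (Khat (of_int j * h))\<^sup>2 * hartley f j" for j
  have XNq: "XN N \<omega> = (\<Sum>j\<in>low (real N). q j * \<xi> j \<omega>)" for N \<omega>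
  proof -
    have "XN N \<omega> = ?A * (\<Sum>j\<in>low (real N). (Khat (of_int j * h))\<^sup>2 * (hartley f j + ?b * \<xi> j \<omega>)\<^sup>2
        - (Khat (of_int j * h))\<^sup>2 * (?b * \<xi> j \<omega>)\<^sup>2 - (Khat (of_int j * h))\<^sup>2 * (hartley f j)\<^sup>2)"
      by (simp add: XN_def trunc_stat_def trunc_norm_def s_def sum_subtractf right_diff_distrib)
    also have "\<dots> = (\<Sum>j\<in>low (real N). q j * \<xi> j \<omega>)"
      unfolding sum_distrib_left by (intro sum.cong) (simp_all add: q_def power2_eq_square algebra_simps)
    finally show ?thesis .
  qed
  \<comment> \<open>One squared multiplier is bounded by mass^2, the noise level is absorbed by
    \<open>scaling_noise\<close>, and what is left sums to the shift itself.\<close>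
  have q2: "(\<Sum>j\<in>low (real N). (q j)\<^sup>2) \<le> (4 * mass\<^sup>2 * (sqrt h / \<kappa>)) * ?D" for N
  proof -
    have "(q j)\<^sup>2 \<le> (4 * mass\<^sup>2 * (sqrt h / \<kappa>) * ?A) * ((Khat (of_int j * h))\<^sup>2 * (hartley f j)\<^sup>2)" for j
    proof -
      have e: "(q j)\<^sup>2 = (Khat (of_int j * h))\<^sup>2 * (4 * (?A * ?b\<^sup>2) * ?A * ((Khat (of_int j * h))\<^sup>2 * (hartley f j)\<^sup>2))"
        by (simp add: q_def power2_eq_square mult_ac)
      have "(Khat (of_int j * h))\<^sup>2 \<le> mass\<^sup>2"
        using Khat_le_mass[of "of_int j * h"] mass_ge_1 by (simp add: abs_le_square_iff[symmetric])
      moreover have "0 \<le> 4 * (?A * ?b\<^sup>2) * ?A * ((Khat (of_int j * h))\<^sup>2 * (hartley f j)\<^sup>2)"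
        using Apos by simp
      ultimately have "(q j)\<^sup>2 \<le> mass\<^sup>2 * (4 * (?A * ?b\<^sup>2) * ?A * ((Khat (of_int j * h))\<^sup>2 * (hartley f j)\<^sup>2))"
        unfolding e by (rule mult_right_mono)
      then show ?thesis unfolding scaling_noise[OF n] by (simp add: mult_ac)
    qed
    then have "(\<Sum>j\<in>low (real N). (q j)\<^sup>2) \<le> (\<Sum>j\<in>low (real N). (4 * mass\<^sup>2 * (sqrt h / \<kappa>) * ?A) * ((Khat (of_int j * h))\<^sup>2 * (hartley f j)\<^sup>2))"
      by (rule sum_mono)
    also have "\<dots> = (4 * mass\<^sup>2 * (sqrt h / \<kappa>) * ?A) * s N"
      by (simp only: s_def sum_distrib_left)
    also have "\<dots> \<le> (4 * mass\<^sup>2 * (sqrt h / \<kappa>) * ?A) * signal h f"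
      unfolding s_def using Apos h kappa_pos by (intro mult_left_mono signal_limit(2) f) auto
    finally show ?thesis by (simp add: mult.assoc)
  qed
  have "prob {\<omega> \<in> space M. X \<omega> \<in> {x. \<bar>x\<bar> \<ge> \<epsilon>}} \<le> cross_const * sqrt h * ?D / \<epsilon>\<^sup>2"
  proof (rule prob_le_of_limit[OF iX iXN lim, where S'="{x. \<bar>x\<bar> \<ge> \<epsilon> / 2}" and \<eta>="\<epsilon> / 2"])
    show "y \<in> {x. \<bar>x\<bar> \<ge> \<epsilon> / 2}" if "x \<in> {x. \<bar>x\<bar> \<ge> \<epsilon>}" "\<bar>x - y\<bar> < \<epsilon> / 2" for x y
      using that by (simp; linarith)
    show "eventually (\<lambda>N. prob {\<omega> \<in> space M. XN N \<omega> \<in> {x. \<bar>x\<bar> \<ge> \<epsilon> / 2}} \<le> cross_const * sqrt h * ?D / \<epsilon>\<^sup>2) sequentially"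
    proof (rule always_eventually, rule allI)
      fix N
      have "prob {\<omega> \<in> space M. \<bar>XN N \<omega>\<bar> \<ge> \<epsilon> / 2} \<le> (\<Sum>j\<in>low (real N). (q j)\<^sup>2) / (\<epsilon> / 2)\<^sup>2"
      proof -
        have "(\<lambda>\<omega>. \<Sum>j\<in>low (real N). q j * \<xi> j \<omega>) \<in> sqint M"
          by (rule sqint_lin) (rule \<xi>_sqint)
        from second_moment_Markov[OF this, of "\<epsilon> / 2"] \<epsilon> show ?thesis
          unfolding XNq \<xi>_sum_second_moment by simp
      qed
      also have "\<dots> \<le> ((4 * mass\<^sup>2 * (sqrt h / \<kappa>)) * ?D) / (\<epsilon> / 2)\<^sup>2"
        by (intro divide_right_mono q2) auto
      also have "\<dots> = cross_const * sqrt h * ?D / \<epsilon>\<^sup>2"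
        by (simp add: cross_const_def power_divide)
      finally show "prob {\<omega> \<in> space M. XN N \<omega> \<in> {x. \<bar>x\<bar> \<ge> \<epsilon> / 2}} \<le> cross_const * sqrt h * ?D / \<epsilon>\<^sup>2" by simp
    qed
  qed (use \<epsilon> in auto)
  then show ?thesis by (simp add: X_def)
qed

definition error_sum :: "nat \<Rightarrow> real \<Rightarrow> (real \<Rightarrow> real) \<Rightarrow> real \<Rightarrow> real" where
  "error_sum n h f c = prob {\<omega> \<in> space M. stat n h null \<omega> > c} + prob {\<omega> \<in> space M. \<not> stat n h f \<omega> > c}"

text \<open>If the null statistic accepts while the shifted one rejects, then either the cross term
  is at least \<epsilon> or the null statistic lies in the window of width 2 \<epsilon> ending at
  the threshold. Both probabilities are bounded independently of \<open>c\<close>.\<close>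

lemma error_sum_ge:
  assumes f: "f \<in> L2_per" and h: "h > 0" "h \<le> max_bandwidth" and n: "n \<ge> 1" and \<epsilon>: "\<epsilon> > 0"
    and D: "scaling n h * signal h f \<le> \<epsilon>"
  shows "error_sum n h f c \<ge> 1 - conc_const * \<epsilon> - cross_const * sqrt h / \<epsilon>"
proof -
  let ?D = "scaling n h * signal h f"
  note h2 = max_bandwidth_half[OF h(2)]
  note [measurable] = stat_measurable[OF zero_L2_per h(1) h2 n] stat_measurable[OF f h(1) h2 n]
  have "1 = prob (space M)" by (simp add: prob_space)
  also have "\<dots> \<le> prob (({\<omega> \<in> space M. stat n h null \<omega> > c} \<union> {\<omega> \<in> space M. \<not> stat n h f \<omega> > c}) \<union>
    ({\<omega> \<in> space M. \<bar>stat n h null \<omega> - (c - \<epsilon>)\<bar> \<le> \<epsilon>} \<union> {\<omega> \<in> space M. \<bar>stat n h f \<omega> - stat n h null \<omega> - ?D\<bar> \<ge> \<epsilon>}))"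
  proof (rule finite_measure_mono)
    show "space M \<subseteq> ({\<omega> \<in> space M. stat n h null \<omega> > c} \<union> {\<omega> \<in> space M. \<not> stat n h f \<omega> > c}) \<union>
    ({\<omega> \<in> space M. \<bar>stat n h null \<omega> - (c - \<epsilon>)\<bar> \<le> \<epsilon>} \<union> {\<omega> \<in> space M. \<bar>stat n h f \<omega> - stat n h null \<omega> - ?D\<bar> \<ge> \<epsilon>})"
    proof
      fix \<omega> assume "\<omega> \<in> space M"
      moreover have "x > c \<or> \<not> y > c \<or> \<bar>x - (c - \<epsilon>)\<bar> \<le> \<epsilon> \<or> \<bar>y - x - ?D\<bar> \<ge> \<epsilon>" for x y
        using D \<epsilon> by linarith
      ultimately show "\<omega> \<in> ({\<omega> \<in> space M. stat n h null \<omega> > c} \<union> {\<omega> \<in> space M. \<not> stat n h f \<omega> > c}) \<union>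
    ({\<omega> \<in> space M. \<bar>stat n h null \<omega> - (c - \<epsilon>)\<bar> \<le> \<epsilon>} \<union> {\<omega> \<in> space M. \<bar>stat n h f \<omega> - stat n h null \<omega> - ?D\<bar> \<ge> \<epsilon>})"
        by blast
    qed
  qed measurable
  also have "\<dots> \<le> error_sum n h f c + (prob {\<omega> \<in> space M. \<bar>stat n h null \<omega> - (c - \<epsilon>)\<bar> \<le> \<epsilon>} + prob {\<omega> \<in> space M. \<bar>stat n h f \<omega> - stat n h null \<omega> - ?D\<bar> \<ge> \<epsilon>})"
    unfolding error_sum_def by (rule order_trans[OF measure_Un_le add_mono[OF measure_Un_le measure_Un_le]]) measurable
  also have "\<dots> \<le> error_sum n h f c + (conc_const * \<epsilon> + cross_const * sqrt h * ?D / \<epsilon>\<^sup>2)"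
    by (intro add_left_mono add_mono stat_concentration stat_shift f h n \<epsilon>)
  also have "cross_const * sqrt h * ?D / \<epsilon>\<^sup>2 \<le> cross_const * sqrt h * \<epsilon> / \<epsilon>\<^sup>2"
    using D cross_const_pos h by (intro divide_right_mono mult_left_mono) auto
  also have "\<dots> = cross_const * sqrt h / \<epsilon>" using \<epsilon> by (simp add: power2_eq_square)
  finally show ?thesis by simp
qed

text \<open>No limit law is needed: the null statistic is tight, so some short interval carries a fixed
  amount of mass, and the test thresholded at its right end gains that mass.\<close>

definition gain :: "real \<Rightarrow> real" where
  "gain \<delta> = 1 / (2 * (4 * spread / \<delta> + 1))"

lemma gain_pos: "\<delta> > 0 \<Longrightarrow> gain \<delta> > 0"
  using spread_pos by (simp add: gain_def add_pos_pos)

lemma error_sum_le: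
  assumes f: "f \<in> L2_per" and h: "h > 0" "h \<le> max_bandwidth" and n: "n \<ge> 1" and \<delta>: "\<delta> > 0"
    and D: "scaling n h * signal h f \<ge> \<delta>"
  shows "\<exists>c. error_sum n h f c \<le> 1 - gain \<delta> + 4 * cross_const * sqrt h / \<delta>"
proof -
  let ?D = "scaling n h * signal h f"
  note h2 = max_bandwidth_half[OF h(2)]
  note [measurable] = stat_measurable[OF zero_L2_per h(1) h2 n] stat_measurable[OF f h(1) h2 n]
  \<comment> \<open>m cells of length \<delta> / 2 cover an interval of length 2 spread that carries
    mass at least 1/2, so some cell has mass at least 1 / (2 m).\<close>
  define m where "m = nat \<lceil>4 * spread / \<delta>\<rceil>"
  have sp: "4 * spread / \<delta> > 0" using spread_pos \<delta> by simp
  have m: "real m \<ge> 4 * spread / \<delta>" "real m \<le> 4 * spread / \<delta> + 1" using sp unfolding m_def by linarith+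
  have m0: "real m > 0" using m(1) sp by linarith
  obtain a where a: "prob {\<omega> \<in> space M. a < stat n h null \<omega> \<and> stat n h null \<omega> \<le> a + 2 * spread} \<ge> 1 / 2"
    using stat_tight[OF h n] by blast
  define J where "J i = {\<omega> \<in> space M. a + real i * (\<delta> / 2) < stat n h null \<omega> \<and> stat n h null \<omega> \<le> a + real (Suc i) * (\<delta> / 2)}" for i
  have [measurable]: "J i \<in> sets M" for i unfolding J_def by measurable
  have "\<exists>i<m. prob (J i) \<ge> 1 / (2 * real m)"
  proof (rule ccontr)
    assume "\<not> ?thesis"
    then have lt: "prob (J i) < 1 / (2 * real m)" if "i < m" for i using that by force
    have cov: "{\<omega> \<in> space M. a < stat n h null \<omega> \<and> stat n h null \<omega> \<le> a + 2 * spread} \<subseteq> (\<Union>i<m. J i)"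
    proof
      fix \<omega> assume \<omega>: "\<omega> \<in> {\<omega> \<in> space M. a < stat n h null \<omega> \<and> stat n h null \<omega> \<le> a + 2 * spread}"
      define z where "z = (stat n h null \<omega> - a) / (\<delta> / 2)"
      have z: "z > 0" "z \<le> real m"
      proof -
        show "z > 0" using \<omega> \<delta> by (simp add: z_def)
        have "z \<le> 2 * spread / (\<delta> / 2)" unfolding z_def using \<omega> \<delta> by (intro divide_right_mono) auto
        then show "z \<le> real m" using m(1) by simp
      qed
      \<comment> \<open>The cells are open on the left, so the index is the ceiling minus 1.\<close>
      define i where "i = nat (\<lceil>z\<rceil> - 1)"
      have "\<lceil>z\<rceil> \<ge> 1" using z(1) by linarith
      then have ri: "real i = of_int \<lceil>z\<rceil> - 1" by (simp add: i_def)
      have i: "real i < z" "z \<le> real (Suc i)" using ri by (linarith, simp)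
      have im: "i < m"
      proof -
        have "real i < real m" using i(1) z(2) by linarith
        then show ?thesis by simp
      qed
      have st: "stat n h null \<omega> = a + z * (\<delta> / 2)" using \<delta> by (simp add: z_def field_simps)
      have "real i * (\<delta> / 2) < z * (\<delta> / 2)" "z * (\<delta> / 2) \<le> real (Suc i) * (\<delta> / 2)"
        using i \<delta> by (intro mult_strict_right_mono mult_right_mono; simp)+
      with \<omega> have "\<omega> \<in> J i" unfolding J_def by (simp only: mem_Collect_eq st) simp
      then show "\<omega> \<in> (\<Union>i<m. J i)" using im by blast
    qed
    have "1 / 2 \<le> prob (\<Union>i<m. J i)" by (rule order_trans[OF a finite_measure_mono[OF cov]]) measurable
    also have "\<dots> \<le> (\<Sum>i<m. prob (J i))" by (rule finite_measure_subadditive_finite) auto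
    also have "\<dots> < (\<Sum>i<m. 1 / (2 * real m))" using lt m0 by (intro sum_strict_mono) auto
    also have "\<dots> = 1 / 2" using m0 by simp
    finally show False by simp
  qed
  then obtain i where i: "prob (J i) \<ge> 1 / (2 * real m)" by blast
  have g: "gain \<delta> \<le> prob (J i)"
  proof -
    have "gain \<delta> \<le> 1 / (2 * real m)"
      unfolding gain_def using m(2) m0 by (intro divide_left_mono) auto
    with i show ?thesis by simp
  qed
  define c where "c = a + real (Suc i) * (\<delta> / 2)"
  let ?N0 = "{\<omega> \<in> space M. stat n h null \<omega> > c}"
  let ?L = "{\<omega> \<in> space M. stat n h null \<omega> \<le> a + real i * (\<delta> / 2)}"
  let ?X = "{\<omega> \<in> space M. \<bar>stat n h f \<omega> - stat n h null \<omega> - ?D\<bar> \<ge> ?D / 2}"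
  have Dp: "?D > 0" using D \<delta> by linarith
  \<comment> \<open>The threshold is the right end of the chosen cell: from a null value above the
    left end, staying below the threshold means an increase of less than \<delta> / 2, at most half
    the shift.\<close>
  have "prob {\<omega> \<in> space M. \<not> stat n h f \<omega> > c} \<le> prob (?L \<union> ?X)"
  proof (intro finite_measure_mono subsetI)
    fix \<omega> assume \<omega>: "\<omega> \<in> {\<omega> \<in> space M. \<not> stat n h f \<omega> > c}"
    have "y \<le> c \<Longrightarrow> x \<le> a + real i * (\<delta> / 2) \<or> \<bar>y - x - ?D\<bar> \<ge> ?D / 2" for x y
    proof -
      have "c = a + real i * (\<delta> / 2) + \<delta> / 2" by (simp add: c_def algebra_simps)
      then show "y \<le> c \<Longrightarrow> x \<le> a + real i * (\<delta> / 2) \<or> \<bar>y - x - ?D\<bar> \<ge> ?D / 2"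
        using D by linarith
    qed
    with \<omega> show "\<omega> \<in> ?L \<union> ?X" by (auto simp: not_less)
  qed measurable
  also have "\<dots> \<le> prob ?L + prob ?X" by (rule measure_Un_le) measurable
  finally have 1: "prob {\<omega> \<in> space M. \<not> stat n h f \<omega> > c} \<le> prob ?L + prob ?X" .
  \<comment> \<open>Null rejection, null values left of the cell, and the cell itself are disjoint;
    the mass of the cell is what the error sum saves.\<close>
  have "prob ?N0 + (prob ?L + prob (J i)) = prob (?N0 \<union> (?L \<union> J i))"
  proof -
    have Ji: "J i = {\<omega> \<in> space M. a + real i * (\<delta> / 2) < stat n h null \<omega> \<and> stat n h null \<omega> \<le> c}"
      by (simp only: J_def c_def)
    have "?L \<inter> J i = {}" unfolding Ji by auto
    then have "prob (?L \<union> J i) = prob ?L + prob (J i)" by (intro finite_measure_Union) measurable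
    moreover have "?N0 \<inter> (?L \<union> J i) = {}"
    proof -
      have "a + real i * (\<delta> / 2) \<le> c" using \<delta> by (simp add: c_def)
      then show ?thesis unfolding Ji by auto
    qed
    then have "prob (?N0 \<union> (?L \<union> J i)) = prob ?N0 + prob (?L \<union> J i)" by (intro finite_measure_Union) measurable
    ultimately show ?thesis by simp
  qed
  also have "\<dots> \<le> 1" by (rule prob_le_1)
  finally have 2: "prob ?N0 + (prob ?L + prob (J i)) \<le> 1" .
  have "prob ?X \<le> cross_const * sqrt h * ?D / (?D / 2)\<^sup>2"
    using Dp by (intro stat_shift f h n) auto
  also have "\<dots> = 4 * cross_const * sqrt h / ?D" using Dp by (simp add: power_divide power2_eq_square)
  also have "\<dots> \<le> 4 * cross_const * sqrt h / \<delta>"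
    using D Dp \<delta> cross_const_pos h by (intro divide_left_mono) auto
  finally have 3: "prob ?X \<le> 4 * cross_const * sqrt h / \<delta>" .
  have "error_sum n h f c \<le> 1 - gain \<delta> + 4 * cross_const * sqrt h / \<delta>"
    unfolding error_sum_def using 1 2 3 g by linarith
  then show ?thesis ..
qed

lemma error_sum_tests:
  assumes "\<And>y. test y \<longleftrightarrow> kernel_statistic K \<sigma> n h y > c"
  shows "type_I_error M W \<sigma> n test + type_II_error M W \<sigma> n test f = error_sum n h f c"
  by (simp add: type_I_error_def type_II_error_def error_sum_def stat_def assms)

end

subsection \<open>Consistency and low-frequency energy\<close>

text \<open>The third identity explains the exponent 4 r - 2: it makes n sqrt h the reciprocal of
  the squared rate of the norms.\<close>

lemma rate_powr:
  assumes "n \<ge> 1"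
  shows "(real n powr (- r))\<^sup>2 * real n powr (2 * r) = 1"
    and "real n powr (4 * r - 2) = 1 / real n powr (2 - 4 * r)"
    and "real n * sqrt (real n powr (4 * r - 2)) = real n powr (2 * r)"
proof -
  have n: "real n > 0" using assms by simp
  show "(real n powr (- r))\<^sup>2 * real n powr (2 * r) = 1"
    using n by (simp add: power2_eq_square powr_add[symmetric])
  show "real n powr (4 * r - 2) = 1 / real n powr (2 - 4 * r)"
    using powr_minus_divide[of "real n" "2 - 4 * r"] by simp
  have "sqrt (real n powr (4 * r - 2)) = real n powr (2 * r - 1)"
  proof (rule real_sqrt_unique)
    show "(real n powr (2 * r - 1))\<^sup>2 = real n powr (4 * r - 2)"
      by (simp add: power2_eq_square powr_add[symmetric])
  qed simp
  then have "real n * sqrt (real n powr (4 * r - 2)) = real n powr 1 * real n powr (2 * r - 1)"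
    using n by simp
  also have "\<dots> = real n powr (2 * r)" by (simp only: powr_add[symmetric]) simp
  finally show "real n * sqrt (real n powr (4 * r - 2)) = real n powr (2 * r)" .
qed

context kernel_noise
begin

definition shift :: "(nat \<Rightarrow> real) \<Rightarrow> (nat \<Rightarrow> real \<Rightarrow> real) \<Rightarrow> nat \<Rightarrow> real" where
  "shift h f n = scaling n (h n) * signal (h n) (f n)"

definition energy :: "real \<Rightarrow> (nat \<Rightarrow> real \<Rightarrow> real) \<Rightarrow> real \<Rightarrow> nat \<Rightarrow> real" where
  "energy r f c n = low_energy (f n) (c * real n powr (2 - 4 * r)) * real n powr (2 * r)"

lemma energy_nonneg: "energy r f c n \<ge> 0"
  by (simp add: energy_def low_energy_nonneg)

lemma energy_mono: "c \<le> d \<Longrightarrow> energy r f c n \<le> energy r f d n"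
  unfolding energy_def by (intro mult_right_mono low_energy_mono) auto

lemma bandwidthsD:
  assumes "bandwidths r h"
  shows "\<exists>c C. 0 < c \<and> c \<le> C \<and> (\<forall>n\<ge>1. h n > 0) \<and>
    (\<forall>n\<ge>1. c * real n powr (4 * r - 2) \<le> h n) \<and> (\<forall>n\<ge>1. h n \<le> C * real n powr (4 * r - 2))"
  using assms unfolding bandwidths_def same_order_def by blast

lemma bandwidths_limit:
  assumes h: "bandwidths r h" and r: "r < 1 / 2"
  shows "h \<longlonglongrightarrow> 0" and "eventually (\<lambda>n. n \<ge> 1 \<and> h n > 0 \<and> h n \<le> max_bandwidth) sequentially"
proof -
  from bandwidthsD[OF h] obtain c C where b: "0 < c" "c \<le> C" "\<And>n. n \<ge> 1 \<Longrightarrow> h n > 0"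
    "\<And>n. n \<ge> 1 \<Longrightarrow> c * real n powr (4 * r - 2) \<le> h n" "\<And>n. n \<ge> 1 \<Longrightarrow> h n \<le> C * real n powr (4 * r - 2)"
    by blast
  have "(\<lambda>n. real n powr (4 * r - 2)) \<longlonglongrightarrow> 0"
    by (rule tendsto_neg_powr) (use r filterlim_real_sequentially in auto)
  then have lim: "(\<lambda>n. C * real n powr (4 * r - 2)) \<longlonglongrightarrow> C * 0"
    by (intro tendsto_intros)
  show h0: "h \<longlonglongrightarrow> 0"
  proof (rule tendsto_sandwich[OF _ _ tendsto_const])
    show "eventually (\<lambda>n. 0 \<le> h n) sequentially"
      using eventually_ge_at_top[of 1] by eventually_elim (use b(3) less_imp_le in blast)
    show "eventually (\<lambda>n. h n \<le> C * real n powr (4 * r - 2)) sequentially"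
      using eventually_ge_at_top[of 1] by eventually_elim (rule b(5))
  qed (use lim in simp)
  have "eventually (\<lambda>n. h n < max_bandwidth) sequentially"
    using order_tendstoD(2)[OF h0 max_bandwidth_pos] .
  with eventually_ge_at_top[of 1] show "eventually (\<lambda>n. n \<ge> 1 \<and> h n > 0 \<and> h n \<le> max_bandwidth) sequentially"
    by eventually_elim (use b(3) in auto)
qed

text \<open>For a prescribed \<open>e\<close>, the decay of the transform fixes a level
  \<open>w / h\<close> beyond which the signal is negligible relative to the norm bound; the lower
  bandwidth constant bounds this level by \<open>w / c * n powr (2 - 4 * r)\<close>.\<close>

lemma shift_le_energy:
  assumes h: "bandwidths r h" and f: "\<forall>n\<ge>1. f n \<in> L2_per"
    and B: "\<And>n. n \<ge> 1 \<Longrightarrow> (L2_norm (f n))\<^sup>2 * real n powr (2 * r) \<le> B" and e: "e > 0"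
  shows "\<exists>c>0. \<exists>k>0. \<forall>n\<ge>1. shift h f n \<le> k * energy r f c n + e"
proof -
  from bandwidthsD[OF h] obtain c C where b: "0 < c" "c \<le> C" "\<And>n. n \<ge> 1 \<Longrightarrow> h n > 0"
    "\<And>n. n \<ge> 1 \<Longrightarrow> c * real n powr (4 * r - 2) \<le> h n" "\<And>n. n \<ge> 1 \<Longrightarrow> h n \<le> C * real n powr (4 * r - 2)"
    by blast
  have "C > 0" using b by simp
  have B0: "B \<ge> 0" by (rule order_trans[OF _ B[of 1]]) auto
  define k0 where "k0 = sqrt C / (\<sigma>\<^sup>2 * \<kappa>)"
  have k0: "k0 > 0" using \<open>C > 0\<close> sigma_pos kappa_pos by (simp add: k0_def)
  \<comment> \<open>Chosen so that the high-frequency contribution k0 \<eta>^2 (B + 1) is exactly e;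
    the + 1 keeps the denominator positive when B = 0.\<close>
  define \<eta> where "\<eta> = sqrt (e / (k0 * (B + 1)))"
  have \<eta>: "\<eta> > 0" "k0 * (\<eta>\<^sup>2 * (B + 1)) = e" using e k0 B0 by (simp_all add: \<eta>_def)
  from Khat_decay[OF \<eta>(1)] obtain w where w: "w > 0" "\<And>x. \<bar>x\<bar> \<ge> w \<Longrightarrow> \<bar>Khat x\<bar> \<le> \<eta>" by blast
  have "shift h f n \<le> (k0 * mass\<^sup>2) * energy r f (w / c) n + e" if n: "n \<ge> 1" for n
  proof -
    define q where "q = real n powr (2 * r)"
    have np: "real n > 0" using n by simp
    have q: "q > 0" using n by (simp add: q_def)
    have fn: "f n \<in> L2_per" using f n by blast
    have sc: "scaling n (h n) \<le> k0 * q"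
    proof -
      have "sqrt (h n) \<le> sqrt C * sqrt (real n powr (4 * r - 2))"
        using b(5)[OF n] by (simp flip: real_sqrt_mult)
      then have "real n * sqrt (h n) \<le> real n * (sqrt C * sqrt (real n powr (4 * r - 2)))"
        by (intro mult_left_mono) auto
      also have "\<dots> = sqrt C * q"
        unfolding q_def rate_powr(3)[OF n, symmetric] by simp
      finally show ?thesis
        using sigma_pos kappa_pos by (simp add: scaling_def k0_def divide_right_mono)
    qed
    have "w / h n \<le> w / c * real n powr (2 - 4 * r)"
    proof -
      have "w / h n \<le> w / (c * real n powr (4 * r - 2))"
        using b(1) b(4)[OF n] w(1) b(3)[OF n] n by (intro divide_left_mono) auto
      then show ?thesis unfolding rate_powr(2)[OF n] by simp
    qed
    then have le: "low_energy (f n) (w / h n) \<le> low_energy (f n) (w / c * real n powr (2 - 4 * r))"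
      by (rule low_energy_mono)
    have "shift h f n \<le> (k0 * q) * signal (h n) (f n)"
      unfolding shift_def by (rule mult_right_mono[OF sc signal_nonneg[OF fn]])
    also have "\<dots> \<le> (k0 * q) * (mass\<^sup>2 * low_energy (f n) (w / h n) + \<eta>\<^sup>2 * (L2_norm (f n))\<^sup>2)"
      using k0 q by (intro mult_left_mono signal_le[OF fn b(3)[OF n] w(2)]) auto
    also have "\<dots> \<le> (k0 * q) * (mass\<^sup>2 * low_energy (f n) (w / c * real n powr (2 - 4 * r)) + \<eta>\<^sup>2 * (L2_norm (f n))\<^sup>2)"
      using k0 q le by (intro mult_left_mono add_right_mono) auto
    also have "\<dots> = (k0 * mass\<^sup>2) * energy r f (w / c) n + k0 * (\<eta>\<^sup>2 * ((L2_norm (f n))\<^sup>2 * q))"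
      by (simp add: energy_def q_def algebra_simps)
    also have "k0 * (\<eta>\<^sup>2 * ((L2_norm (f n))\<^sup>2 * q)) \<le> k0 * (\<eta>\<^sup>2 * (B + 1))"
      using k0 B[OF n] by (intro mult_left_mono) (auto simp: q_def)
    finally show ?thesis unfolding \<eta>(2) by simp
  qed
  moreover have "w / c > 0" "k0 * mass\<^sup>2 > 0" using w b k0 mass_ge_1 by auto
  ultimately show ?thesis by blast
qed

text \<open>The bandwidth for which \<open>cutoff / h\<close> equals
  \<open>c * n powr (2 - 4 * r)\<close>, so that \<open>signal_ge\<close> sees exactly the
  frequencies counted in \<open>energy r f c\<close>.\<close>

definition tuned :: "real \<Rightarrow> real \<Rightarrow> nat \<Rightarrow> real" where
  "tuned r c n = cutoff / c * real n powr (4 * r - 2)"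

lemma tuned_bandwidths: "c > 0 \<Longrightarrow> bandwidths r (tuned r c)"
  using cutoff_pos unfolding bandwidths_def same_order_def tuned_def
  by (auto intro!: exI[of _ "cutoff / c"])

lemma tuned_shift_ge:
  assumes f: "\<forall>n\<ge>1. f n \<in> L2_per" and c: "c > 0"
  shows "\<exists>k>0. \<forall>n\<ge>1. shift (tuned r c) f n \<ge> k * energy r f c n"
proof (intro exI conjI allI impI)
  define k0 where "k0 = sqrt (cutoff / c) / (\<sigma>\<^sup>2 * \<kappa>)"
  show "k0 / 4 > 0" using c cutoff_pos sigma_pos kappa_pos by (simp add: k0_def)
  fix n :: nat assume n: "n \<ge> 1"
  have fn: "f n \<in> L2_per" using f n by blast
  have t: "tuned r c n > 0" using c cutoff_pos n by (simp add: tuned_def)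
  have "real n * sqrt (tuned r c n) = sqrt (cutoff / c) * (real n * sqrt (real n powr (4 * r - 2)))"
    unfolding tuned_def real_sqrt_mult by (rule mult.left_commute)
  then have sc: "scaling n (tuned r c n) = k0 * real n powr (2 * r)"
    unfolding rate_powr(3)[OF n] by (simp add: scaling_def k0_def)
  have "cutoff / tuned r c n = c * real n powr (2 - 4 * r)"
    unfolding tuned_def rate_powr(2)[OF n] using c cutoff_pos by simp
  then have "low_energy (f n) (c * real n powr (2 - 4 * r)) / 4 \<le> signal (tuned r c n) (f n)"
    using signal_ge[OF fn t] by simp
  then have "(k0 * real n powr (2 * r)) * (low_energy (f n) (c * real n powr (2 - 4 * r)) / 4) \<le> shift (tuned r c) f n"
    unfolding shift_def sc using \<open>k0 / 4 > 0\<close> by (intro mult_left_mono) auto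
  then show "k0 / 4 * energy r f c n \<le> shift (tuned r c) f n"
    by (simp add: energy_def mult_ac)
qed

lemma generated_tests_errors:
  assumes "generated_tests (\<lambda>n. kernel_statistic K \<sigma> n (h n)) tests"
  obtains c where "\<And>n. n \<ge> 1 \<Longrightarrow> type_I_error M W \<sigma> n (tests n) + type_II_error M W \<sigma> n (tests n) (f n) = error_sum n (h n) (f n) (c n)"
proof -
  from assms obtain c where "\<forall>n\<ge>1. \<forall>y. tests n y \<longleftrightarrow> kernel_statistic K \<sigma> n (h n) y > c n"
    unfolding generated_tests_def by blast
  then show ?thesis by (intro that[of c] error_sum_tests) blast
qed

text \<open>Concentration and cross term each receive a third of \<eta>: \<epsilon> is fixed first,
  then the bandwidth shrinks.\<close>

lemma error_sum_near_one:
  assumes h: "bandwidths r h" and r: "r < 1 / 2" and f: "\<forall>n\<ge>1. f n \<in> L2_per" and \<eta>: "\<eta> > 0"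
  shows "\<exists>\<epsilon>>0. eventually (\<lambda>n. shift h f n \<le> \<epsilon> \<longrightarrow> (\<forall>c. error_sum n (h n) (f n) c > 1 - \<eta>)) sequentially"
proof -
  define \<epsilon> where "\<epsilon> = \<eta> / (3 * (conc_const + 1))"
  have \<epsilon>: "\<epsilon> > 0" "conc_const * \<epsilon> \<le> \<eta> / 3"
    using \<eta> conc_const_nonneg by (simp_all add: \<epsilon>_def field_simps)
  have "(\<lambda>n. cross_const * sqrt (h n) / \<epsilon>) \<longlonglongrightarrow> cross_const * sqrt 0 / \<epsilon>"
    using \<epsilon> by (intro tendsto_intros bandwidths_limit[OF h r]) auto
  then have "eventually (\<lambda>n. cross_const * sqrt (h n) / \<epsilon> < \<eta> / 3) sequentially"
    using \<eta> by (intro order_tendstoD(2)) auto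
  with bandwidths_limit(2)[OF h r]
  have "eventually (\<lambda>n. shift h f n \<le> \<epsilon> \<longrightarrow> (\<forall>c. error_sum n (h n) (f n) c > 1 - \<eta>)) sequentially"
  proof eventually_elim
    case (elim n)
    show ?case
    proof (intro impI allI)
      fix c assume "shift h f n \<le> \<epsilon>"
      then have "error_sum n (h n) (f n) c \<ge> 1 - conc_const * \<epsilon> - cross_const * sqrt (h n) / \<epsilon>"
        using elim f \<epsilon> by (intro error_sum_ge) (auto simp: shift_def)
      then show "error_sum n (h n) (f n) c > 1 - \<eta>" using elim \<epsilon> \<eta> by linarith
    qed
  qed
  with \<epsilon>(1) show ?thesis by blast
qed

lemma error_sum_below_one:
  assumes h: "bandwidths r h" and r: "r < 1 / 2" and f: "\<forall>n\<ge>1. f n \<in> L2_per" and \<delta>: "\<delta> > 0"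
  shows "eventually (\<lambda>n. shift h f n \<ge> \<delta> \<longrightarrow> (\<exists>c. error_sum n (h n) (f n) c \<le> 1 - gain \<delta> / 2)) sequentially"
proof -
  have "(\<lambda>n. 4 * cross_const * sqrt (h n) / \<delta>) \<longlonglongrightarrow> 4 * cross_const * sqrt 0 / \<delta>"
    using \<delta> by (intro tendsto_intros bandwidths_limit[OF h r]) auto
  then have "eventually (\<lambda>n. 4 * cross_const * sqrt (h n) / \<delta> < gain \<delta> / 2) sequentially"
    using gain_pos[OF \<delta>] by (intro order_tendstoD(2)) auto
  with bandwidths_limit(2)[OF h r] show ?thesis
  proof eventually_elim
    case (elim n)
    show ?case
    proof
      assume "shift h f n \<ge> \<delta>"
      then obtain c where "error_sum n (h n) (f n) c \<le> 1 - gain \<delta> + 4 * cross_const * sqrt (h n) / \<delta>"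
        using error_sum_le[of "f n" "h n" n \<delta>] elim f \<delta> by (auto simp: shift_def)
      then have "error_sum n (h n) (f n) c \<le> 1 - gain \<delta> / 2" using elim by linarith
      then show "\<exists>c. error_sum n (h n) (f n) c \<le> 1 - gain \<delta> / 2" ..
    qed
  qed
qed

text \<open>The threshold may depend on \<open>f n\<close>, since consistency asks only for some
  generated tests. Choice makes it total, also at those n where the level \<open>v\<close> is not
  attained.\<close>

definition best_tests :: "(nat \<Rightarrow> real) \<Rightarrow> (nat \<Rightarrow> real \<Rightarrow> real) \<Rightarrow> real \<Rightarrow> nat \<Rightarrow> observation \<Rightarrow> bool" where
  "best_tests h f v n y \<longleftrightarrow> kernel_statistic K \<sigma> n (h n) y > (SOME c. error_sum n (h n) (f n) c \<le> v)"

lemma best_tests_generated: "generated_tests (\<lambda>n. kernel_statistic K \<sigma> n (h n)) (best_tests h f v)"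
  unfolding generated_tests_def best_tests_def
  by (intro exI[of _ "\<lambda>n. SOME c. error_sum n (h n) (f n) c \<le> v"]) simp

lemma best_tests_errors:
  assumes "\<exists>c. error_sum n (h n) (f n) c \<le> v"
  shows "type_I_error M W \<sigma> n (best_tests h f v n) + type_II_error M W \<sigma> n (best_tests h f v n) (f n) \<le> v"
proof -
  have "type_I_error M W \<sigma> n (best_tests h f v n) + type_II_error M W \<sigma> n (best_tests h f v n) (f n)
    = error_sum n (h n) (f n) (SOME c. error_sum n (h n) (f n) c \<le> v)"
    by (rule error_sum_tests) (simp add: best_tests_def)
  then show ?thesis using someI_ex[OF assms] by simp
qed

text \<open>A limiting error sum below 1 forces the shift away from 0, hence the energy at some
  \<open>c\<close>; conversely the bandwidth tuned to \<open>c\<close> turns energy into shift.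
  \<open>B\<close> is only an upper bound on the norms, so the result can be applied to sums of two
  sequences.\<close>

theorem consistent_iff_energy:
  assumes r: "r < 1 / 2" and f: "\<forall>n\<ge>1. f n \<in> L2_per"
    and B: "\<And>n. n \<ge> 1 \<Longrightarrow> (L2_norm (f n))\<^sup>2 * real n powr (2 * r) \<le> B"
  shows "consistent M W \<sigma> K r f \<longleftrightarrow> (\<exists>c>0. \<exists>\<epsilon>>0. eventually (\<lambda>n. energy r f c n \<ge> \<epsilon>) sequentially)"
proof
  assume "consistent M W \<sigma> K r f"
  then obtain h tests where h: "bandwidths r h"
    and gt: "generated_tests (\<lambda>n. kernel_statistic K \<sigma> n (h n)) tests"
    and ls: "limsup (\<lambda>n. ereal (type_I_error M W \<sigma> n (tests n) + type_II_error M W \<sigma> n (tests n) (f n))) < 1"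
    unfolding consistent_def by blast
  obtain c where c: "\<And>n. n \<ge> 1 \<Longrightarrow> type_I_error M W \<sigma> n (tests n) + type_II_error M W \<sigma> n (tests n) (f n) = error_sum n (h n) (f n) (c n)"
    using generated_tests_errors[OF gt, where f=f] by blast
  obtain v :: real where v: "limsup (\<lambda>n. ereal (type_I_error M W \<sigma> n (tests n) + type_II_error M W \<sigma> n (tests n) (f n))) < ereal v" "ereal v < 1"
    using ereal_dense2[OF ls] by blast
  have ev: "eventually (\<lambda>n. type_I_error M W \<sigma> n (tests n) + type_II_error M W \<sigma> n (tests n) (f n) < v) sequentially"
    using Limsup_lessD[OF v(1)] by simp
  have "1 - v > 0" using v(2) by (simp add: one_ereal_def)
  from error_sum_near_one[OF h r f this] obtain \<epsilon> where \<epsilon>: "\<epsilon> > 0"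
    "eventually (\<lambda>n. shift h f n \<le> \<epsilon> \<longrightarrow> (\<forall>c. error_sum n (h n) (f n) c > 1 - (1 - v))) sequentially" by blast
  have "\<epsilon> / 2 > 0" using \<epsilon> by simp
  from shift_le_energy[OF h f B this] obtain d k where d: "d > 0" "k > 0" "\<And>n. n \<ge> 1 \<Longrightarrow> shift h f n \<le> k * energy r f d n + \<epsilon> / 2"
    by blast
  have "eventually (\<lambda>n. energy r f d n \<ge> \<epsilon> / (2 * k)) sequentially"
    using ev \<epsilon>(2) eventually_ge_at_top[of 1]
  proof eventually_elim
    case (elim n)
    have "shift h f n > \<epsilon>"
    proof (rule ccontr)
      assume "\<not> shift h f n > \<epsilon>"
      then have "error_sum n (h n) (f n) (c n) > v" using elim(2) by simp
      with elim(1) c[OF elim(3)] show False by simp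
    qed
    then have "k * energy r f d n \<ge> \<epsilon> / 2" using d(3)[OF elim(3)] by linarith
    then show ?case using d(2) by (simp add: field_simps)
  qed
  moreover have "\<epsilon> / (2 * k) > 0" using \<epsilon> d by simp
  ultimately show "\<exists>c>0. \<exists>\<epsilon>>0. eventually (\<lambda>n. energy r f c n \<ge> \<epsilon>) sequentially" using d(1) by blast
next
  assume "\<exists>c>0. \<exists>\<epsilon>>0. eventually (\<lambda>n. energy r f c n \<ge> \<epsilon>) sequentially"
  then obtain c \<epsilon> where c: "c > 0" and \<epsilon>: "\<epsilon> > 0" "eventually (\<lambda>n. energy r f c n \<ge> \<epsilon>) sequentially" by blast
  obtain k where k: "k > 0" "\<And>n. n \<ge> 1 \<Longrightarrow> shift (tuned r c) f n \<ge> k * energy r f c n"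
    using tuned_shift_ge[OF f c] by blast
  define v where "v = 1 - gain (k * \<epsilon>) / 2"
  have ke: "k * \<epsilon> > 0" using k \<epsilon> by simp
  have v1: "v < 1" using gain_pos[OF ke] by (simp add: v_def)
  note bw = tuned_bandwidths[OF c, of r]
  have "eventually (\<lambda>n. ereal (type_I_error M W \<sigma> n (best_tests (tuned r c) f v n) + type_II_error M W \<sigma> n (best_tests (tuned r c) f v n) (f n)) \<le> ereal v) sequentially"
    using error_sum_below_one[OF bw r f ke] \<epsilon>(2) eventually_ge_at_top[of 1]
  proof eventually_elim
    case (elim n)
    have "k * \<epsilon> \<le> k * energy r f c n" using elim(2) k(1) by (intro mult_left_mono) auto
    with elim k(2)[OF elim(3)] have "\<exists>c'. error_sum n (tuned r c n) (f n) c' \<le> v" by (simp add: v_def)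
    then show ?case by (simp only: ereal_less_eq best_tests_errors)
  qed
  then have "limsup (\<lambda>n. ereal (type_I_error M W \<sigma> n (best_tests (tuned r c) f v n) + type_II_error M W \<sigma> n (best_tests (tuned r c) f v n) (f n))) \<le> ereal v"
    by (rule Limsup_bounded)
  also have "ereal v < 1" using v1 by (simp add: one_ereal_def)
  finally show "consistent M W \<sigma> K r f"
    unfolding consistent_def using bw best_tests_generated by blast
qed

text \<open>The forward direction argues at single indices: whenever the energy at \<open>c\<close>
  is at least \<epsilon> and n is large, the best test for the tuned bandwidth has error sum at most
  v < 1, which the liminf excludes eventually. In the converse \<open>d\<close> is chosen after the
  bandwidths, so vanishing at every \<open>c\<close> is the right condition.\<close>

theorem inconsistent_iff_energy:
  assumes r: "r < 1 / 2" and f: "\<forall>n\<ge>1. f n \<in> L2_per"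
    and B: "\<And>n. n \<ge> 1 \<Longrightarrow> (L2_norm (f n))\<^sup>2 * real n powr (2 * r) \<le> B"
  shows "inconsistent M W \<sigma> K r f \<longleftrightarrow> (\<forall>c>0. energy r f c \<longlonglongrightarrow> 0)"
proof
  assume inc: "inconsistent M W \<sigma> K r f"
  show "\<forall>c>0. energy r f c \<longlonglongrightarrow> 0"
  proof (intro allI impI order_tendstoI)
    fix c a :: real assume "c > 0" "a < 0"
    show "eventually (\<lambda>n. a < energy r f c n) sequentially"
      using \<open>a < 0\<close> energy_nonneg by (intro always_eventually allI) (rule less_le_trans)
  next
    fix c \<epsilon> :: real assume c: "c > 0" and \<epsilon>: "0 < \<epsilon>"
    obtain k where k: "k > 0" "\<And>n. n \<ge> 1 \<Longrightarrow> shift (tuned r c) f n \<ge> k * energy r f c n"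
      using tuned_shift_ge[OF f c] by blast
    have ke: "k * \<epsilon> > 0" using k \<epsilon> by simp
    define v where "v = 1 - gain (k * \<epsilon>) / 2"
    have v1: "ereal v < 1" using gain_pos[OF ke] by (simp add: v_def one_ereal_def)
    note bw = tuned_bandwidths[OF c, of r]
    have "1 \<le> liminf (\<lambda>n. ereal (type_I_error M W \<sigma> n (best_tests (tuned r c) f v n) + type_II_error M W \<sigma> n (best_tests (tuned r c) f v n) (f n)))"
      using inc bw best_tests_generated unfolding inconsistent_def by blast
    then have "eventually (\<lambda>n. ereal v < ereal (type_I_error M W \<sigma> n (best_tests (tuned r c) f v n) + type_II_error M W \<sigma> n (best_tests (tuned r c) f v n) (f n))) sequentially"
      using v1 unfolding le_Liminf_iff by blast
    then show "eventually (\<lambda>n. energy r f c n < \<epsilon>) sequentially"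
      using error_sum_below_one[OF bw r f ke] eventually_ge_at_top[of 1]
    proof eventually_elim
      case (elim n)
      show ?case
      proof (rule ccontr)
        assume "\<not> energy r f c n < \<epsilon>"
        then have "k * \<epsilon> \<le> k * energy r f c n" using k(1) by (intro mult_left_mono) auto
        with elim(2) k(2)[OF elim(3)] have "\<exists>c'. error_sum n (tuned r c n) (f n) c' \<le> v" by (simp add: v_def)
        then have "type_I_error M W \<sigma> n (best_tests (tuned r c) f v n) + type_II_error M W \<sigma> n (best_tests (tuned r c) f v n) (f n) \<le> v"
          by (rule best_tests_errors)
        with elim(1) show False by simp
      qed
    qed
  qed
next
  assume E: "\<forall>c>0. energy r f c \<longlonglongrightarrow> 0"
  show "inconsistent M W \<sigma> K r f"
    unfolding inconsistent_def le_Liminf_iff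
  proof (intro allI impI)
    fix h tests and y :: ereal
    assume h: "bandwidths r h" and gt: "generated_tests (\<lambda>n. kernel_statistic K \<sigma> n (h n)) tests" and "y < 1"
    obtain v :: real where v: "y < ereal v" "ereal v < 1" using ereal_dense2[OF \<open>y < 1\<close>] by blast
    have "1 - v > 0" using v(2) by (simp add: one_ereal_def)
    from error_sum_near_one[OF h r f this] obtain \<epsilon> where \<epsilon>: "\<epsilon> > 0"
      "eventually (\<lambda>n. shift h f n \<le> \<epsilon> \<longrightarrow> (\<forall>c. error_sum n (h n) (f n) c > 1 - (1 - v))) sequentially" by blast
    have "\<epsilon> / 2 > 0" using \<epsilon> by simp
    from shift_le_energy[OF h f B this] obtain d k where d: "d > 0" "k > 0" "\<And>n. n \<ge> 1 \<Longrightarrow> shift h f n \<le> k * energy r f d n + \<epsilon> / 2"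
      by blast
    have "energy r f d \<longlonglongrightarrow> 0" using E d(1) by blast
    then have "eventually (\<lambda>n. energy r f d n < \<epsilon> / (2 * k)) sequentially"
      using \<epsilon> d by (intro order_tendstoD(2)) auto
    obtain c where c: "\<And>n. n \<ge> 1 \<Longrightarrow> type_I_error M W \<sigma> n (tests n) + type_II_error M W \<sigma> n (tests n) (f n) = error_sum n (h n) (f n) (c n)"
      using generated_tests_errors[OF gt, where f=f] by blast
    show "eventually (\<lambda>n. y < ereal (type_I_error M W \<sigma> n (tests n) + type_II_error M W \<sigma> n (tests n) (f n))) sequentially"
      using \<open>eventually (\<lambda>n. energy r f d n < \<epsilon> / (2 * k)) sequentially\<close> \<epsilon>(2) eventually_ge_at_top[of 1]
    proof eventually_elim
      case (elim n)
      have "k * energy r f d n \<le> \<epsilon> / 2" using elim(1) d(2) by (simp add: field_simps)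
      then have "shift h f n \<le> \<epsilon>" using d(3)[OF elim(3)] by linarith
      then have "error_sum n (h n) (f n) (c n) > v" using elim(2) by simp
      then have "ereal v < ereal (type_I_error M W \<sigma> n (tests n) + type_II_error M W \<sigma> n (tests n) (f n))"
        using c[OF elim(3)] by simp
      with v(1) show ?case by (rule less_trans)
    qed
  qed
qed

end

subsection \<open>Maxisets\<close>

lemma same_order_norm_iff:
  "same_order (\<lambda>n. L2_norm (g n)) (\<lambda>n. real n powr (- r)) \<longleftrightarrow>
    (\<exists>a b. 0 < a \<and> (\<forall>n\<ge>1. a \<le> (L2_norm (g n))\<^sup>2 * real n powr (2 * r) \<and> (L2_norm (g n))\<^sup>2 * real n powr (2 * r) \<le> b))"
proof
  assume "same_order (\<lambda>n. L2_norm (g n)) (\<lambda>n. real n powr (- r))"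
  then obtain c C where cC: "0 < c" "c \<le> C"
    "\<And>n. n \<ge> 1 \<Longrightarrow> c * real n powr (- r) \<le> L2_norm (g n)" "\<And>n. n \<ge> 1 \<Longrightarrow> L2_norm (g n) \<le> C * real n powr (- r)"
    unfolding same_order_def by blast
  have "c\<^sup>2 \<le> (L2_norm (g n))\<^sup>2 * real n powr (2 * r) \<and> (L2_norm (g n))\<^sup>2 * real n powr (2 * r) \<le> C\<^sup>2" if n: "n \<ge> 1" for n
  proof -
    have e: "x\<^sup>2 = (x * real n powr (- r))\<^sup>2 * real n powr (2 * r)" for x
      using rate_powr(1)[OF n, of r] by (simp add: power_mult_distrib mult.assoc)
    have "(c * real n powr (- r))\<^sup>2 \<le> (L2_norm (g n))\<^sup>2" "(L2_norm (g n))\<^sup>2 \<le> (C * real n powr (- r))\<^sup>2"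
      using cC n by (intro power_mono; simp add: L2_norm_nonneg)+
    then show ?thesis unfolding e[of c] e[of C] by (intro conjI mult_right_mono) auto
  qed
  then show "\<exists>a b. 0 < a \<and> (\<forall>n\<ge>1. a \<le> (L2_norm (g n))\<^sup>2 * real n powr (2 * r) \<and> (L2_norm (g n))\<^sup>2 * real n powr (2 * r) \<le> b)"
    using cC(1) by (intro exI[of _ "c\<^sup>2"] exI[of _ "C\<^sup>2"]) auto
next
  assume "\<exists>a b. 0 < a \<and> (\<forall>n\<ge>1. a \<le> (L2_norm (g n))\<^sup>2 * real n powr (2 * r) \<and> (L2_norm (g n))\<^sup>2 * real n powr (2 * r) \<le> b)"
  then obtain a b where ab: "0 < a" "\<And>n. n \<ge> 1 \<Longrightarrow> a \<le> (L2_norm (g n))\<^sup>2 * real n powr (2 * r)"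
    "\<And>n. n \<ge> 1 \<Longrightarrow> (L2_norm (g n))\<^sup>2 * real n powr (2 * r) \<le> b" by blast
  have "a \<le> b" using ab(2)[of 1] ab(3)[of 1] by simp
  have "sqrt a * real n powr (- r) \<le> L2_norm (g n) \<and> L2_norm (g n) \<le> sqrt b * real n powr (- r)" if n: "n \<ge> 1" for n
  proof -
    define p where "p = real n powr (- r)"
    have p: "p \<ge> 0" "p\<^sup>2 * real n powr (2 * r) = 1" using rate_powr(1)[OF n, of r] by (auto simp: p_def)
    have e: "(L2_norm (g n))\<^sup>2 = ((L2_norm (g n))\<^sup>2 * real n powr (2 * r)) * p\<^sup>2"
      using p(2) by (simp add: mult_ac)
    have "a * p\<^sup>2 \<le> (L2_norm (g n))\<^sup>2" "(L2_norm (g n))\<^sup>2 \<le> b * p\<^sup>2"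
      using ab(2,3)[OF n] by (subst e, intro mult_right_mono, auto)+
    then have "sqrt (a * p\<^sup>2) \<le> L2_norm (g n)" "L2_norm (g n) \<le> sqrt (b * p\<^sup>2)"
      by (auto intro: real_le_lsqrt real_le_rsqrt simp: L2_norm_nonneg)
    then show ?thesis using p(1) by (simp add: real_sqrt_mult p_def)
  qed
  moreover have "0 < sqrt a" "sqrt a \<le> sqrt b" using \<open>0 < a\<close> \<open>a \<le> b\<close> by auto
  ultimately show "same_order (\<lambda>n. L2_norm (g n)) (\<lambda>n. real n powr (- r))"
    unfolding same_order_def by blast
qed

context kernel_noise
begin

text \<open>The component must have norm of order n^(-r) for every n \<ge> 1, not only eventually.
  By Parseval a larger \<open>c\<close> captures half the energy of each of the finitely many early
  functions, and enlarging \<open>c\<close> never lowers the energy.\<close>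

lemma energy_complete:
  assumes f: "\<forall>n\<ge>1. f n \<in> L2_per" and a: "a > 0" "\<And>n. n \<ge> 1 \<Longrightarrow> a \<le> (L2_norm (f n))\<^sup>2 * real n powr (2 * r)"
    and r: "r < 1 / 2" and c: "c > 0" "\<epsilon> > 0" "eventually (\<lambda>n. energy r f c n \<ge> \<epsilon>) sequentially"
  shows "\<exists>c>0. \<exists>\<epsilon>>0. \<forall>n\<ge>1. energy r f c n \<ge> \<epsilon>"
proof -
  obtain n0 where n0: "\<And>n. n \<ge> n0 \<Longrightarrow> energy r f c n \<ge> \<epsilon>"
    using c(3) by (auto simp: eventually_sequentially)
  have "\<exists>d. n \<ge> 1 \<longrightarrow> (\<forall>x\<ge>d. low_energy (f n) x \<ge> (L2_norm (f n))\<^sup>2 / 2)" for n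
  proof (cases "n \<ge> 1")
    case True
    have "(L2_norm (f n))\<^sup>2 > 0"
      using a(1) a(2)[OF True] zero_le_power2[of "L2_norm (f n)"] by (cases "L2_norm (f n) = 0") auto
    then have "(L2_norm (f n))\<^sup>2 / 2 > 0" by simp
    from Parseval_L2_per[OF _ this] f True obtain d where d: "\<And>x. x \<ge> d \<Longrightarrow> (L2_norm (f n))\<^sup>2 - low_energy (f n) x < (L2_norm (f n))\<^sup>2 / 2"
      by blast
    have "low_energy (f n) x \<ge> (L2_norm (f n))\<^sup>2 / 2" if "x \<ge> d" for x using d[OF that] by linarith
    then show ?thesis by blast
  qed simp
  then obtain d where d: "\<And>n x. n \<ge> 1 \<Longrightarrow> x \<ge> d n \<Longrightarrow> low_energy (f n) x \<ge> (L2_norm (f n))\<^sup>2 / 2" by metis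
  define c' where "c' = c + (\<Sum>n<n0. \<bar>d n\<bar>)"
  have S0: "(\<Sum>n<n0. \<bar>d n\<bar>) \<ge> 0" by (simp add: sum_nonneg)
  have c'1: "c' \<ge> c" using S0 by (simp add: c'_def)
  have c': "c' \<ge> c" "c' > 0" using c'1 less_le_trans[OF c(1) c'1] by auto
  have "energy r f c' n \<ge> min \<epsilon> (a / 2)" if n: "n \<ge> 1" for n
  proof (cases "n \<ge> n0")
    case True
    then show ?thesis using n0[of n] energy_mono[OF c'(1), of r f n] by linarith
  next
    case False
    have "\<bar>d n\<bar> \<le> (\<Sum>n<n0. \<bar>d n\<bar>)" using False by (intro member_le_sum) auto
    then have "d n \<le> c'" using c(1) by (simp add: c'_def)
    also have "c' \<le> c' * real n powr (2 - 4 * r)"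
      using c'(2) n r ge_one_powr_ge_zero[of "real n" "2 - 4 * r"] by simp
    finally have "low_energy (f n) (c' * real n powr (2 - 4 * r)) \<ge> (L2_norm (f n))\<^sup>2 / 2" by (rule d[OF n])
    then have "energy r f c' n \<ge> (L2_norm (f n))\<^sup>2 / 2 * real n powr (2 * r)"
      unfolding energy_def by (intro mult_right_mono) auto
    then show ?thesis using a(2)[OF n] by simp
  qed
  then show ?thesis using c' a c by (intro exI[of _ c'] conjI exI[of _ "min \<epsilon> (a / 2)"]) auto
qed

text \<open>Solves \<gamma>^2 P0 = c^(2 s) b, the requirement of \<open>proj_in_scaled_ball\<close>
  once the powers of n have cancelled.\<close>

definition ball_scale :: "real \<Rightarrow> real \<Rightarrow> real \<Rightarrow> real \<Rightarrow> real" where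
  "ball_scale s P\<^sub>0 b c = sqrt (c powr (2 * s) * b / P\<^sub>0)"

lemma ball_scale_pos: "c > 0 \<Longrightarrow> b > 0 \<Longrightarrow> P\<^sub>0 > 0 \<Longrightarrow> ball_scale s P\<^sub>0 b c > 0"
  by (simp add: ball_scale_def)

text \<open>The relation (2 - 4 r) 2 s = 2 r turns the Besov weight at the truncation frequency into
  a constant times n^(2 r), which the squared norm compensates.\<close>

lemma truncation_in_ball:
  assumes f: "f n \<in> L2_per" and n: "n \<ge> 1" and c: "c > 0" and b: "b > 0" "(L2_norm (f n))\<^sup>2 * real n powr (2 * r) \<le> b"
    and r: "0 < r" "r < 1 / 2" and s: "s = r / (2 - 4 * r)" and P: "P\<^sub>0 > 0"
  shows "proj (c * real n powr (2 - 4 * r)) (f n) \<in> scale_set (ball_scale s P\<^sub>0 b c) (besov_ball s P\<^sub>0)"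
proof (rule proj_in_scaled_ball[OF f ball_scale_pos[OF c b(1) P] _ P])
  show "s > 0" using r s by simp
  have "(2 - 4 * r) * (2 * s) = 2 * (s * (2 - 4 * r))" by (simp only: mult_ac)
  also have "s * (2 - 4 * r) = r" using r s by simp
  finally have e: "(2 - 4 * r) * (2 * s) = 2 * r" .
  have "(c * real n powr (2 - 4 * r)) powr (2 * s) = c powr (2 * s) * real n powr (2 * r)"
    using c by (simp add: powr_mult powr_powr e)
  then have "(c * real n powr (2 - 4 * r)) powr (2 * s) * (L2_norm (f n))\<^sup>2 = c powr (2 * s) * ((L2_norm (f n))\<^sup>2 * real n powr (2 * r))"
    by (simp add: mult_ac)
  also have "\<dots> \<le> c powr (2 * s) * b" using b by (intro mult_left_mono) auto
  also have "\<dots> = (ball_scale s P\<^sub>0 b c)\<^sup>2 * P\<^sub>0"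
    using b P by (simp add: ball_scale_def)
  finally show "(c * real n powr (2 - 4 * r)) powr (2 * s) * (L2_norm (f n))\<^sup>2 \<le> (ball_scale s P\<^sub>0 b c)\<^sup>2 * P\<^sub>0" .
qed

text \<open>The same exponent identity read in the other direction: the tail beyond
  \<open>c * n powr (2 - 4 * r)\<close> is of order n^(-2 r), with a factor that vanishes as c
  grows.\<close>

lemma ball_tail_rate:
  assumes g: "g n \<in> scale_set \<gamma> (besov_ball s P\<^sub>0)" and n: "n \<ge> 1" and c: "c > 0"
    and r: "0 < r" "r < 1 / 2" and s: "s = r / (2 - 4 * r)"
  shows "(L2_norm (g n))\<^sup>2 * real n powr (2 * r) - energy r g c n \<le> \<gamma>\<^sup>2 * P\<^sub>0 * c powr (- 2 * s)"
proof -
  have "(2 - 4 * r) * (2 * s) = 2 * (s * (2 - 4 * r))" by (simp only: mult_ac)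
  also have "s * (2 - 4 * r) = r" using r s by simp
  finally have e: "(2 - 4 * r) * (2 * s) = 2 * r" .
  have l: "c * real n powr (2 - 4 * r) > 0" using c n by simp
  have "(c * real n powr (2 - 4 * r)) powr (- 2 * s) = c powr (- 2 * s) * real n powr (- (2 * r))"
  proof -
    have "(c * real n powr (2 - 4 * r)) powr (- 2 * s) = c powr (- 2 * s) * real n powr ((2 - 4 * r) * (- 2 * s))"
      using c by (simp add: powr_mult powr_powr)
    also have "(2 - 4 * r) * (- 2 * s) = - (2 * r)" using e by simp
    finally show ?thesis .
  qed
  then have "(L2_norm (g n))\<^sup>2 - low_energy (g n) (c * real n powr (2 - 4 * r)) \<le> \<gamma>\<^sup>2 * P\<^sub>0 * (c powr (- 2 * s) * real n powr (- (2 * r)))"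
    using scaled_ball_tail(2)[OF g l] by simp
  then have "((L2_norm (g n))\<^sup>2 - low_energy (g n) (c * real n powr (2 - 4 * r))) * real n powr (2 * r)
    \<le> (\<gamma>\<^sup>2 * P\<^sub>0 * (c powr (- 2 * s) * real n powr (- (2 * r)))) * real n powr (2 * r)"
    by (intro mult_right_mono) auto
  also have "\<dots> = \<gamma>\<^sup>2 * P\<^sub>0 * c powr (- 2 * s)"
    using n by (simp add: powr_minus field_simps)
  finally show ?thesis by (simp add: energy_def left_diff_distrib)
qed

lemma ball_tail_small:
  assumes "0 < s" "\<tau> > 0" "A > 0" shows "\<exists>c>0. A * c powr (- 2 * s) = (\<tau>::real)"
proof (intro exI conjI)
  show "(\<tau> / A) powr (- 1 / (2 * s)) > 0" using assms by simp
  have "((\<tau> / A) powr (- 1 / (2 * s))) powr (- 2 * s) = (\<tau> / A) powr ((- 1 / (2 * s)) * (- 2 * s))"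
    by (rule powr_powr)
  also have "(- 1 / (2 * s)) * (- 2 * s) = 1" using assms by simp
  finally show "A * ((\<tau> / A) powr (- 1 / (2 * s))) powr (- 2 * s) = \<tau>" using assms by simp
qed

text \<open>Normalized form of \<open>L2_inner_low_bound\<close>: the factor n^(2 r) is shared
  evenly between the two functions under the square roots.\<close>

lemma inner_rate_bound:
  assumes f: "f n \<in> L2_per" and g: "g n \<in> L2_per"
    and b: "(L2_norm (f n))\<^sup>2 * real n powr (2 * r) \<le> b" and b1: "(L2_norm (g n))\<^sup>2 * real n powr (2 * r) \<le> b1"
    and t: "(L2_norm (g n))\<^sup>2 * real n powr (2 * r) - energy r g c n \<le> t"
  shows "\<bar>L2_inner (f n) (g n)\<bar> * real n powr (2 * r) \<le> sqrt (energy r f c n * b1) + sqrt (b * t)"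
proof -
  let ?l = "c * real n powr (2 - 4 * r)"
  define q where "q = real n powr (2 * r)"
  have q: "q \<ge> 0" by (simp add: q_def)
  have "\<bar>L2_inner (f n) (g n)\<bar> \<le> sqrt (low_energy (f n) ?l) * sqrt (low_energy (g n) ?l) + L2_norm (f n) * sqrt ((L2_norm (g n))\<^sup>2 - low_energy (g n) ?l)"
    by (rule L2_inner_low_bound[OF f g])
  then have "\<bar>L2_inner (f n) (g n)\<bar> * q \<le> (sqrt (low_energy (f n) ?l) * sqrt (low_energy (g n) ?l) + L2_norm (f n) * sqrt ((L2_norm (g n))\<^sup>2 - low_energy (g n) ?l)) * q"
    using q by (rule mult_right_mono)
  also have "\<dots> = sqrt ((low_energy (f n) ?l * q) * (low_energy (g n) ?l * q)) + sqrt (((L2_norm (f n))\<^sup>2 * q) * (((L2_norm (g n))\<^sup>2 - low_energy (g n) ?l) * q))"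
  proof -
    have sq: "sqrt ((x * q) * (y * q)) = sqrt x * sqrt y * q" for x y
    proof -
      have "(x * q) * (y * q) = x * y * q\<^sup>2" by (simp add: power2_eq_square)
      then show ?thesis using q by (simp add: real_sqrt_mult)
    qed
    show ?thesis unfolding sq by (simp add: distrib_right L2_norm_nonneg)
  qed
  also have "\<dots> \<le> sqrt (energy r f c n * b1) + sqrt (b * t)"
  proof (intro add_mono real_sqrt_le_mono mult_mono)
    show "low_energy (f n) ?l * q \<le> energy r f c n" by (simp add: energy_def q_def)
    show "low_energy (g n) ?l * q \<le> b1"
      using b1 mult_right_mono[OF low_energy_le_norm[OF g, of ?l] q] by (simp add: q_def)
    show "(L2_norm (f n))\<^sup>2 * q \<le> b" using b by (simp add: q_def)
    show "((L2_norm (g n))\<^sup>2 - low_energy (g n) ?l) * q \<le> t" using t by (simp add: energy_def q_def left_diff_distrib)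
    show "0 \<le> b" using b by (rule order_trans[rotated]) simp
    show "0 \<le> ((L2_norm (g n))\<^sup>2 - low_energy (g n) ?l) * q" using low_energy_le_norm[OF g, of ?l] q by simp
  qed (simp_all add: energy_nonneg low_energy_nonneg q)
  finally show ?thesis by (simp add: q_def)
qed

text \<open>Coefficientwise y^2 / 2 - x^2 \<le> (x + y)^2, because the difference is (2 x + y)^2 /
  2.\<close>

lemma low_energy_add_ge:
  assumes "f \<in> L2_per" "g \<in> L2_per"
  shows "low_energy (\<lambda>t. f t + g t) c \<ge> low_energy g c / 2 - low_energy f c"
proof -
  have "low_energy g c / 2 - low_energy f c = (\<Sum>j\<in>low c. (hartley g j)\<^sup>2 / 2 - (hartley f j)\<^sup>2)"
    by (simp add: low_energy_def sum_subtractf sum_divide_distrib)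
  also have "\<dots> \<le> low_energy (\<lambda>t. f t + g t) c"
    unfolding low_energy_def
  proof (rule sum_mono)
    fix j
    have "0 \<le> (2 * hartley f j + hartley g j)\<^sup>2" by simp
    then show "(hartley g j)\<^sup>2 / 2 - (hartley f j)\<^sup>2 \<le> (hartley (\<lambda>t. f t + g t) j)\<^sup>2"
      unfolding hartley_add[OF assms] by (simp add: power2_eq_square algebra_simps)
  qed
  finally show ?thesis .
qed

section \<open>The implications between testing and decomposition for a fixed sequence\<close>

context
  fixes r s P\<^sub>0 :: real and f :: "nat \<Rightarrow> real \<Rightarrow> real" and a b :: real
  assumes r: "0 < r" "r < 1 / 2" and s: "s = r / (2 - 4 * r)" and P: "P\<^sub>0 > 0"
    and f: "\<forall>n\<ge>1. f n \<in> L2_per"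
    and a: "0 < a" "\<And>n. n \<ge> 1 \<Longrightarrow> a \<le> (L2_norm (f n))\<^sup>2 * real n powr (2 * r)"
    and b: "\<And>n. n \<ge> 1 \<Longrightarrow> (L2_norm (f n))\<^sup>2 * real n powr (2 * r) \<le> b"
begin

lemma s_pos: "s > 0" using r s by simp

lemma b_pos: "b > 0" using a(1) a(2)[of 1] b[of 1] by simp

lemma inconsistent_iff: "inconsistent M W \<sigma> K r f \<longleftrightarrow> (\<forall>c>0. energy r f c \<longlonglongrightarrow> 0)"
  by (rule inconsistent_iff_energy[OF r(2) f b])

text \<open>The component is the truncation of \<open>f n\<close> at a frequency below which its
  energy is bounded from below; truncation and remainder are orthogonal, which is the Pythagorean
  identity.\<close>

lemma consistent_imp_component:
  assumes "consistent M W \<sigma> K r f"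
  shows "\<exists>\<gamma>>0. \<exists>f1. (\<forall>n\<ge>1. f1 n \<in> scale_set \<gamma> (besov_ball s P\<^sub>0)) \<and>
    same_order (\<lambda>n. L2_norm (f1 n)) (\<lambda>n. real n powr (- r)) \<and>
    (\<forall>n\<ge>1. (L2_norm (f n))\<^sup>2 = (L2_norm (f1 n))\<^sup>2 + (L2_norm (\<lambda>t. f n t - f1 n t))\<^sup>2)"
proof -
  obtain c0 \<epsilon>0 where "c0 > 0" "\<epsilon>0 > 0" "eventually (\<lambda>n. energy r f c0 n \<ge> \<epsilon>0) sequentially"
    using assms consistent_iff_energy[OF r(2) f b] by blast
  from energy_complete[OF f a r(2) this] obtain c \<epsilon> where c: "c > 0" "\<epsilon> > 0" "\<And>n. n \<ge> 1 \<Longrightarrow> energy r f c n \<ge> \<epsilon>"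
    by blast
  define f1 where "f1 n = proj (c * real n powr (2 - 4 * r)) (f n)" for n
  have e: "(L2_norm (f1 n))\<^sup>2 * real n powr (2 * r) = energy r f c n" for n
    by (simp add: f1_def L2_norm_proj energy_def)
  have le: "energy r f c n \<le> b" if n: "n \<ge> 1" for n
  proof -
    have "energy r f c n \<le> (L2_norm (f n))\<^sup>2 * real n powr (2 * r)"
      unfolding energy_def using f n by (intro mult_right_mono low_energy_le_norm) auto
    with b[OF n] show ?thesis by simp
  qed
  have "f1 n \<in> scale_set (ball_scale s P\<^sub>0 b c) (besov_ball s P\<^sub>0)" if "n \<ge> 1" for n
    unfolding f1_def by (rule truncation_in_ball[where n=n and f=f, OF _ that c(1) b_pos b[OF that] r s P]) (use f that in blast)
  moreover have "same_order (\<lambda>n. L2_norm (f1 n)) (\<lambda>n. real n powr (- r))"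
    unfolding same_order_norm_iff e using c le by blast
  moreover have "(L2_norm (f n))\<^sup>2 = (L2_norm (f1 n))\<^sup>2 + (L2_norm (\<lambda>t. f n t - f1 n t))\<^sup>2" if "n \<ge> 1" for n
    using L2_norm_diff_proj[of "f n"] f that by (simp add: f1_def L2_norm_proj)
  ultimately show ?thesis using ball_scale_pos[OF c(1) b_pos P] by blast
qed

text \<open>The Pythagorean identity says that the inner product of \<open>f n\<close> and
  \<open>f1 n\<close> equals the squared norm of \<open>f1 n\<close>. The tail of
  \<open>f1 n\<close> can account for only part of it, so the low frequencies of \<open>f n\<close>
  must carry the rest.\<close>

lemma component_imp_consistent:
  assumes \<gamma>: "\<gamma> > 0" and f1: "\<And>n. n \<ge> 1 \<Longrightarrow> f1 n \<in> scale_set \<gamma> (besov_ball s P\<^sub>0)"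
    and so: "same_order (\<lambda>n. L2_norm (f1 n)) (\<lambda>n. real n powr (- r))"
    and py: "\<And>n. n \<ge> 1 \<Longrightarrow> (L2_norm (f n))\<^sup>2 = (L2_norm (f1 n))\<^sup>2 + (L2_norm (\<lambda>t. f n t - f1 n t))\<^sup>2"
  shows "consistent M W \<sigma> K r f"
proof -
  obtain a1 b1 where a1: "0 < a1" "\<And>n. n \<ge> 1 \<Longrightarrow> a1 \<le> (L2_norm (f1 n))\<^sup>2 * real n powr (2 * r)"
    and b1: "\<And>n. n \<ge> 1 \<Longrightarrow> (L2_norm (f1 n))\<^sup>2 * real n powr (2 * r) \<le> b1"
    using so unfolding same_order_norm_iff by blast
  have b1p: "b1 > 0" using a1(1) a1(2)[of 1] b1[of 1] by simp
  \<comment> \<open>The tail level for which the high-frequency term sqrt (b \<tau>) is half of the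
    lower bound a1.\<close>
  define \<tau> where "\<tau> = (a1 / 2)\<^sup>2 / b"
  have \<tau>: "\<tau> > 0" "sqrt (b * \<tau>) = a1 / 2" using a1(1) b_pos by (simp_all add: \<tau>_def)
  have "\<gamma>\<^sup>2 * P\<^sub>0 > 0" using \<gamma> P by simp
  from ball_tail_small[OF s_pos \<tau>(1) this] obtain c where c: "c > 0" "\<gamma>\<^sup>2 * P\<^sub>0 * c powr (- 2 * s) = \<tau>" by blast
  have en: "energy r f c n \<ge> (a1 / 2)\<^sup>2 / b1" if n: "n \<ge> 1" for n
  proof -
    have fn: "f n \<in> L2_per" using f n by blast
    have f1n: "f1 n \<in> L2_per" by (rule scaled_ball_tail(1)[OF f1[OF n], of 1]) simp
    have "L2_inner (f n) (f1 n) = (L2_norm (f1 n))\<^sup>2"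
      using py[OF n] L2_norm_diff_power2[OF fn f1n] by simp
    then have "a1 \<le> \<bar>L2_inner (f n) (f1 n)\<bar> * real n powr (2 * r)" using a1(2)[OF n] by simp
    also have "\<dots> \<le> sqrt (energy r f c n * b1) + sqrt (b * \<tau>)"
      using ball_tail_rate[of f1 n \<gamma> s P\<^sub>0, OF f1[OF n] n c(1) r s] unfolding c(2)
      by (intro inner_rate_bound fn f1n b n b1)
    finally have "a1 / 2 \<le> sqrt (energy r f c n * b1)" using \<tau>(2) by simp
    then have "(a1 / 2)\<^sup>2 \<le> (sqrt (energy r f c n * b1))\<^sup>2"
      using a1(1) by (intro power_mono) auto
    also have "\<dots> = energy r f c n * b1"
      using energy_nonneg[of r f c n] b1p by simp
    finally have "(a1 / 2)\<^sup>2 \<le> energy r f c n * b1" .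
    then show ?thesis using b1p by (simp add: pos_divide_le_eq)
  qed
  have "eventually (\<lambda>n. energy r f c n \<ge> (a1 / 2)\<^sup>2 / b1) sequentially"
    using eventually_ge_at_top[of 1] by eventually_elim (rule en)
  moreover have "(a1 / 2)\<^sup>2 / b1 > 0" using a1(1) b1p by simp
  ultimately show ?thesis
    using consistent_iff_energy[OF r(2) f b] c(1) by blast
qed

text \<open>The difference of the squared norms is twice the inner product, and dividing by n^(-2 r)
  multiplies it by n^(2 r).\<close>

lemma norm_sum_rate_iff:
  assumes f1: "\<And>n. n \<ge> 1 \<Longrightarrow> f1 n \<in> L2_per"
  shows "(\<lambda>n. (L2_norm (\<lambda>t. f n t + f1 n t))\<^sup>2 - ((L2_norm (f n))\<^sup>2 + (L2_norm (f1 n))\<^sup>2)) \<in> o(\<lambda>n. real n powr (- 2 * r))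
    \<longleftrightarrow> (\<lambda>n. \<bar>L2_inner (f n) (f1 n)\<bar> * real n powr (2 * r)) \<longlonglongrightarrow> 0" (is "?X \<in> o(?g) \<longleftrightarrow> _")
proof -
  have ev: "eventually (\<lambda>n. norm (?X n / ?g n) = 2 * (\<bar>L2_inner (f n) (f1 n)\<bar> * real n powr (2 * r))) sequentially"
    using eventually_ge_at_top[of 1]
  proof eventually_elim
    case (elim n)
    then have "?X n = 2 * L2_inner (f n) (f1 n)" using L2_norm_add_power2[of "f n" "f1 n"] f f1 by simp
    then show ?case using elim by (simp add: powr_minus divide_inverse abs_mult)
  qed
  have "?X \<in> o(?g) \<longleftrightarrow> (\<lambda>n. ?X n / ?g n) \<longlonglongrightarrow> 0"
  proof
    assume "?X \<in> o(?g)"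
    then show "(\<lambda>n. ?X n / ?g n) \<longlonglongrightarrow> 0" by (rule smalloD_tendsto)
  next
    assume "(\<lambda>n. ?X n / ?g n) \<longlonglongrightarrow> 0"
    then show "?X \<in> o(?g)"
      by (rule smalloI_tendsto) (use eventually_gt_at_top[of 0] in eventually_elim, simp)
  qed
  also have "\<dots> \<longleftrightarrow> (\<lambda>n. norm (?X n / ?g n)) \<longlonglongrightarrow> 0" by (rule tendsto_norm_zero_iff[symmetric])
  also have "\<dots> \<longleftrightarrow> (\<lambda>n. 2 * (\<bar>L2_inner (f n) (f1 n)\<bar> * real n powr (2 * r))) \<longlonglongrightarrow> 0"
    by (rule tendsto_cong[OF ev])
  also have "\<dots> \<longleftrightarrow> (\<lambda>n. \<bar>L2_inner (f n) (f1 n)\<bar> * real n powr (2 * r)) \<longlonglongrightarrow> 0"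
    using tendsto_mult_left_iff[of 2 "\<lambda>n. \<bar>L2_inner (f n) (f1 n)\<bar> * real n powr (2 * r)" 0] by simp
  finally show ?thesis .
qed

text \<open>Inconsistency empties the low frequencies of \<open>f n\<close>, while the ball keeps
  almost all of \<open>f1 n\<close> there. Hence the inner product is negligible, and the sum
  inherits the low-frequency energy of \<open>f1 n\<close>.\<close>

lemma inconsistent_imp_orthogonal:
  assumes inc: "inconsistent M W \<sigma> K r f" and \<gamma>: "\<gamma> > 0"
    and f1: "\<And>n. n \<ge> 1 \<Longrightarrow> f1 n \<in> scale_set \<gamma> (besov_ball s P\<^sub>0)"
    and so: "same_order (\<lambda>n. L2_norm (f1 n)) (\<lambda>n. real n powr (- r))"
  shows "consistent M W \<sigma> K r (\<lambda>n t. f n t + f1 n t)"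
    and "(\<lambda>n. (L2_norm (\<lambda>t. f n t + f1 n t))\<^sup>2 - ((L2_norm (f n))\<^sup>2 + (L2_norm (f1 n))\<^sup>2)) \<in> o(\<lambda>n. real n powr (- 2 * r))"
proof -
  have E: "energy r f c \<longlonglongrightarrow> 0" if "c > 0" for c
    using inc that inconsistent_iff by blast
  obtain a1 b1 where a1: "0 < a1" "\<And>n. n \<ge> 1 \<Longrightarrow> a1 \<le> (L2_norm (f1 n))\<^sup>2 * real n powr (2 * r)"
    and b1: "\<And>n. n \<ge> 1 \<Longrightarrow> (L2_norm (f1 n))\<^sup>2 * real n powr (2 * r) \<le> b1"
    using so unfolding same_order_norm_iff by blast
  have b1p: "b1 > 0" using a1(1) a1(2)[of 1] b1[of 1] by simp
  have f1L: "f1 n \<in> L2_per" if "n \<ge> 1" for n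
    by (rule scaled_ball_tail(1)[OF f1[OF that], of 1]) simp
  have fL: "f n \<in> L2_per" if "n \<ge> 1" for n using f that by blast
  have gP: "\<gamma>\<^sup>2 * P\<^sub>0 > 0" using \<gamma> P by simp
  have tail: "\<exists>c>0. \<forall>n\<ge>1. (L2_norm (f1 n))\<^sup>2 * real n powr (2 * r) - energy r f1 c n \<le> \<tau>" if "\<tau> > 0" for \<tau>
  proof -
    from ball_tail_small[OF s_pos that gP] obtain c where c: "c > 0" "\<gamma>\<^sup>2 * P\<^sub>0 * c powr (- 2 * s) = \<tau>" by blast
    have "(L2_norm (f1 n))\<^sup>2 * real n powr (2 * r) - energy r f1 c n \<le> \<tau>" if n: "n \<ge> 1" for n
      using ball_tail_rate[of f1 n \<gamma> s P\<^sub>0, OF f1[OF n] n c(1) r s] unfolding c(2) .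
    with c(1) show ?thesis by blast
  qed
  have "(\<lambda>n. \<bar>L2_inner (f n) (f1 n)\<bar> * real n powr (2 * r)) \<longlonglongrightarrow> 0"
  proof (rule order_tendstoI)
    fix e :: real assume "e < 0"
    then show "eventually (\<lambda>n. e < \<bar>L2_inner (f n) (f1 n)\<bar> * real n powr (2 * r)) sequentially"
      by (intro always_eventually allI) (rule less_le_trans, auto)
  next
    fix e :: real assume e: "0 < e"
    define \<tau> where "\<tau> = (e / 2)\<^sup>2 / b"
    have \<tau>: "\<tau> > 0" "sqrt (b * \<tau>) = e / 2" using e b_pos by (simp_all add: \<tau>_def)
    from tail[OF \<tau>(1)] obtain c where c: "c > 0" "\<And>n. n \<ge> 1 \<Longrightarrow> (L2_norm (f1 n))\<^sup>2 * real n powr (2 * r) - energy r f1 c n \<le> \<tau>"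
      by blast
    have "(\<lambda>n. sqrt (energy r f c n * b1)) \<longlonglongrightarrow> sqrt (0 * b1)"
      by (intro tendsto_intros E c)
    then have "eventually (\<lambda>n. sqrt (energy r f c n * b1) < e / 2) sequentially"
      using e by (intro order_tendstoD(2)) auto
    with eventually_ge_at_top[of 1]
    show "eventually (\<lambda>n. \<bar>L2_inner (f n) (f1 n)\<bar> * real n powr (2 * r) < e) sequentially"
    proof eventually_elim
      case (elim n)
      have "\<bar>L2_inner (f n) (f1 n)\<bar> * real n powr (2 * r) \<le> sqrt (energy r f c n * b1) + sqrt (b * \<tau>)"
        by (rule inner_rate_bound[OF fL f1L b b1 c(2)]) (use elim in auto)
      with elim \<tau>(2) show ?case by linarith
    qed
  qed
  then show "(\<lambda>n. (L2_norm (\<lambda>t. f n t + f1 n t))\<^sup>2 - ((L2_norm (f n))\<^sup>2 + (L2_norm (f1 n))\<^sup>2)) \<in> o(\<lambda>n. real n powr (- 2 * r))"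
    by (subst norm_sum_rate_iff[OF f1L])
  have g: "\<forall>n\<ge>1. (\<lambda>t. f n t + f1 n t) \<in> L2_per" using fL f1L L2_per_add by blast
  have gB: "(L2_norm (\<lambda>t. f n t + f1 n t))\<^sup>2 * real n powr (2 * r) \<le> 2 * b + 2 * b1" if n: "n \<ge> 1" for n
  proof -
    have "(L2_norm (\<lambda>t. f n t + f1 n t))\<^sup>2 \<le> 2 * (L2_norm (f n))\<^sup>2 + 2 * (L2_norm (f1 n))\<^sup>2"
      unfolding L2_norm_power2 by (intro sqint_add_bound L2_per_sqint fL f1L n)
    then have "(L2_norm (\<lambda>t. f n t + f1 n t))\<^sup>2 * real n powr (2 * r) \<le> (2 * (L2_norm (f n))\<^sup>2 + 2 * (L2_norm (f1 n))\<^sup>2) * real n powr (2 * r)"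
      by (rule mult_right_mono) simp
    then show ?thesis using b[OF n] b1[OF n] by (simp add: distrib_right mult.assoc)
  qed
  \<comment> \<open>Energy at least a1 / 2 of \<open>f1 n\<close>, halved by
    \<open>low_energy_add_ge\<close>, less a1 / 8 for \<open>f n\<close>, leaves a1 / 8.\<close>
  have "a1 / 2 > 0" using a1(1) by simp
  from tail[OF this] obtain c where c: "c > 0" "\<And>n. n \<ge> 1 \<Longrightarrow> (L2_norm (f1 n))\<^sup>2 * real n powr (2 * r) - energy r f1 c n \<le> a1 / 2"
    by blast
  have "eventually (\<lambda>n. energy r f c n < a1 / 8) sequentially"
    using E[OF c(1)] a1(1) by (intro order_tendstoD(2)) auto
  with eventually_ge_at_top[of 1]
  have "eventually (\<lambda>n. energy r (\<lambda>n t. f n t + f1 n t) c n \<ge> a1 / 8) sequentially"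
  proof eventually_elim
    case (elim n)
    have "(low_energy (f1 n) (c * real n powr (2 - 4 * r)) / 2 - low_energy (f n) (c * real n powr (2 - 4 * r))) * real n powr (2 * r)
      \<le> energy r (\<lambda>n t. f n t + f1 n t) c n"
      unfolding energy_def using elim by (intro mult_right_mono low_energy_add_ge fL f1L) auto
    then have "energy r f1 c n / 2 - energy r f c n \<le> energy r (\<lambda>n t. f n t + f1 n t) c n"
      by (simp add: energy_def left_diff_distrib)
    then show ?case using c(2)[OF elim(1)] a1(2)[OF elim(1)] elim(2) by linarith
  qed
  moreover have "a1 / 8 > 0" using a1(1) by simp
  ultimately show "consistent M W \<sigma> K r (\<lambda>n t. f n t + f1 n t)"
    using consistent_iff_energy[OF r(2) g gB] c(1) by blast
qed

text \<open>A constant has all its energy at frequency 0, so no tail beyond any l > 0; such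
  functions serve as fillers of prescribed norm.\<close>

lemma constant_in_ball:
  assumes "\<gamma> > 0" shows "(\<lambda>_. k) \<in> scale_set \<gamma> (besov_ball s P\<^sub>0)"
proof -
  have k: "(\<lambda>_. k) = (\<lambda>t. k * cas 0 t)" by simp
  have L: "(\<lambda>_. k) \<in> L2_per" unfolding k by (rule L2_per_cmult[OF cas_L2_per])
  have "low 0 = {0}" by auto
  then have "proj 0 (\<lambda>_. k) = (\<lambda>_. k)"
    using unit.prob_space by (simp add: proj_def[abs_def] hartley_def space_unit)
  moreover have "proj 0 (\<lambda>_. k) \<in> scale_set \<gamma> (besov_ball s P\<^sub>0)"
    by (rule proj_in_scaled_ball[OF L assms s_pos P]) simp
  ultimately show ?thesis by simp
qed

text \<open>A sequence that keeps low-frequency energy along a subsequence is there not orthogonal to its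
  own truncation.\<close>

lemma orthogonal_imp_inconsistent:
  assumes o: "\<And>\<gamma> f1. \<gamma> > 0 \<Longrightarrow> \<forall>n\<ge>1. f1 n \<in> scale_set \<gamma> (besov_ball s P\<^sub>0) \<Longrightarrow>
      same_order (\<lambda>n. L2_norm (f1 n)) (\<lambda>n. real n powr (- r)) \<Longrightarrow>
      (\<lambda>n. (L2_norm (\<lambda>t. f n t + f1 n t))\<^sup>2 - ((L2_norm (f n))\<^sup>2 + (L2_norm (f1 n))\<^sup>2)) \<in> o(\<lambda>n. real n powr (- 2 * r))"
  shows "inconsistent M W \<sigma> K r f"
  unfolding inconsistent_iff
proof (intro allI impI order_tendstoI)
  fix c e :: real assume "e < 0"
  then show "eventually (\<lambda>n. e < energy r f c n) sequentially"
    using energy_nonneg by (intro always_eventually allI) (rule less_le_trans)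
next
  fix c e :: real assume c: "c > 0" and e: "0 < e"
  let ?hit = "\<lambda>n. energy r f c n \<ge> e"
  \<comment> \<open>Where the energy is small the truncation could violate the lower order bound, so
    a constant of normalized squared norm 1 stands in for it.\<close>
  define f1 where "f1 n = (if ?hit n then proj (c * real n powr (2 - 4 * r)) (f n) else (\<lambda>_. real n powr (- r)))" for n
  note \<gamma> = ball_scale_pos[OF c b_pos P, of s]
  have ball: "\<forall>n\<ge>1. f1 n \<in> scale_set (ball_scale s P\<^sub>0 b c) (besov_ball s P\<^sub>0)"
    using truncation_in_ball[where f=f, OF _ _ c b_pos b r s P] constant_in_ball[OF \<gamma>] f by (simp add: f1_def)
  have N: "(L2_norm (f1 n))\<^sup>2 * real n powr (2 * r) = (if ?hit n then energy r f c n else 1)" if n: "n \<ge> 1" for n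
  proof (cases "?hit n")
    case False
    then show ?thesis using rate_powr(1)[OF n, of r] unit.prob_space by (simp add: f1_def L2_norm_power2 space_unit)
  qed (simp add: f1_def L2_norm_proj energy_def)
  have le: "energy r f c n \<le> b" if n: "n \<ge> 1" for n
  proof -
    have "energy r f c n \<le> (L2_norm (f n))\<^sup>2 * real n powr (2 * r)"
      unfolding energy_def using f n by (intro mult_right_mono low_energy_le_norm) auto
    with b[OF n] show ?thesis by simp
  qed
  have "same_order (\<lambda>n. L2_norm (f1 n)) (\<lambda>n. real n powr (- r))"
    unfolding same_order_norm_iff
  proof (rule exI[of _ "min e 1"], rule exI[of _ "max b 1"], intro conjI allI impI)
    fix n :: nat assume n: "n \<ge> 1"
    show "min e 1 \<le> (L2_norm (f1 n))\<^sup>2 * real n powr (2 * r)" "(L2_norm (f1 n))\<^sup>2 * real n powr (2 * r) \<le> max b 1"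
      using le[OF n] by (auto simp: N[OF n])
  qed (use e in auto)
  from o[OF \<gamma> ball this]
  have "(\<lambda>n. \<bar>L2_inner (f n) (f1 n)\<bar> * real n powr (2 * r)) \<longlonglongrightarrow> 0"
  proof (subst (asm) norm_sum_rate_iff)
    show "f1 n \<in> L2_per" if "n \<ge> 1" for n
      by (rule scaled_ball_tail(1)[of _ "ball_scale s P\<^sub>0 b c" s P\<^sub>0 1]) (use ball that in auto)
  qed
  then have "eventually (\<lambda>n. \<bar>L2_inner (f n) (f1 n)\<bar> * real n powr (2 * r) < e) sequentially"
    using e by (intro order_tendstoD(2)) auto
  with eventually_ge_at_top[of 1] show "eventually (\<lambda>n. energy r f c n < e) sequentially"
  proof eventually_elim
    case (elim n)
    show ?case
    proof (rule ccontr)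
      assume "\<not> energy r f c n < e"
      then have hit: "?hit n" by simp
      have "L2_inner (f n) (f1 n) = low_energy (f n) (c * real n powr (2 - 4 * r))"
        using hit inner_proj_self f elim by (simp add: f1_def)
      then have "\<bar>L2_inner (f n) (f1 n)\<bar> * real n powr (2 * r) = energy r f c n"
        by (simp add: energy_def low_energy_nonneg)
      with hit elim show False by simp
    qed
  qed
qed

end

end

theorem theorem5p2:
  fixes M :: "'w measure" and W :: "'w \<Rightarrow> observation"
    and \<sigma> r s P\<^sub>0 :: real and K :: "real \<Rightarrow> real" and f :: "nat \<Rightarrow> real \<Rightarrow> real"
  assumes "gaussian_white_noise M W"
    and "\<sigma> > 0"
    and "admissible_kernel K"
    and "0 < r" and "r < 1 / 2" and "s = r / (2 - 4 * r)"
    and "P\<^sub>0 > 0"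
    and "\<forall>n\<ge>1. f n \<in> L2_per"
    and "same_order (\<lambda>n. L2_norm (f n)) (\<lambda>n. real n powr (- r))"
  shows "(consistent M W \<sigma> K r f \<longleftrightarrow>
           (\<exists>\<gamma>>0. \<exists>f1. (\<forall>n\<ge>1. f1 n \<in> scale_set \<gamma> (besov_ball s P\<^sub>0)) \<and>
              same_order (\<lambda>n. L2_norm (f1 n)) (\<lambda>n. real n powr (- r)) \<and>
              (\<forall>n\<ge>1. (L2_norm (f n))\<^sup>2 =
                 (L2_norm (f1 n))\<^sup>2 + (L2_norm (\<lambda>t. f n t - f1 n t))\<^sup>2)))
       \<and> (inconsistent M W \<sigma> K r f \<longleftrightarrow>
           (\<forall>\<gamma>>0. \<forall>f1. (\<forall>n\<ge>1. f1 n \<in> scale_set \<gamma> (besov_ball s P\<^sub>0)) \<longrightarrow>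
              same_order (\<lambda>n. L2_norm (f1 n)) (\<lambda>n. real n powr (- r)) \<longrightarrow>
              consistent M W \<sigma> K r (\<lambda>n t. f n t + f1 n t) \<and>
              (\<lambda>n. (L2_norm (\<lambda>t. f n t + f1 n t))\<^sup>2
                    - ((L2_norm (f n))\<^sup>2 + (L2_norm (f1 n))\<^sup>2))
                \<in> o(\<lambda>n. real n powr (- 2 * r))))"
proof -
  interpret gaussian_white_noise M W by (rule assms(1))
  interpret kernel_noise M W K \<sigma> by unfold_locales (rule assms)+
  obtain a b where a: "0 < a" "\<And>n. n \<ge> 1 \<Longrightarrow> a \<le> (L2_norm (f n))\<^sup>2 * real n powr (2 * r)"
    and b: "\<And>n. n \<ge> 1 \<Longrightarrow> (L2_norm (f n))\<^sup>2 * real n powr (2 * r) \<le> b"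
    using assms(9) unfolding same_order_norm_iff by blast
  note facts = assms(4-8) a b
  show ?thesis
  proof (intro conjI iffI)
    assume "consistent M W \<sigma> K r f"
    from consistent_imp_component[OF facts this]
    show "\<exists>\<gamma>>0. \<exists>f1. (\<forall>n\<ge>1. f1 n \<in> scale_set \<gamma> (besov_ball s P\<^sub>0)) \<and>
      same_order (\<lambda>n. L2_norm (f1 n)) (\<lambda>n. real n powr (- r)) \<and>
      (\<forall>n\<ge>1. (L2_norm (f n))\<^sup>2 = (L2_norm (f1 n))\<^sup>2 + (L2_norm (\<lambda>t. f n t - f1 n t))\<^sup>2)" .
  next
    assume "\<exists>\<gamma>>0. \<exists>f1. (\<forall>n\<ge>1. f1 n \<in> scale_set \<gamma> (besov_ball s P\<^sub>0)) \<and>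
      same_order (\<lambda>n. L2_norm (f1 n)) (\<lambda>n. real n powr (- r)) \<and>
      (\<forall>n\<ge>1. (L2_norm (f n))\<^sup>2 = (L2_norm (f1 n))\<^sup>2 + (L2_norm (\<lambda>t. f n t - f1 n t))\<^sup>2)"
    then obtain \<gamma> f1 where \<gamma>: "\<gamma> > 0" and f1: "\<And>n. n \<ge> 1 \<Longrightarrow> f1 n \<in> scale_set \<gamma> (besov_ball s P\<^sub>0)"
      and so: "same_order (\<lambda>n. L2_norm (f1 n)) (\<lambda>n. real n powr (- r))"
      and py: "\<And>n. n \<ge> 1 \<Longrightarrow> (L2_norm (f n))\<^sup>2 = (L2_norm (f1 n))\<^sup>2 + (L2_norm (\<lambda>t. f n t - f1 n t))\<^sup>2"
      by blast
    show "consistent M W \<sigma> K r f" by (rule component_imp_consistent[OF facts \<gamma> f1 so py])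
  next
    assume inc: "inconsistent M W \<sigma> K r f"
    show "\<forall>\<gamma>>0. \<forall>f1. (\<forall>n\<ge>1. f1 n \<in> scale_set \<gamma> (besov_ball s P\<^sub>0)) \<longrightarrow>
      same_order (\<lambda>n. L2_norm (f1 n)) (\<lambda>n. real n powr (- r)) \<longrightarrow>
      consistent M W \<sigma> K r (\<lambda>n t. f n t + f1 n t) \<and>
      (\<lambda>n. (L2_norm (\<lambda>t. f n t + f1 n t))\<^sup>2 - ((L2_norm (f n))\<^sup>2 + (L2_norm (f1 n))\<^sup>2)) \<in> o(\<lambda>n. real n powr (- 2 * r))"
    proof (intro allI impI)
      fix \<gamma> f1
      assume \<gamma>: "\<gamma> > 0" and f1: "\<forall>n\<ge>1. f1 n \<in> scale_set \<gamma> (besov_ball s P\<^sub>0)"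
        and so: "same_order (\<lambda>n. L2_norm (f1 n)) (\<lambda>n. real n powr (- r))"
      have f1': "f1 n \<in> scale_set \<gamma> (besov_ball s P\<^sub>0)" if "n \<ge> 1" for n using f1 that by blast
      show "consistent M W \<sigma> K r (\<lambda>n t. f n t + f1 n t) \<and>
        (\<lambda>n. (L2_norm (\<lambda>t. f n t + f1 n t))\<^sup>2 - ((L2_norm (f n))\<^sup>2 + (L2_norm (f1 n))\<^sup>2)) \<in> o(\<lambda>n. real n powr (- 2 * r))"
        using inconsistent_imp_orthogonal[OF facts inc \<gamma> f1' so] by (rule conjI)
    qed
  next
    assume o: "\<forall>\<gamma>>0. \<forall>f1. (\<forall>n\<ge>1. f1 n \<in> scale_set \<gamma> (besov_ball s P\<^sub>0)) \<longrightarrow>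
      same_order (\<lambda>n. L2_norm (f1 n)) (\<lambda>n. real n powr (- r)) \<longrightarrow>
      consistent M W \<sigma> K r (\<lambda>n t. f n t + f1 n t) \<and>
      (\<lambda>n. (L2_norm (\<lambda>t. f n t + f1 n t))\<^sup>2 - ((L2_norm (f n))\<^sup>2 + (L2_norm (f1 n))\<^sup>2)) \<in> o(\<lambda>n. real n powr (- 2 * r))"
    show "inconsistent M W \<sigma> K r f"
    proof (rule orthogonal_imp_inconsistent[OF facts])
      fix \<gamma> f1
      assume \<gamma>: "\<gamma> > 0" and f1: "\<forall>n\<ge>1. f1 n \<in> scale_set \<gamma> (besov_ball s P\<^sub>0)"
        and so: "same_order (\<lambda>n. L2_norm (f1 n)) (\<lambda>n. real n powr (- r))"
      show "(\<lambda>n. (L2_norm (\<lambda>t. f n t + f1 n t))\<^sup>2 - ((L2_norm (f n))\<^sup>2 + (L2_norm (f1 n))\<^sup>2)) \<in> o(\<lambda>n. real n powr (- 2 * r))"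
        by (rule conjunct2[OF mp[OF mp[OF spec[OF mp[OF spec[OF o] \<gamma>]] f1] so]])
    qed
  qed
qed

end
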